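(* Let $\Gamma\subset\mathbb{R}^2$ be a line segment of unit length, let $f\in C^\infty(\Gamma)$, let the weight profile $\theta$ have regularity order $q\ge0$, and let $\varepsilon=\varepsilon(h)=\Theta(h^\alpha)$ with $\alpha\in[0,1]$. For a rotation $\eta\in\mathrm{SO}(2)$ and a translation $\boldsymbol\xi\in[0,1]^2$ let $\mathcal{I}_h(f;\eta,\boldsymbol\xi)$ denote the implicit boundary integral with tube width $\varepsilon$ on the transformed segment $\eta\Gamma+h\boldsymbol\xi$. Then, as $h\to0^+$, $$\int_{[0,1]^2}\int_{\mathrm{SO}(2)}\left|\mathcal{I}_h(f;\eta,\boldsymbol\xi)-\mathcal{I}(f)\right|^2d\eta\,d\boldsymbol\xi=\begin{cases}\mathcal{O}\left(h^{3-\alpha}\right), & \alpha\in\left[0,\frac{2q}{2q+1}\right),\\[1ex]\mathcal{O}\left(h^{1+(2q+2)(1-\alpha)}\right), & \alpha\in\left[\frac{2q}{2q+1},1\right],\end{cases}$$ where $d\eta$ is the normalized Haar measure on $\mathrm{SO}(2)$.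
   Context: $\mathbf{n}$ is a unit normal vector of the segment and $T_\varepsilon=\{\mathbf{x}+t\mathbf{n}:(\mathbf{x},t)\in\Gamma\times[-\varepsilon,\varepsilon]\}$ is the rectangular tube. Weight profile of regularity order $q\in\{0,1,2,\dots\}$: a fixed function $\theta:\mathbb{R}\to\mathbb{R}$ with $\mathrm{supp}\,\theta=[-1,1]$, $\int_{-1}^1\theta=1$; if $q\ge1$, $\theta\in C^{q-1}(\mathbb{R})$ and $\theta^{(q)}$ is piecewise $C^1$; if $q=0$, $\theta\in L^\infty$ is piecewise $C^1$ (piecewise $C^1$: finitely many pieces, $C^1$ up to the closure on each). $\theta_\varepsilon(s)=\varepsilon^{-1}\theta(s/\varepsilon)$. Let $\mathcal{Q}_\Gamma(\mathbf{x}+t\mathbf{n})=f(\mathbf{x})\,\theta_\varepsilon(t)$ for $\mathbf{x}\in\Gamma$, $|t|\le\varepsilon$, and $\mathcal{Q}_\Gamma=0$ outside $T_\varepsilon$. $\mathcal{I}(f)=\int_\Gamma f\,d\sigma$, and (the integrand being transported with the segment) $\mathcal{I}_h(f;\eta,\boldsymbol\xi)=h^2\sum_{\mathbf{w}\in\mathbb{Z}^2}\mathcal{Q}_\Gamma\left(h\eta^{-1}(\mathbf{w}-\boldsymbol\xi)\right)$. $\varepsilon=\Theta(h^\alpha)$ means $c_1h^\alpha\le\varepsilon\le c_2h^\alpha$ with constants $c_1,c_2>0$; the constants in $\mathcal{O}$ are independent of $h$. *)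

theory Defs
  imports "HOL-Analysis.Analysis" "HOL-Library.Landau_Symbols"
begin

subsection \<open>Weight profiles\<close>

text \<open>Values of \<open>g\<close> at the finitely many breakpoints \<open>S\<close> are unrestricted. On each open piece \<open>C\<close>,
  \<open>g\<close> agrees with a function \<open>G\<close> that is continuously differentiable on the closed piece
  (one-sidedly at its endpoints).\<close>

definition piecewise_C1_off :: "real set \<Rightarrow> (real \<Rightarrow> real) \<Rightarrow> bool" where
  "piecewise_C1_off S g \<longleftrightarrow> finite S \<and>
     (\<forall>C \<in> components (- S). \<exists>G G'.
        (\<forall>t \<in> C. g t = G t) \<and>
        (\<forall>t \<in> closure C. (G has_real_derivative G' t) (at t within closure C)) \<and>
        continuous_on (closure C) G')"

definition C_on_reals :: "nat \<Rightarrow> (real \<Rightarrow> real) \<Rightarrow> bool" where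
  "C_on_reals k g \<longleftrightarrow>
     (\<forall>j<k. (deriv ^^ j) g differentiable_on UNIV) \<and> continuous_on UNIV ((deriv ^^ k) g)"

definition L_infinity :: "(real \<Rightarrow> real) \<Rightarrow> bool" where
  "L_infinity g \<longleftrightarrow> g \<in> borel_measurable lebesgue \<and> (\<exists>B. AE t in lebesgue. \<bar>g t\<bar> \<le> B)"

text \<open>For \<open>q \<ge> 1\<close> the derivative of order \<open>q\<close> need only exist off the breakpoints \<open>S\<close>.\<close>

definition weight_profile :: "nat \<Rightarrow> (real \<Rightarrow> real) \<Rightarrow> bool" where
  "weight_profile q \<theta> \<longleftrightarrow>
     closure {s. \<theta> s \<noteq> 0} = {-1..1} \<and>
     (\<theta> has_integral 1) {-1..1} \<and>
     (if q = 0 then L_infinity \<theta> \<and> (\<exists>S. piecewise_C1_off S \<theta>)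
      else C_on_reals (q - 1) \<theta> \<and>
           (\<exists>S. (\<forall>t \<in> - S. (deriv ^^ (q - 1)) \<theta> differentiable (at t)) \<and>
                piecewise_C1_off S ((deriv ^^ q) \<theta>)))"

definition scaled_weight :: "(real \<Rightarrow> real) \<Rightarrow> real \<Rightarrow> real \<Rightarrow> real" where
  "scaled_weight \<theta> \<epsilon> s = \<theta> (s / \<epsilon>) / \<epsilon>"


subsection \<open>Functions on a segment\<close>

text \<open>\<open>D k\<close> is the derivative of order \<open>k\<close> along the segment, one-sided at the two endpoints.\<close>

definition smooth_on_segment :: "real^2 \<Rightarrow> real^2 \<Rightarrow> (real^2 \<Rightarrow> real) \<Rightarrow> bool" where
  "smooth_on_segment a b f \<longleftrightarrow>
     (\<exists>D :: nat \<Rightarrow> real \<Rightarrow> real.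
        (\<forall>s \<in> {0..1}. D 0 s = f (linepath a b s)) \<and>
        (\<forall>k. \<forall>s \<in> {0..1}. (D k has_real_derivative D (Suc k) s) (at s within {0..1})))"

text \<open>Integral with respect to arc length.\<close>

definition segment_integral :: "real^2 \<Rightarrow> real^2 \<Rightarrow> (real^2 \<Rightarrow> real) \<Rightarrow> real" where
  "segment_integral a b f = integral {0..1} (\<lambda>s. f (linepath a b s) * dist a b)"


subsection \<open>The implicit boundary integral\<close>

definition tube :: "(real^2) set \<Rightarrow> real^2 \<Rightarrow> real \<Rightarrow> (real^2) set" where
  "tube \<Gamma> n \<epsilon> = {x + t *\<^sub>R n | x t. x \<in> \<Gamma> \<and> t \<in> {-\<epsilon>..\<epsilon>}}"

text \<open>The decomposition \<open>z = x + t *\<^sub>R n\<close> is unique when \<open>n\<close> is a unit normal of the segment \<open>\<Gamma>\<close>;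
  see \<open>tube_integrand_tube\<close> below.\<close>

definition tube_integrand ::
  "(real^2) set \<Rightarrow> real^2 \<Rightarrow> (real^2 \<Rightarrow> real) \<Rightarrow> (real \<Rightarrow> real) \<Rightarrow> real \<Rightarrow> real^2 \<Rightarrow> real" where
  "tube_integrand \<Gamma> n f \<theta> \<epsilon> z =
     (if z \<in> tube \<Gamma> n \<epsilon>
      then (THE v. \<exists>x \<in> \<Gamma>. \<exists>t \<in> {-\<epsilon>..\<epsilon>}. z = x + t *\<^sub>R n \<and> v = f x * scaled_weight \<theta> \<epsilon> t)
      else 0)"

text \<open>The sum runs over the integer lattice; for bounded \<open>\<Gamma>\<close> and \<open>h > 0\<close> only finitely many
  terms are nonzero.\<close>

definition implicit_boundary_integral ::
  "(real^2) set \<Rightarrow> real^2 \<Rightarrow> (real \<Rightarrow> real) \<Rightarrow> real \<Rightarrow> real \<Rightarrow> (real^2 \<Rightarrow> real) \<Rightarrow>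
     real^2^2 \<Rightarrow> real^2 \<Rightarrow> real" where
  "implicit_boundary_integral \<Gamma> n \<theta> \<epsilon> h f \<eta> \<xi> =
     h\<^sup>2 * (\<Sum>\<^sub>\<infinity>w \<in> {w. \<forall>i. w $ i \<in> \<int>}.
             tube_integrand \<Gamma> n f \<theta> \<epsilon> (h *\<^sub>R (matrix_inv \<eta> *v (w - \<xi>))))"

lemma tube_integrand_tube:
  assumes n: "norm n = 1" "n \<bullet> (b - a) = 0"
    and x: "x \<in> closed_segment a b" and t: "\<bar>t\<bar> \<le> \<epsilon>"
  shows "tube_integrand (closed_segment a b) n f \<theta> \<epsilon> (x + t *\<^sub>R n) = f x * scaled_weight \<theta> \<epsilon> t"
proof -
  have seg: "n \<bullet> y = n \<bullet> a" if y: "y \<in> closed_segment a b" for y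
  proof -
    obtain u where "y = a + u *\<^sub>R (b - a)"
      using y by (auto simp: in_segment algebra_simps)
    then show ?thesis using n by (simp add: inner_add_right)
  qed
  have nn: "n \<bullet> n = 1" using n by (simp add: norm_eq_1)
  have uniq: "y = x \<and> s = t"
    if "y \<in> closed_segment a b" "x + t *\<^sub>R n = y + s *\<^sub>R n" for y s
  proof -
    have "n \<bullet> (x + t *\<^sub>R n) = n \<bullet> (y + s *\<^sub>R n)" using that by simp
    then have "s = t" using seg[OF x] seg[OF that(1)] nn by (simp add: inner_add_right)
    then show ?thesis using that by simp
  qed
  have "x + t *\<^sub>R n \<in> tube (closed_segment a b) n \<epsilon>"
    using x t unfolding tube_def by (auto simp: abs_le_iff intro!: exI[of _ x] exI[of _ t])
  moreover have "(THE v. \<exists>y \<in> closed_segment a b. \<exists>s \<in> {-\<epsilon>..\<epsilon>}.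
      x + t *\<^sub>R n = y + s *\<^sub>R n \<and> v = f y * scaled_weight \<theta> \<epsilon> s) = f x * scaled_weight \<theta> \<epsilon> t"
  proof (rule the_equality)
    show "\<exists>y \<in> closed_segment a b. \<exists>s \<in> {-\<epsilon>..\<epsilon>}. x + t *\<^sub>R n = y + s *\<^sub>R n \<and>
        f x * scaled_weight \<theta> \<epsilon> t = f y * scaled_weight \<theta> \<epsilon> s"
      using x t by (intro bexI[of _ x] bexI[of _ t]) auto
  qed (use uniq in blast)
  ultimately show ?thesis by (simp add: tube_integrand_def)
qed


subsection \<open>Haar measure on the rotation group\<close>

definition SO2 :: "(real^2^2) set" where
  "SO2 = {\<eta>. rotation_matrix \<eta>}"

text \<open>Normalized left Haar measure: the left-invariant Borel probability measure. Existence is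
  \<open>normalized_haar_SO2_exists\<close>.\<close>

definition normalized_haar_SO2 :: "(real^2^2) measure \<Rightarrow> bool" where
  "normalized_haar_SO2 \<mu> \<longleftrightarrow>
     sets \<mu> = sets (restrict_space borel SO2) \<and>
     emeasure \<mu> SO2 = 1 \<and>
     (\<forall>R \<in> SO2. \<forall>A \<in> sets \<mu>. emeasure \<mu> ((\<lambda>\<eta>. R ** \<eta>) ` A) = emeasure \<mu> A)"

definition rot :: "real \<Rightarrow> real^2^2" where
  "rot \<phi> = vector [vector [cos \<phi>, - sin \<phi>], vector [sin \<phi>, cos \<phi>]]"

lemma rot_in_SO2: "rot \<phi> \<in> SO2"
  by (auto simp: SO2_def rotation_matrix_def orthogonal_matrix rot_def det_2 vec_eq_iff
      matrix_matrix_mult_def transpose_def sum_2 forall_2 mat_def simp flip: power2_eq_square)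

lemma rot_add: "rot (\<phi> + \<psi>) = rot \<phi> ** rot \<psi>"
  by (auto simp: rot_def vec_eq_iff matrix_matrix_mult_def sum_2 forall_2 cos_add sin_add)

lemma rot_0: "rot 0 = mat 1"
  by (auto simp: rot_def vec_eq_iff forall_2 mat_def)

lemma rot_periodic: "rot (\<phi> + 2 * pi) = rot \<phi>"
  by (simp add: rot_def)

lemma SO2_imp_rot:
  assumes "R \<in> SO2"
  obtains \<phi> where "0 \<le> \<phi>" "\<phi> < 2 * pi" "R = rot \<phi>"
proof -
  have o: "transpose R ** R = mat 1" "R ** transpose R = mat 1" and d: "det R = 1"
    using assms by (auto simp: SO2_def rotation_matrix_def orthogonal_matrix_def)
  define p q r s where "p = R$1$1" and "q = R$1$2" and "r = R$2$1" and "s = R$2$2"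
  have 1: "p * p + r * r = 1" "q * q + s * s = 1" "p * q + r * s = 0"
    using o(1) by (auto simp: vec_eq_iff matrix_matrix_mult_def transpose_def sum_2 forall_2
        mat_def p_def q_def r_def s_def)
  have 2: "p * s - q * r = 1" using d by (simp add: det_2 p_def q_def r_def s_def)
  have "(p - s)\<^sup>2 + (q + r)\<^sup>2 = 0"
    using 1 2 by (simp add: power2_eq_square algebra_simps)
  then have 3: "s = p" "q = - r" by (auto simp: sum_power2_eq_zero_iff)
  obtain \<phi> where "0 \<le> \<phi>" "\<phi> < 2 * pi" "p = cos \<phi>" "r = sin \<phi>"
    using sincos_total_2pi[of p r] 1 by (auto simp: power2_eq_square)
  moreover from this have "R = rot \<phi>"
    using 3 by (auto simp: vec_eq_iff forall_2 rot_def p_def q_def r_def s_def)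
  ultimately show thesis using that by blast
qed

lemma continuous_rot: "continuous_on UNIV rot"
proof -
  have eq: "rot = (\<lambda>\<phi>. \<chi> i j. rot \<phi> $ i $ j)"
    by (simp add: vec_eq_iff fun_eq_iff)
  have "continuous_on UNIV (\<lambda>\<phi>. rot \<phi> $ i $ j)" for i j
    using exhaust_2[of i] exhaust_2[of j] by (auto simp: rot_def continuous_on_cos continuous_on_sin continuous_on_minus)
  then show ?thesis
    by (subst eq) (intro continuous_on_vec_lambda)
qed

lemma rot_measurable [measurable]: "rot \<in> borel \<rightarrow>\<^sub>M restrict_space borel SO2"
  using rot_in_SO2 borel_measurable_continuous_onI[OF continuous_rot]
  by (auto intro!: measurable_restrict_space2)

lemma emeasure_lborel_periodic:
  fixes N :: "real set"
  assumes N [measurable]: "N \<in> sets borel" and per: "\<And>x. x + p \<in> N \<longleftrightarrow> x \<in> N"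
    and c: "0 \<le> c" "c < p"
  shows "emeasure lborel (((+) c ` N) \<inter> {0..<p}) = emeasure lborel (N \<inter> {0..<p})"
proof -
  have shift: "emeasure lborel ((+) d ` X) = emeasure lborel X" if "X \<in> sets borel" for X d
  proof -
    have im: "(+) d ` X = (\<lambda>y. - d + y) -` X"
    proof (intro set_eqI iffI)
      fix y assume "y \<in> (\<lambda>y. - d + y) -` X"
      then show "y \<in> (+) d ` X" by (intro image_eqI[of _ _ "- d + y"]) auto
    qed auto
    have "(\<lambda>y. - d + y) -` X \<inter> space borel \<in> sets borel"
      by (rule measurable_sets[OF _ that]) simp
    then have "emeasure (distr lborel borel ((+) d)) ((+) d ` X) = emeasure lborel ((+) d -` ((+) d ` X))"
      using im by (subst emeasure_distr) auto
    also have "(+) d -` ((+) d ` X) = X" by auto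
    finally show ?thesis by (simp add: lborel_distr_plus)
  qed
  have "(+) c ` N \<inter> {0..<p} = (+) c ` (N \<inter> {-c..<p - c})" by force
  then have "emeasure lborel ((+) c ` N \<inter> {0..<p}) = emeasure lborel (N \<inter> {-c..<p - c})"
    by (simp add: shift)
  also have "N \<inter> {-c..<p - c} = (N \<inter> {-c..<0}) \<union> (N \<inter> {0..<p - c})" using c by auto
  also have "emeasure lborel \<dots> = emeasure lborel (N \<inter> {-c..<0}) + emeasure lborel (N \<inter> {0..<p - c})"
    by (rule plus_emeasure[symmetric]) auto
  also have "emeasure lborel (N \<inter> {-c..<0}) = emeasure lborel ((+) p ` (N \<inter> {-c..<0}))"
    by (simp add: shift)
  also have "(+) p ` (N \<inter> {-c..<0}) = N \<inter> {p - c..<p}"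
  proof -
    have "y \<in> (+) p ` (N \<inter> {-c..<0})" if "y \<in> N" "p - c \<le> y" "y < p" for y
      using that per[of "y - p"] by (intro image_eqI[of _ _ "y - p"]) auto
    then show ?thesis using per by (auto simp: add.commute)
  qed
  also have "emeasure lborel (N \<inter> {p - c..<p}) + emeasure lborel (N \<inter> {0..<p - c}) =
      emeasure lborel ((N \<inter> {p - c..<p}) \<union> (N \<inter> {0..<p - c}))"
    by (rule plus_emeasure) auto
  also have "(N \<inter> {p - c..<p}) \<union> (N \<inter> {0..<p - c}) = N \<inter> {0..<p}" using c by auto
  finally show ?thesis .
qed

lemma normalized_haar_SO2_exists: "\<exists>\<mu>. normalized_haar_SO2 \<mu>"
proof -
  let ?I = "{0..<2 * pi}"
  let ?U = "uniform_measure lborel ?I"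
  let ?\<mu> = "distr ?U (restrict_space borel SO2) rot"
  have meas: "rot \<in> ?U \<rightarrow>\<^sub>M restrict_space borel SO2"
    using rot_measurable by (simp cong: measurable_cong_sets)
  have em: "emeasure ?\<mu> A = emeasure lborel ((rot -` A) \<inter> ?I) / emeasure lborel ?I"
    if A: "A \<in> sets (restrict_space borel SO2)" for A
  proof -
    have "rot -` A \<in> sets borel" using measurable_sets[OF rot_measurable A] by simp
    then show ?thesis
      using meas A by (simp add: emeasure_distr Int_commute)
  qed
  have sp: "SO2 \<in> sets (restrict_space borel SO2)"
    using sets.top[of "restrict_space borel SO2"] by (simp add: space_restrict_space)
  have "rot -` SO2 = UNIV" using rot_in_SO2 by auto
  then have one: "emeasure ?\<mu> SO2 = 1"
    using em[OF sp] by (simp add: ennreal_divide_self pi_gt_zero)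
  have inv: "emeasure ?\<mu> ((\<lambda>\<eta>. R ** \<eta>) ` A) = emeasure ?\<mu> A"
    if R: "R \<in> SO2" and A: "A \<in> sets (restrict_space borel SO2)" for R A
  proof -
    obtain c where c: "0 \<le> c" "c < 2 * pi" "R = rot c" using SO2_imp_rot[OF R] .
    have "rot c ** rot (-c) = mat 1" "rot (-c) ** rot c = mat 1"
      using rot_0 by (simp_all flip: rot_add)
    then have cancel: "rot c ** (rot (-c) ** X) = X" "rot (-c) ** (rot c ** X) = X" for X
      by (simp_all add: matrix_mul_assoc)
    have ASO: "A \<subseteq> SO2" using sets.sets_into_space[OF A] by (simp add: space_restrict_space)
    have mulSO: "rot d ** X \<in> SO2" if "X \<in> SO2" for d X
      using that SO2_imp_rot[OF that] rot_add rot_in_SO2 by metis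
    have img: "(\<lambda>\<eta>. R ** \<eta>) ` A = (\<lambda>\<eta>. rot (-c) ** \<eta>) -` A \<inter> space (restrict_space borel SO2)"
    proof (intro set_eqI iffI)
      fix X assume "X \<in> (\<lambda>\<eta>. R ** \<eta>) ` A"
      then obtain Y where "Y \<in> A" "X = rot c ** Y" using c(3) by blast
      then show "X \<in> (\<lambda>\<eta>. rot (-c) ** \<eta>) -` A \<inter> space (restrict_space borel SO2)"
        using ASO mulSO cancel(2)[of Y] by (auto simp: space_restrict_space)
    next
      fix X assume "X \<in> (\<lambda>\<eta>. rot (-c) ** \<eta>) -` A \<inter> space (restrict_space borel SO2)"
      then show "X \<in> (\<lambda>\<eta>. R ** \<eta>) ` A"
        using cancel(1)[of X, symmetric] c(3) by blast
    qed
    have "continuous_on UNIV (\<lambda>X. rot (-c) ** X)"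
      unfolding matrix_matrix_mult_def by (intro continuous_on_vec_lambda continuous_intros)
    then have "(\<lambda>X. rot (-c) ** X) \<in> restrict_space borel SO2 \<rightarrow>\<^sub>M restrict_space borel SO2"
      using mulSO
      by (intro measurable_restrict_space2 measurable_restrict_space1 borel_measurable_continuous_onI)
         (auto simp: space_restrict_space)
    from measurable_sets[OF this A] have RA: "(\<lambda>\<eta>. R ** \<eta>) ` A \<in> sets (restrict_space borel SO2)"
      by (simp add: img)
    have N: "rot -` A \<in> sets borel" using measurable_sets[OF rot_measurable A] by simp
    have "rot -` ((\<lambda>\<eta>. R ** \<eta>) ` A) = (+) c ` (rot -` A)"
    proof (intro set_eqI iffI)
      fix \<phi> assume "\<phi> \<in> rot -` ((\<lambda>\<eta>. R ** \<eta>) ` A)"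
      then obtain Y where "Y \<in> A" "rot \<phi> = rot c ** Y" using c(3) by blast
      then have "rot (-c + \<phi>) \<in> A" using rot_add[of "-c" \<phi>] cancel(2)[of Y] by simp
      then show "\<phi> \<in> (+) c ` (rot -` A)" by (intro image_eqI[of _ _ "-c + \<phi>"]) auto
    qed (use c(3) rot_add in auto)
    then show ?thesis
      using em[OF A] em[OF RA] emeasure_lborel_periodic[OF N _ c(1,2)] by (simp add: rot_periodic)
  qed
  have "normalized_haar_SO2 ?\<mu>"
    unfolding normalized_haar_SO2_def using one inv by auto
  then show ?thesis ..
qed

end

(* Averaged over the translation, the squared error is the variance of the periodisation of the
   integrand; by Parseval it is the sum, over nonzero lattice frequencies k, of |Qhat(k/h)|^2, where Q
   is the integrand in the rotated frame.  In coordinates along and across the segment Qhat factors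
   into Fhat(w1) * thetahat(eps * w2) with w1^2 + w2^2 = |k|^2/h^2 = R^2, where
   |Fhat(w1)|^2 = O(1/(1+w1^2)) and |thetahat(t)|^2 = O(1/(1+t^2)^(q+1)) by q+1 integrations by parts.
   Averaging over the rotation, frequencies nearly parallel to the segment contribute R^-2 * 1/(eps R),
   those nearly normal to it contribute (eps R)^(-2q-2) * 1/R, and summing over k gives
   O(h^3/eps + h^(2q+3)/eps^(2q+2)).  Only the inequality "<=" in Parseval is needed; it is
   obtained in one variable from the density of trigonometric polynomials and then iterated. *)

theory Submission
  imports Defs "HOL-Computational_Algebra.Polynomial"
begin

subsection \<open>Parseval on the unit interval\<close>

text \<open>The obstacle is summability: a bound on |Qhat|^2 that is uniform in the direction of the
  frequency is only of order R^-2, and the sum of |k|^-2 over a planar lattice diverges. The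
  rotation supplies the missing power. In each direction one of the two components of the frequency
  is comparable to R and makes its own factor small, while the angular average of the other factor
  gains a further 1/R or 1/(eps R). The resulting R^-3 is summable over nonzero lattice points. The
  number q+1 splits as q plus one: the derivatives of order below q are continuous and vanish at -1
  and 1, so q integrations by parts leave no boundary terms, whereas the derivative of order q may
  jump and the last integration leaves bounded terms at the breakpoints. Extended by zero, f may
  jump at the ends of the segment in the same way, which is why Fhat has decay of order one. The
  factor h^2 cancels the Jacobian of the lattice scaling, so the zeroth coefficient is exactly the
  segment integral. Width and step size stay independent until the very end, and the estimates run
  through extended nonnegative integrals, where interchanges only require measurability.\<close>

definition expi :: "real \<Rightarrow> complex" where
  "expi x = cis (2 * pi * x)"

lemma expi_add: "expi (x + y) = expi x * expi y"
  by (simp add: expi_def cis_mult distrib_left)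

lemma norm_expi [simp]: "norm (expi x) = 1"
  by (simp add: expi_def)

lemma expi_of_int [simp]: "expi (of_int k) = 1"
  by (simp add: expi_def cis_multiple_2pi)

lemma expi_0 [simp]: "expi 0 = 1"
  by (simp add: expi_def)

lemma cnj_expi: "cnj (expi x) = expi (- x)"
  by (simp add: expi_def cis_cnj)

lemma expi_power: "expi x ^ n = expi (real n * x)"
  unfolding expi_def Complex.DeMoivre by (simp only: mult_ac)

lemma continuous_on_expi [continuous_intros]:
  "continuous_on S f \<Longrightarrow> continuous_on S (\<lambda>x. expi (f x))"
  unfolding expi_def by (intro continuous_intros)

lemma measurable_expi [measurable]: "expi \<in> borel_measurable borel"
  by (intro borel_measurable_continuous_onI continuous_intros)

lemma measurable_cnj [measurable]: "cnj \<in> borel_measurable borel"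
  by (intro borel_measurable_continuous_onI continuous_intros)

lemma expi_has_vector_derivative:
  "((\<lambda>x. expi (w * x)) has_vector_derivative (2 * pi * w * \<i>) * expi (w * x)) (at x within S)"
proof -
  have *: "expi (w * y) = exp (y *\<^sub>R (2 * pi * w * \<i>))" for y
    by (simp add: expi_def cis_conv_exp scaleR_conv_of_real mult_ac)
  show ?thesis
    unfolding * by (rule has_vector_derivative_eq_rhs[OF exp_scaleR_has_vector_derivative_right]) (simp only: mult.commute)
qed

text \<open>A density, in place of a restricted space, keeps the whole line and its Borel sets, so
  that measurability facts for \<open>borel\<close> apply unchanged.\<close>

definition unit_lborel :: "real measure" where
  "unit_lborel = density lborel (indicator {0..1})"

lemma sets_unit_lborel [simp, measurable_cong]: "sets unit_lborel = sets borel"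
  by (simp add: unit_lborel_def)

lemma space_unit_lborel [simp]: "space unit_lborel = UNIV"
  by (simp add: unit_lborel_def)

lemma emeasure_unit_lborel: "A \<in> sets borel \<Longrightarrow> emeasure unit_lborel A = emeasure lborel ({0..1} \<inter> A)"
  by (simp add: unit_lborel_def emeasure_density flip: indicator_inter_arith)

lemma measure_unit_lborel_UNIV [simp]: "measure unit_lborel UNIV = 1"
  by (simp add: measure_def emeasure_unit_lborel)

lemma finite_measure_unit_lborel: "finite_measure unit_lborel"
  by (rule finite_measureI) (simp add: emeasure_unit_lborel)

interpretation unit_lborel: finite_measure unit_lborel
  by (rule finite_measure_unit_lborel)

lemma nn_integral_unit_lborel:
  "u \<in> borel_measurable borel \<Longrightarrow> (\<integral>\<^sup>+x. u x \<partial>unit_lborel) = (\<integral>\<^sup>+x\<in>{0..1}. u x \<partial>lborel)"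
  by (simp add: unit_lborel_def nn_integral_density mult.commute)

lemma integral_unit_lborel:
  fixes u :: "real \<Rightarrow> 'b::{banach, second_countable_topology}"
  shows "u \<in> borel_measurable borel \<Longrightarrow> (\<integral>x. u x \<partial>unit_lborel) = (\<integral>x. indicator {0..1} x *\<^sub>R u x \<partial>lborel)"
  unfolding unit_lborel_def ennreal_indicator[symmetric]
  by (rule integral_density) auto

lemma integrable_unit_lborel_bounded:
  fixes u :: "real \<Rightarrow> 'b::{banach, second_countable_topology}"
  shows "u \<in> borel_measurable borel \<Longrightarrow> (\<And>x. norm (u x) \<le> B) \<Longrightarrow> integrable unit_lborel u"
  by (rule unit_lborel.integrable_const_bound[where B = B]) auto

text \<open>Allows the fundamental theorem of calculus for the gauge integral to evaluate the
  Lebesgue integrals of the characters.\<close>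

lemma integral_unit_lborel_has_integral:
  fixes u :: "real \<Rightarrow> complex"
  assumes u: "continuous_on UNIV u" and hi: "(u has_integral I) {0..1}"
  shows "(\<integral>x. u x \<partial>unit_lborel) = I"
proof -
  have ub: "u \<in> borel_measurable borel"
    using u by (rule borel_measurable_continuous_onI)
  have si: "set_integrable lborel {0..1} u"
    unfolding set_integrable_def
    by (rule borel_integrable_compact) (auto intro: continuous_on_subset[OF u])
  have "(\<integral>x. u x \<partial>unit_lborel) = (LINT x:{0..1}|lborel. u x)"
    by (simp add: integral_unit_lborel[OF ub] set_lebesgue_integral_def)
  also have "\<dots> = integral {0..1} u"
    by (rule set_borel_integral_eq_integral(2)[OF si])
  finally show ?thesis using hi by (simp add: integral_unique)
qed

lemma integral_expi_int: "(\<integral>x. expi (of_int m * x) \<partial>unit_lborel) = (if m = 0 then 1 else 0)"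
proof (rule integral_unit_lborel_has_integral)
  show "((\<lambda>x. expi (of_int m * x)) has_integral (if m = 0 then 1 else 0)) {0..1}"
  proof (cases "m = 0")
    case True
    then show ?thesis using has_integral_const_real[of "1::complex" 0 1] by simp
  next
    case False
    have "((\<lambda>x. (2 * pi * of_int m * \<i>) * expi (of_int m * x)) has_integral
        (expi (of_int m * 1) - expi (of_int m * 0))) {0..1}"
      using expi_has_vector_derivative[of "of_int m"]
      by (intro fundamental_theorem_of_calculus) (auto simp: mult_ac)
    then have "((\<lambda>x. (2 * pi * of_int m * \<i>) * expi (of_int m * x)) has_integral 0) {0..1}"
      using expi_of_int[of m] by simp
    then show ?thesis
      using False has_integral_mult_right_iff[of "2 * pi * of_int m * \<i>" "\<lambda>x. expi (of_int m * x)" 0 "{0..1}"]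
      by simp
  qed
qed (intro continuous_intros)

text \<open>Completing the square with orthonormal characters. The coefficients \<open>c\<close> are
  arbitrary, not those of \<open>u\<close>: dropping the last sum bounds the defect in Parseval's
  identity by the distance from \<open>u\<close> to any trigonometric polynomial, and density makes
  that distance small.\<close>

lemma trig_square_integral:
  fixes u :: "real \<Rightarrow> complex" and c :: "int \<Rightarrow> complex"
  assumes [measurable]: "u \<in> borel_measurable borel" and B: "\<And>x. norm (u x) \<le> B"
    and K: "finite K"
  defines "uh \<equiv> \<lambda>k. \<integral>x. u x * expi (- of_int k * x) \<partial>unit_lborel"
  shows "(\<integral>x. (norm (u x - (\<Sum>k\<in>K. c k * expi (of_int k * x))))\<^sup>2 \<partial>unit_lborel) =
    (\<integral>x. (norm (u x))\<^sup>2 \<partial>unit_lborel) - (\<Sum>k\<in>K. (norm (uh k))\<^sup>2) + (\<Sum>k\<in>K. (norm (uh k - c k))\<^sup>2)"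
proof -
  let ?M = unit_lborel
  define p where "p x = (\<Sum>k\<in>K. c k * expi (of_int k * x))" for x
  have B0: "0 \<le> B" using norm_ge_zero[of "u 0"] B[of 0] by linarith
  have [measurable]: "p \<in> borel_measurable borel"
    unfolding p_def by measurable
  have pB: "norm (p x) \<le> (\<Sum>k\<in>K. norm (c k))" for x
    unfolding p_def by (intro order_trans[OF norm_sum] sum_mono) (simp add: norm_mult)
  have int: "integrable ?M (\<lambda>x. f x * g x)"
    if [measurable]: "f \<in> borel_measurable borel" "g \<in> borel_measurable borel"
      and "\<And>x. norm (f x) \<le> A" "\<And>x. norm (g x) \<le> C" for f g :: "real \<Rightarrow> complex" and A C
    using that by (intro integrable_unit_lborel_bounded[where B = "A * C"])
      (auto simp: norm_mult intro!: mult_mono order_trans[OF norm_ge_zero])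
  have u1: "integrable ?M (\<lambda>x. u x * cnj (u x))" "integrable ?M (\<lambda>x. u x * cnj (p x))"
       "integrable ?M (\<lambda>x. p x * cnj (u x))" "integrable ?M (\<lambda>x. p x * cnj (p x))"
    using B pB by (auto intro!: int)
  have ue: "integrable ?M (\<lambda>x. u x * expi (- (of_int k * x)))" for k
    using B by (intro int[where C = 1]) auto
  have ue': "integrable ?M (\<lambda>x. cnj (u x) * expi (of_int k * x))" for k
    using B by (intro int[where C = 1]) auto
  have pe: "integrable ?M (\<lambda>x. p x * expi (- (of_int k * x)))" for k
    using pB by (intro int[where C = 1]) auto
  have ee: "integrable ?M (\<lambda>x. expi (of_int k * x))" for k
    by (intro integrable_unit_lborel_bounded[where B = 1]) auto
  have up: "(\<integral>x. u x * cnj (p x) \<partial>?M) = (\<Sum>k\<in>K. cnj (c k) * uh k)"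
  proof -
    have "(\<integral>x. u x * cnj (p x) \<partial>?M) = (\<integral>x. (\<Sum>k\<in>K. cnj (c k) * (u x * expi (- (of_int k * x)))) \<partial>?M)"
      by (simp add: p_def cnj_expi sum_distrib_left mult_ac)
    also have "\<dots> = (\<Sum>k\<in>K. cnj (c k) * uh k)"
      using ue by (subst Bochner_Integration.integral_sum) (auto simp: uh_def)
    finally show ?thesis .
  qed
  have pu: "(\<integral>x. p x * cnj (u x) \<partial>?M) = cnj (\<Sum>k\<in>K. cnj (c k) * uh k)"
    unfolding up[symmetric] by (subst Bochner_Integration.integral_cnj[symmetric]) (simp add: mult.commute)
  have phat: "(\<integral>x. p x * expi (- (of_int k * x)) \<partial>?M) = c k" if k: "k \<in> K" for k
  proof -
    have "(\<integral>x. p x * expi (- (of_int k * x)) \<partial>?M) = (\<integral>x. (\<Sum>j\<in>K. c j * expi (of_int (j - k) * x)) \<partial>?M)"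
      by (simp add: p_def sum_distrib_right mult.assoc left_diff_distrib flip: expi_add)
    also have "\<dots> = (\<Sum>j\<in>K. c j * (\<integral>x. expi (of_int (j - k) * x) \<partial>?M))"
      using ee by (subst Bochner_Integration.integral_sum) (auto simp del: of_int_diff)
    also have "\<dots> = (\<Sum>j\<in>K. if j = k then c j else 0)"
      by (intro sum.cong) (auto simp: integral_expi_int simp del: of_int_diff)
    finally show ?thesis using k K by simp
  qed
  have pp: "(\<integral>x. p x * cnj (p x) \<partial>?M) = (\<Sum>k\<in>K. cnj (c k) * c k)"
  proof -
    have "(\<integral>x. p x * cnj (p x) \<partial>?M) = (\<integral>x. (\<Sum>k\<in>K. cnj (c k) * (p x * expi (- (of_int k * x)))) \<partial>?M)"
      by (subst (2) p_def) (simp add: cnj_expi sum_distrib_left mult_ac)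
    also have "\<dots> = (\<Sum>k\<in>K. cnj (c k) * (\<integral>x. p x * expi (- (of_int k * x)) \<partial>?M))"
      using pe by (subst Bochner_Integration.integral_sum) auto
    finally show ?thesis using phat by simp
  qed
  \<comment> \<open>The squared norm is a product with the conjugate; the two cross terms are
    conjugate to each other.\<close>
  have "complex_of_real (\<integral>x. (norm (u x - p x))\<^sup>2 \<partial>?M) =
      (\<integral>x. u x * cnj (u x) - u x * cnj (p x) - p x * cnj (u x) + p x * cnj (p x) \<partial>?M)"
    by (subst integral_complex_of_real[symmetric])
       (simp add: complex_norm_square algebra_simps del: of_real_power)
  also have "\<dots> = (\<integral>x. u x * cnj (u x) \<partial>?M) - (\<integral>x. u x * cnj (p x) \<partial>?M) - (\<integral>x. p x * cnj (u x) \<partial>?M)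
      + (\<integral>x. p x * cnj (p x) \<partial>?M)"
    using u1 by (simp add: Bochner_Integration.integral_add Bochner_Integration.integral_diff)
  also have "\<dots> = complex_of_real ((\<integral>x. (norm (u x))\<^sup>2 \<partial>?M) - (\<Sum>k\<in>K. (norm (uh k))\<^sup>2) + (\<Sum>k\<in>K. (norm (uh k - c k))\<^sup>2))"
    unfolding up pu pp
    by (simp add: complex_norm_square algebra_simps sum.distrib sum_subtractf flip: integral_complex_of_real del: of_real_power)
  finally show ?thesis
    unfolding p_def of_real_eq_iff .
qed

section \<open>Density of trigonometric polynomials in square mean\<close>

text \<open>A Laurent polynomial in \<open>expi x\<close> whose negative powers are pulled out in
  front: sums and products become polynomial arithmetic, without index sets of frequencies.\<close>

definition trig_polynomial :: "(real \<Rightarrow> complex) \<Rightarrow> bool" where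
  "trig_polynomial p \<longleftrightarrow> (\<exists>N P. \<forall>x. p x = expi (- (real N * x)) * poly P (expi x))"

lemma trig_polynomial_add:
  assumes "trig_polynomial p" "trig_polynomial r" shows "trig_polynomial (\<lambda>x. p x + r x)"
proof -
  obtain N P M R where "\<And>x. p x = expi (- (real N * x)) * poly P (expi x)"
      "\<And>x. r x = expi (- (real M * x)) * poly R (expi x)"
    using assms unfolding trig_polynomial_def by metis
  then have "p x + r x = expi (- (real (N + M) * x)) * poly (monom 1 M * P + monom 1 N * R) (expi x)" for x
    by (simp add: poly_monom expi_power distrib_left mult.assoc[symmetric] flip: expi_add) (simp add: algebra_simps)
  then show ?thesis unfolding trig_polynomial_def by blast
qed

lemma trig_polynomial_mult:
  assumes "trig_polynomial p" "trig_polynomial r" shows "trig_polynomial (\<lambda>x. p x * r x)"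
proof -
  obtain N P M R where *: "\<And>x. p x = expi (- (real N * x)) * poly P (expi x)"
      "\<And>x. r x = expi (- (real M * x)) * poly R (expi x)"
    using assms unfolding trig_polynomial_def by metis
  have "expi (- (real (N + M) * x)) = expi (- (real N * x)) * expi (- (real M * x))" for x
    by (simp add: algebra_simps flip: expi_add)
  then have "p x * r x = expi (- (real (N + M) * x)) * poly (P * R) (expi x)" for x
    using * by simp
  then show ?thesis unfolding trig_polynomial_def by blast
qed

lemma trig_polynomial_const: "trig_polynomial (\<lambda>x. c)"
  unfolding trig_polynomial_def by (rule exI[of _ 0], rule exI[of _ "[:c:]"]) simp

lemma trig_polynomial_expi: "trig_polynomial expi"
  unfolding trig_polynomial_def by (rule exI[of _ 0], rule exI[of _ "[:0, 1:]"]) simp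

lemma trig_polynomial_expi_minus: "trig_polynomial (\<lambda>x. expi (- x))"
  unfolding trig_polynomial_def by (rule exI[of _ 1], rule exI[of _ 1]) simp

lemma trig_polynomial_sum_expi:
  assumes "trig_polynomial p"
  obtains K c where "finite K" "\<And>x. p x = (\<Sum>k\<in>K. c k * expi (of_int k * x))"
proof -
  obtain N P where p: "\<And>x. p x = expi (- (real N * x)) * poly P (expi x)"
    using assms unfolding trig_polynomial_def by blast
  \<comment> \<open>The factor in front moves the coefficient of degree \<open>i\<close> to the
    frequency \<open>i - N\<close>.\<close>
  let ?t = "\<lambda>i. int i - int N"
  have "p x = (\<Sum>k\<in>?t ` {..degree P}. coeff P (nat (k + int N)) * expi (of_int k * x))" for x
    by (subst sum.reindex)
       (auto simp: inj_on_def p poly_altdef sum_distrib_left expi_power left_diff_distrib expi_add[symmetric]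
          simp flip: expi_add intro!: sum.cong)
  then show ?thesis by (intro that) auto
qed

text \<open>Converts what Stone-Weierstrass delivers. Real polynomial functions on the plane are
  generated by constants and linear functionals; on the circle the latter are combinations of cosine
  and sine, that is, of \<open>expi x\<close> and \<open>expi (- x)\<close>.\<close>

lemma trig_polynomial_real_polynomial_function:
  fixes P :: "complex \<Rightarrow> real"
  assumes "real_polynomial_function P"
  shows "trig_polynomial (\<lambda>x. complex_of_real (P (expi x)))"
  using assms
proof induction
  case (linear f)
  interpret bounded_linear f by fact
  have "complex_of_real (f (expi x)) = of_real (f 1) * ((expi x + expi (- x)) * of_real (1/2)) +
      of_real (f \<i>) * ((expi x + (-1) * expi (- x)) * (- \<i> / 2))" for x
  proof -
    have "f (expi x) = f (Re (expi x) *\<^sub>R 1 + Im (expi x) *\<^sub>R \<i>)"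
      by (rule arg_cong[where f = f]) (simp add: complex_eq_iff)
    also have "\<dots> = Re (expi x) * f 1 + Im (expi x) * f \<i>"
      by (simp only: add scaleR) simp
    finally show ?thesis by (simp add: complex_eq_iff expi_def)
  qed
  then show ?case
    by (simp only:) (intro trig_polynomial_add trig_polynomial_mult trig_polynomial_const
      trig_polynomial_expi trig_polynomial_expi_minus)
qed (simp_all only: of_real_add of_real_mult trig_polynomial_const trig_polynomial_add trig_polynomial_mult)

text \<open>Equal end values let \<open>v\<close> descend to a continuous function on the unit
  circle, where Stone-Weierstrass applies.\<close>

lemma trig_polynomial_dense_periodic:
  fixes v :: "real \<Rightarrow> real"
  assumes v: "continuous_on {0..1} v" "v 0 = v 1" and "\<delta> > 0"
  obtains p where "trig_polynomial p" "\<And>x. x \<in> {0..1} \<Longrightarrow> norm (complex_of_real (v x) - p x) < \<delta>"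
proof -
  let ?g = "v \<circ> (\<lambda>z. Arg2pi z / (2 * pi))"
  \<comment> \<open>The homotopy is constant. Its only use is the continuity of \<open>?g\<close> on
    the circle, including the point 1 where \<open>Arg2pi\<close> jumps.\<close>
  have "homotopic_loops UNIV v v"
    using v by (simp add: homotopic_loops_refl path_def pathfinish_def pathstart_def)
  then have "homotopic_with_canon (\<lambda>h. True) (sphere 0 1) UNIV ?g ?g"
    by (rule homotopic_loops_imp_homotopic_circlemaps)
  then have "continuous_on (sphere 0 1) ?g"
    by (auto dest: homotopic_with_imp_continuous)
  then obtain P where P: "real_polynomial_function P" "\<And>z. z \<in> sphere 0 1 \<Longrightarrow> \<bar>?g z - P z\<bar> < \<delta>"
    using Stone_Weierstrass_real_polynomial_function[of "sphere 0 1 :: complex set" ?g \<delta>] \<open>\<delta> > 0\<close> by auto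
  have "?g (expi x) = v x" if "x \<in> {0..1}" for x
  proof (cases "x = 1")
    case True
    then show ?thesis using v(2) Arg2pi_unique[of 1 0 1] by (simp add: expi_def)
  next
    case False
    then have "Arg2pi (expi x) = 2 * pi * x"
      using that unfolding expi_def cis_conv_exp
      by (intro Arg2pi_unique[of 1]) (auto)
    then show ?thesis by simp
  qed
  then have "norm (complex_of_real (v x) - of_real (P (expi x))) < \<delta>" if "x \<in> {0..1}" for x
    using P(2)[of "expi x"] that by (simp flip: of_real_diff)
  with trig_polynomial_real_polynomial_function[OF P(1)] show ?thesis
    by (rule that)
qed

lemma continuous_dense_unit_lborel:
  fixes u :: "real \<Rightarrow> real"
  assumes [measurable]: "u \<in> borel_measurable borel" and B: "\<And>x. \<bar>u x\<bar> \<le> B" and "\<delta> > 0"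
  obtains v where "continuous_on UNIV v" "v 0 = 0" "v 1 = 0" "(\<integral>x. (u x - v x)\<^sup>2 \<partial>unit_lborel) < \<delta>"
proof -
  have "u measurable_on UNIV"
    by (intro lebesgue_measurable_imp_measurable_on borel_measurable_if_I measurable_completion) auto
  then obtain N g where N: "negligible N" and g: "\<And>n. continuous_on UNIV (g n)"
    and lim: "\<And>x. x \<notin> N \<Longrightarrow> (\<lambda>n. g n x) \<longlonglongrightarrow> u x"
    unfolding measurable_on_def by auto
  \<comment> \<open>Clipping to [-B, B] provides the dominating constant. The second factor is a
    cutoff that vanishes at 0 and 1 and tends to 1 in between, so the periodic end condition costs
    nothing in the limit.\<close>
  define v where "v n x = max (- B) (min B (g n x)) * min 1 (max 0 (real n * (x * (1 - x))))" for n x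
  have B0: "0 \<le> B" using B[of 0] by linarith
  have vc: "continuous_on UNIV (v n)" for n
    unfolding v_def by (intro continuous_intros g)
  have vB: "\<bar>v n x\<bar> \<le> B" for n x
  proof -
    have "\<bar>v n x\<bar> \<le> B * 1"
      unfolding v_def abs_mult using B0 by (intro mult_mono) auto
    then show ?thesis by simp
  qed
  have [measurable]: "v n \<in> borel_measurable borel" for n
    by (rule borel_measurable_continuous_onI[OF vc])
  have vlim: "(\<lambda>n. v n x) \<longlonglongrightarrow> u x" if "x \<notin> N" "x \<in> {0<..<1}" for x
  proof -
    have pos: "0 < x * (1 - x)" using that by simp
    have "(\<lambda>n. min 1 (max 0 (real n * (x * (1 - x))))) \<longlonglongrightarrow> 1"
    proof (rule tendsto_eventually)
      have "filterlim (\<lambda>n. real n * (x * (1 - x))) at_top sequentially"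
        using pos by (intro filterlim_at_top_mult_tendsto_pos[OF tendsto_const _ filterlim_real_sequentially])
      then have "\<forall>\<^sub>F n in sequentially. 1 \<le> real n * (x * (1 - x))"
        by (simp add: filterlim_at_top)
      then show "\<forall>\<^sub>F n in sequentially. min 1 (max 0 (real n * (x * (1 - x)))) = 1"
        by eventually_elim auto
    qed
    moreover have "(\<lambda>n. max (- B) (min B (g n x))) \<longlonglongrightarrow> max (- B) (min B (u x))"
      by (intro tendsto_intros lim that)
    ultimately have "(\<lambda>n. v n x) \<longlonglongrightarrow> max (- B) (min B (u x)) * 1"
      unfolding v_def by (intro tendsto_mult)
    moreover have "max (- B) (min B (u x)) = u x" using B[of x] by auto
    ultimately show ?thesis by simp
  qed
  \<comment> \<open>\<open>N\<close> is merely Lebesgue negligible; a statement about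
    \<open>lborel\<close> takes a Borel null set around it.\<close>
  obtain N' where N': "N' \<in> null_sets lborel" "N \<subseteq> N'"
    using N by (auto simp: negligible_iff_null_sets null_sets_completion_iff2)
  have ae: "AE x in unit_lborel. (\<lambda>n. (u x - v n x)\<^sup>2) \<longlonglongrightarrow> 0"
  proof -
    have "AE x in lborel. x \<notin> N' \<union> {0, 1}"
      using N'(1) by (intro AE_not_in null_sets.Un) (auto intro: countable_imp_null_set_lborel)
    then have "AE x in lborel. (0::ennreal) < indicator {0..1} x \<longrightarrow> (\<lambda>n. (u x - v n x)\<^sup>2) \<longlonglongrightarrow> 0"
    proof eventually_elim
      case (elim x)
      show ?case
      proof
        assume "(0::ennreal) < indicator {0..1} x"
        then have "x \<in> {0<..<1}" using elim by (auto simp: indicator_def order_less_le split: if_splits)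
        then have "(\<lambda>n. (u x - v n x)\<^sup>2) \<longlonglongrightarrow> (u x - u x)\<^sup>2"
          using elim N'(2) by (intro tendsto_intros vlim) auto
        then show "(\<lambda>n. (u x - v n x)\<^sup>2) \<longlonglongrightarrow> 0" by simp
      qed
    qed
    then show ?thesis
      unfolding unit_lborel_def by (subst AE_density) auto
  qed
  have "(\<lambda>n. \<integral>x. (u x - v n x)\<^sup>2 \<partial>unit_lborel) \<longlonglongrightarrow> (\<integral>x. 0 \<partial>unit_lborel)"
  proof (rule integral_dominated_convergence[OF _ _ _ ae, where w = "\<lambda>_. (2 * B)\<^sup>2"])
    show "AE x in unit_lborel. norm ((u x - v n x)\<^sup>2) \<le> (2 * B)\<^sup>2" for n
    proof (rule AE_I2)
      fix x
      have "\<bar>u x - v n x\<bar> \<le> 2 * B" using B[of x] vB[of n x] by linarith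
      then show "norm ((u x - v n x)\<^sup>2) \<le> (2 * B)\<^sup>2"
        using power_mono[of "\<bar>u x - v n x\<bar>" "2 * B" 2] by simp
    qed
  qed auto
  then have "\<forall>\<^sub>F n in sequentially. (\<integral>x. (u x - v n x)\<^sup>2 \<partial>unit_lborel) < \<delta>"
    using \<open>\<delta> > 0\<close> by (intro order_tendstoD(2)) auto
  then obtain n where "(\<integral>x. (u x - v n x)\<^sup>2 \<partial>unit_lborel) < \<delta>"
    by (auto simp: eventually_sequentially)
  then show ?thesis
    by (intro that[OF vc[of n]]) (auto simp: v_def)
qed

lemma trig_polynomial_measurable_bounded:
  assumes "trig_polynomial p"
  obtains B where "p \<in> borel_measurable borel" "\<And>x. norm (p x) \<le> B"
proof -
  obtain K c where K: "finite K" and p: "\<And>x. p x = (\<Sum>k\<in>K. c k * expi (of_int k * x))"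
    using trig_polynomial_sum_expi[OF assms] by blast
  have "p = (\<lambda>x. \<Sum>k\<in>K. c k * expi (of_int k * x))"
    using p by blast
  then have "p \<in> borel_measurable borel" by simp
  moreover have "norm (p x) \<le> (\<Sum>k\<in>K. norm (c k))" for x
    unfolding p by (intro order_trans[OF norm_sum] sum_mono) (simp add: norm_mult)
  ultimately show ?thesis by (rule that)
qed

lemma trig_polynomial_dense_real:
  fixes u :: "real \<Rightarrow> real"
  assumes [measurable]: "u \<in> borel_measurable borel" and B: "\<And>x. \<bar>u x\<bar> \<le> B" and \<delta>: "\<delta> > 0"
  obtains p where "trig_polynomial p" "(\<integral>x. (norm (complex_of_real (u x) - p x))\<^sup>2 \<partial>unit_lborel) \<le> \<delta>"
proof -
  obtain v where v: "continuous_on UNIV v" "v 0 = 0" "v 1 = 0" "(\<integral>x. (u x - v x)\<^sup>2 \<partial>unit_lborel) < \<delta> / 4"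
    using continuous_dense_unit_lborel[OF assms(1,2), of "\<delta> / 4"] \<delta> by auto
  \<comment> \<open>From (s + t)^2 \<le> 2 s^2 + 2 t^2, two errors of \<delta>/4 in square mean add
    up to at most \<delta>.\<close>
  define \<delta>' where "\<delta>' = sqrt (\<delta> / 4)"
  have d': "\<delta>' > 0" "\<delta>'\<^sup>2 = \<delta> / 4" using \<delta> by (auto simp: \<delta>'_def)
  obtain p where p: "trig_polynomial p" "\<And>x. x \<in> {0..1} \<Longrightarrow> norm (complex_of_real (v x) - p x) < \<delta>'"
    using trig_polynomial_dense_periodic[of v \<delta>'] v d' continuous_on_subset[OF v(1)] by auto
  have [measurable]: "v \<in> borel_measurable borel"
    by (rule borel_measurable_continuous_onI[OF v(1)])
  obtain C where [measurable]: "p \<in> borel_measurable borel" and C: "\<And>x. norm (p x) \<le> C"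
    using trig_polynomial_measurable_bounded[OF p(1)] by blast
  obtain V where V: "\<And>x. x \<in> {0..1} \<Longrightarrow> \<bar>v x\<bar> \<le> V"
    using compact_imp_bounded[OF compact_continuous_image[OF continuous_on_subset[OF v(1)] compact_Icc[of 0 1]]]
    by (fastforce simp: bounded_iff)
  have AE01: "AE x in unit_lborel. x \<in> {0..1}"
    unfolding unit_lborel_def by (subst AE_density) (auto simp: indicator_def intro!: AE_I2)
  have i1: "integrable unit_lborel (\<lambda>x. (u x - v x)\<^sup>2)"
  proof (rule unit_lborel.integrable_const_bound[where B = "(B + V)\<^sup>2"])
    show "AE x in unit_lborel. norm ((u x - v x)\<^sup>2) \<le> (B + V)\<^sup>2"
      using AE01
    proof eventually_elim
      case (elim x)
      have "\<bar>u x - v x\<bar> \<le> B + V" using B[of x] V[OF elim] by linarith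
      then show ?case using power_mono[of "\<bar>u x - v x\<bar>" "B + V" 2] by simp
    qed
  qed auto
  have i2: "integrable unit_lborel (\<lambda>x. (norm (complex_of_real (u x) - p x))\<^sup>2)"
  proof (rule integrable_unit_lborel_bounded[where B = "(B + C)\<^sup>2"])
    fix x
    have "norm (complex_of_real (u x) - p x) \<le> B + C"
      using B[of x] C[of x] by (intro order_trans[OF norm_triangle_ineq4]) auto
    then show "norm ((norm (complex_of_real (u x) - p x))\<^sup>2) \<le> (B + C)\<^sup>2"
      using power_mono[of "norm (complex_of_real (u x) - p x)" "B + C" 2] by simp
  qed auto
  have "(\<integral>x. (norm (complex_of_real (u x) - p x))\<^sup>2 \<partial>unit_lborel) \<le>
      (\<integral>x. 2 * (u x - v x)\<^sup>2 + 2 * \<delta>'\<^sup>2 \<partial>unit_lborel)"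
  proof (rule integral_mono_AE)
    show "AE x in unit_lborel. (norm (complex_of_real (u x) - p x))\<^sup>2 \<le> 2 * (u x - v x)\<^sup>2 + 2 * \<delta>'\<^sup>2"
      using AE01
    proof eventually_elim
      case (elim x)
      have "norm (complex_of_real (u x) - p x) \<le> norm (complex_of_real (u x) - of_real (v x)) + norm (of_real (v x) - p x)"
        by (rule order_trans[OF _ norm_triangle_ineq]) simp
      also have "\<dots> \<le> \<bar>u x - v x\<bar> + \<delta>'"
        using p(2)[OF elim] by (intro add_mono) (auto simp flip: of_real_diff)
      finally have "(norm (complex_of_real (u x) - p x))\<^sup>2 \<le> (\<bar>u x - v x\<bar> + \<delta>')\<^sup>2"
        by (intro power_mono) auto
      also have "\<dots> \<le> 2 * (u x - v x)\<^sup>2 + 2 * \<delta>'\<^sup>2"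
        using zero_le_power2[of "\<bar>u x - v x\<bar> - \<delta>'"] by (simp add: power2_eq_square algebra_simps)
      finally show ?case .
    qed
  qed (use i1 i2 in auto)
  also have "\<dots> = 2 * (\<integral>x. (u x - v x)\<^sup>2 \<partial>unit_lborel) + 2 * \<delta>'\<^sup>2"
    using i1 by simp
  also have "\<dots> \<le> \<delta>" using v(4) d'(2) by simp
  finally show ?thesis using that[OF p(1)] by blast
qed

lemma trig_polynomial_dense:
  fixes u :: "real \<Rightarrow> complex"
  assumes [measurable]: "u \<in> borel_measurable borel" and B: "\<And>x. norm (u x) \<le> B" and \<delta>: "\<delta> > 0"
  obtains p where "trig_polynomial p" "(\<integral>x. (norm (u x - p x))\<^sup>2 \<partial>unit_lborel) \<le> \<delta>"
proof -
  have bnd: "\<bar>Re (u x)\<bar> \<le> B" "\<bar>Im (u x)\<bar> \<le> B" for x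
    using B[of x] abs_Re_le_cmod[of "u x"] abs_Im_le_cmod[of "u x"] by linarith+
  obtain p where p: "trig_polynomial p" "(\<integral>x. (norm (complex_of_real (Re (u x)) - p x))\<^sup>2 \<partial>unit_lborel) \<le> \<delta> / 4"
    using trig_polynomial_dense_real[of "\<lambda>x. Re (u x)" B "\<delta> / 4"] bnd \<delta> by auto
  obtain r where r: "trig_polynomial r" "(\<integral>x. (norm (complex_of_real (Im (u x)) - r x))\<^sup>2 \<partial>unit_lborel) \<le> \<delta> / 4"
    using trig_polynomial_dense_real[of "\<lambda>x. Im (u x)" B "\<delta> / 4"] bnd \<delta> by auto
  obtain C where [measurable]: "p \<in> borel_measurable borel" and C: "\<And>x. norm (p x) \<le> C"
    using trig_polynomial_measurable_bounded[OF p(1)] by blast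
  obtain D where [measurable]: "r \<in> borel_measurable borel" and D: "\<And>x. norm (r x) \<le> D"
    using trig_polynomial_measurable_bounded[OF r(1)] by blast
  have int: "integrable unit_lborel (\<lambda>x. (norm (f x - g x))\<^sup>2)"
    if [measurable]: "f \<in> borel_measurable borel" "g \<in> borel_measurable borel"
      and fg: "\<And>x. norm (f x) \<le> A" "\<And>x. norm (g x) \<le> A'" for f g :: "real \<Rightarrow> complex" and A A'
  proof (rule integrable_unit_lborel_bounded[where B = "(A + A')\<^sup>2"])
    fix x
    have "norm (f x - g x) \<le> A + A'"
      using fg(1)[of x] fg(2)[of x] by (intro order_trans[OF norm_triangle_ineq4]) auto
    then show "norm ((norm (f x - g x))\<^sup>2) \<le> (A + A')\<^sup>2"
      using power_mono[of "norm (f x - g x)" "A + A'" 2] by simp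
  qed auto
  have i: "integrable unit_lborel (\<lambda>x. (norm (complex_of_real (Re (u x)) - p x))\<^sup>2)"
      "integrable unit_lborel (\<lambda>x. (norm (complex_of_real (Im (u x)) - r x))\<^sup>2)"
    using bnd C D by (auto intro!: int)
  have norm_pr: "norm (p x + \<i> * r x) \<le> C + D" for x
    using C[of x] D[of x] by (intro order_trans[OF norm_triangle_ineq]) (auto simp: norm_mult)
  have "(\<integral>x. (norm (u x - (p x + \<i> * r x)))\<^sup>2 \<partial>unit_lborel) \<le>
      (\<integral>x. 2 * (norm (complex_of_real (Re (u x)) - p x))\<^sup>2 + 2 * (norm (complex_of_real (Im (u x)) - r x))\<^sup>2 \<partial>unit_lborel)"
  proof (rule integral_mono)
    show "integrable unit_lborel (\<lambda>x. (norm (u x - (p x + \<i> * r x)))\<^sup>2)"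
      using B norm_pr by (intro int) auto
    show "(norm (u x - (p x + \<i> * r x)))\<^sup>2 \<le>
      2 * (norm (complex_of_real (Re (u x)) - p x))\<^sup>2 + 2 * (norm (complex_of_real (Im (u x)) - r x))\<^sup>2" for x
    proof -
      let ?s = "norm (complex_of_real (Re (u x)) - p x)" and ?t = "norm (complex_of_real (Im (u x)) - r x)"
      have "u x - (p x + \<i> * r x) = (complex_of_real (Re (u x)) - p x) + \<i> * (complex_of_real (Im (u x)) - r x)"
        by (simp add: complex_eq_iff)
      then have "norm (u x - (p x + \<i> * r x)) \<le> ?s + ?t"
        by (simp only:) (rule order_trans[OF norm_triangle_ineq], simp add: norm_mult)
      then have "(norm (u x - (p x + \<i> * r x)))\<^sup>2 \<le> (?s + ?t)\<^sup>2"
        by (intro power_mono) auto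
      also have "\<dots> \<le> 2 * ?s\<^sup>2 + 2 * ?t\<^sup>2"
        using zero_le_power2[of "?s - ?t"] by (simp add: power2_eq_square algebra_simps)
      finally show ?thesis .
    qed
  qed (use i in auto)
  also have "\<dots> \<le> \<delta>" using i p(2) r(2) by simp
  finally show ?thesis
    using p(1) r(1) by (intro that[of "\<lambda>x. p x + \<i> * r x"] trig_polynomial_add trig_polynomial_mult trig_polynomial_const)
qed

text \<open>As an integral over a counting measure with values in \<open>ennreal\<close>, the sum of
  squared coefficients always exists, dominates its finite partial sums and can be interchanged with
  later integrals.\<close>

theorem parseval_le:
  fixes u :: "real \<Rightarrow> complex"
  assumes [measurable]: "u \<in> borel_measurable borel" and B: "\<And>x. norm (u x) \<le> B"
  shows "(\<integral>\<^sup>+x. ennreal ((norm (u x))\<^sup>2) \<partial>unit_lborel) \<le>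
    (\<integral>\<^sup>+k. ennreal ((norm (\<integral>x. u x * expi (- of_int k * x) \<partial>unit_lborel))\<^sup>2) \<partial>count_space UNIV)"
proof (rule ennreal_le_epsilon)
  fix \<delta> :: real assume "0 < \<delta>"
  obtain p where p: "trig_polynomial p" "(\<integral>x. (norm (u x - p x))\<^sup>2 \<partial>unit_lborel) \<le> \<delta>"
    using trig_polynomial_dense[OF assms \<open>0 < \<delta>\<close>] by blast
  obtain K c where K: "finite K" and pK: "\<And>x. p x = (\<Sum>k\<in>K. c k * expi (of_int k * x))"
    using trig_polynomial_sum_expi[OF p(1)] by blast
  define uh where "uh k = (\<integral>x. u x * expi (- of_int k * x) \<partial>unit_lborel)" for k :: int
  have "(\<integral>x. (norm (u x))\<^sup>2 \<partial>unit_lborel) - (\<Sum>k\<in>K. (norm (uh k))\<^sup>2) \<le> \<delta>"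
    using p(2) trig_square_integral[OF assms K, of c] sum_nonneg[of K "\<lambda>k. (norm (uh k - c k))\<^sup>2"]
    by (simp add: pK uh_def)
  moreover have "integrable unit_lborel (\<lambda>x. (norm (u x))\<^sup>2)"
    using power_mono[OF B norm_ge_zero, of _ 2] by (intro integrable_unit_lborel_bounded[where B = "B\<^sup>2"]) auto
  ultimately have "(\<integral>\<^sup>+x. ennreal ((norm (u x))\<^sup>2) \<partial>unit_lborel) \<le> ennreal ((\<Sum>k\<in>K. (norm (uh k))\<^sup>2) + \<delta>)"
    by (subst nn_integral_eq_integral) (auto intro!: ennreal_leI)
  also have "\<dots> = (\<integral>\<^sup>+k. ennreal ((norm (uh k))\<^sup>2) \<partial>count_space K) + \<delta>"
    using K \<open>0 < \<delta>\<close> by (subst nn_integral_count_space_finite) (auto simp: ennreal_plus sum_nonneg)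
  also have "\<dots> \<le> (\<integral>\<^sup>+k. ennreal ((norm (uh k))\<^sup>2) \<partial>count_space UNIV) + \<delta>"
    by (intro add_mono order_refl, subst nn_integral_count_space_indicator)
      (auto intro!: nn_integral_mono simp: indicator_def)
  finally show "(\<integral>\<^sup>+x. ennreal ((norm (u x))\<^sup>2) \<partial>unit_lborel) \<le>
    (\<integral>\<^sup>+k. ennreal ((norm (\<integral>x. u x * expi (- of_int k * x) \<partial>unit_lborel))\<^sup>2) \<partial>count_space UNIV) + \<delta>"
    by (simp only: uh_def)
qed

subsection \<open>Periodisation in the plane\<close>

text \<open>Parseval in \<open>y\<close> for fixed \<open>x\<close>, exchange of the frequency sum
  with the integral over \<open>x\<close>, then Parseval in \<open>x\<close> for each coefficient
  function \<open>c k\<close>, which inherits the bound \<open>B\<close> because the interval has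
  mass one.\<close>

lemma parseval2_le:
  fixes g :: "real \<times> real \<Rightarrow> complex"
  assumes [measurable]: "g \<in> borel_measurable borel" and B: "\<And>z. norm (g z) \<le> B"
  shows "(\<integral>\<^sup>+x. \<integral>\<^sup>+y. ennreal ((norm (g (x, y)))\<^sup>2) \<partial>unit_lborel \<partial>unit_lborel) \<le>
    (\<integral>\<^sup>+k. \<integral>\<^sup>+j. ennreal ((norm (\<integral>x. (\<integral>y. g (x, y) * expi (- of_int k * y) \<partial>unit_lborel)
        * expi (- of_int j * x) \<partial>unit_lborel))\<^sup>2) \<partial>count_space UNIV \<partial>count_space UNIV)"
proof -
  let ?M = unit_lborel
  have [measurable]: "g \<in> borel_measurable (borel \<Otimes>\<^sub>M borel)"
    using assms(1) by (simp add: borel_prod)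
  define c where "c k x = (\<integral>y. g (x, y) * expi (- of_int k * y) \<partial>?M)" for k :: int and x
  have [measurable]: "c k \<in> borel_measurable borel" for k
    unfolding c_def by measurable
  have B0: "0 \<le> B" using norm_ge_zero[of "g 0"] B[of 0] by linarith
  have cB: "norm (c k x) \<le> B" for k x
  proof -
    have "norm (c k x) \<le> (\<integral>y. norm (g (x, y) * expi (- of_int k * y)) \<partial>?M)"
      unfolding c_def by (rule integral_norm_bound)
    also have "\<dots> \<le> (\<integral>y. B \<partial>?M)"
      using B B0 by (intro integral_mono integrable_unit_lborel_bounded[where B = B]) (auto simp: norm_mult)
    finally show ?thesis by simp
  qed
  have "(\<integral>\<^sup>+x. \<integral>\<^sup>+y. ennreal ((norm (g (x, y)))\<^sup>2) \<partial>?M \<partial>?M) \<le>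
      (\<integral>\<^sup>+x. \<integral>\<^sup>+k. ennreal ((norm (c k x))\<^sup>2) \<partial>count_space UNIV \<partial>?M)"
    unfolding c_def by (intro nn_integral_mono parseval_le[where B = B] B) auto
  also have "\<dots> = (\<integral>\<^sup>+k. \<integral>\<^sup>+x. ennreal ((norm (c k x))\<^sup>2) \<partial>?M \<partial>count_space UNIV)"
    by (intro nn_integral_count_space_nn_integral) auto
  also have "\<dots> \<le> (\<integral>\<^sup>+k. \<integral>\<^sup>+j. ennreal ((norm (\<integral>x. c k x * expi (- of_int j * x) \<partial>?M))\<^sup>2)
      \<partial>count_space UNIV \<partial>count_space UNIV)"
    by (intro nn_integral_mono parseval_le[where B = B] cB) auto
  finally show ?thesis by (simp only: c_def)
qed

text \<open>Integer translates of the unit interval tile the line and leave integer-frequency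
  characters unchanged, so the coefficients of a periodisation are values of the Fourier transform.
  The bounded support keeps the sum finite.\<close>

lemma unfold_periodization:
  fixes u :: "real \<Rightarrow> complex"
  assumes u: "integrable lborel u" and supp: "\<And>y. \<bar>y\<bar> > real N \<Longrightarrow> u y = 0"
  shows "(\<integral>y. (\<Sum>i\<in>{- int N..int N}. u (y - of_int i)) * expi (- of_int k * y) \<partial>unit_lborel) =
    (\<integral>y. u y * expi (- of_int k * y) \<partial>lborel)"
proof -
  let ?J = "{- int N..int N}"
  have [measurable]: "u \<in> borel_measurable borel"
    using u by (simp add: integrable_iff_bounded)
  have per: "expi (- (of_int k * (y + of_int i))) = expi (- (of_int k * y))" for y and i :: int
  proof -
    have "expi (- (of_int k * (y + of_int i))) = expi (- (of_int k * y)) * expi (of_int (- (k * i)))"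
      by (simp add: algebra_simps flip: expi_add)
    then show ?thesis by (simp del: of_int_minus of_int_mult)
  qed
  have int: "integrable lborel (\<lambda>y. indicator {0..1} (y + of_int i) *\<^sub>R (u y * expi (- (of_int k * y))))" for i :: int
    by (rule Bochner_Integration.integrable_bound[OF u]) (auto simp: norm_mult indicator_def)
  have shift: "integrable lborel (\<lambda>y. indicator {0..1} y *\<^sub>R (u (y - of_int i) * expi (- (of_int k * y))))"
      "(\<integral>y. indicator {0..1} y *\<^sub>R (u (y - of_int i) * expi (- (of_int k * y))) \<partial>lborel) =
       (\<integral>y. indicator {0..1} (y + of_int i) *\<^sub>R (u y * expi (- (of_int k * y))) \<partial>lborel)" for i :: int
  proof -
    let ?f = "\<lambda>y. indicator {0..1} y *\<^sub>R (u (y - of_int i) * expi (- (of_int k * y)))"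
    have eq: "?f (of_int i + 1 * y) = indicator {0..1} (y + of_int i) *\<^sub>R (u y * expi (- (of_int k * y)))" for y
      using per[of y i] by (simp add: add.commute)
    show "integrable lborel ?f"
      using lborel_integrable_real_affine_iff[of 1 ?f "of_int i"] int[of i] unfolding eq by simp
    show "(\<integral>y. ?f y \<partial>lborel) =
       (\<integral>y. indicator {0..1} (y + of_int i) *\<^sub>R (u y * expi (- (of_int k * y))) \<partial>lborel)"
      using lborel_integral_real_affine[of 1 ?f "of_int i"] unfolding eq by simp
  qed
  have "(\<integral>y. (\<Sum>i\<in>?J. u (y - of_int i)) * expi (- of_int k * y) \<partial>unit_lborel) =
      (\<integral>y. (\<Sum>i\<in>?J. indicator {0..1} y *\<^sub>R (u (y - of_int i) * expi (- (of_int k * y)))) \<partial>lborel)"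
    by (subst integral_unit_lborel) (auto simp: sum_distrib_right scaleR_sum_right)
  also have "\<dots> = (\<Sum>i\<in>?J. \<integral>y. indicator {0..1} y *\<^sub>R (u (y - of_int i) * expi (- (of_int k * y))) \<partial>lborel)"
    by (intro Bochner_Integration.integral_sum shift(1))
  also have "\<dots> = (\<integral>y. (\<Sum>i\<in>?J. indicator {0..1} (y + of_int i) *\<^sub>R (u y * expi (- (of_int k * y)))) \<partial>lborel)"
    unfolding shift(2) by (intro Bochner_Integration.integral_sum[symmetric] int)
  also have "\<dots> = (\<integral>y. u y * expi (- of_int k * y) \<partial>lborel)"
  proof (rule integral_cong_AE)
    \<comment> \<open>An integer \<open>y\<close> has two translates in the closed unit interval and
      would be counted twice; the integers form a null set.\<close>
    have "AE y in lborel. y \<notin> (\<int> :: real set)"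
      by (intro AE_not_in countable_imp_null_set_lborel) (auto simp: countable_int Ints_def)
    then show "AE y in lborel. (\<Sum>i\<in>?J. indicator {0..1} (y + of_int i) *\<^sub>R (u y * expi (- (of_int k * y))))
        = u y * expi (- of_int k * y)"
    proof eventually_elim
      case (elim y)
      show ?case
      proof (cases "\<bar>y\<bar> > real N")
        case True
        then show ?thesis by (simp add: supp)
      next
        case False
        have "y \<noteq> of_int i" for i using elim by (metis Ints_of_int)
        note nint = this
        \<comment> \<open>Exactly one translate of a non-integer lands in the unit interval.\<close>
        have iff: "0 \<le> y + of_int i \<and> y + of_int i \<le> 1 \<longleftrightarrow> i = - \<lfloor>y\<rfloor>" for i
        proof -
          have "y \<noteq> of_int (- i)" "y \<noteq> of_int (1 - i)" by (rule nint)+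
          then have "0 \<le> y + of_int i \<and> y + of_int i \<le> 1 \<longleftrightarrow> \<lfloor>y\<rfloor> = - i"
            unfolding floor_eq_iff by auto
          then show ?thesis by auto
        qed
        have "- \<lfloor>y\<rfloor> \<in> ?J"
        proof -
          have "y < real N" "- real N \<le> y"
            using False nint[of "int N"] by auto
          then have "- int N \<le> \<lfloor>y\<rfloor>" "\<lfloor>y\<rfloor> < int N"
            by (simp_all add: le_floor_iff floor_less_iff)
          then show ?thesis by simp

        qed
        have "(\<Sum>i\<in>?J. indicator {0..1} (y + of_int i) *\<^sub>R (u y * expi (- (of_int k * y)))) =
            (\<Sum>i\<in>?J. if i = - \<lfloor>y\<rfloor> then u y * expi (- (of_int k * y)) else 0)"
          using iff by (intro sum.cong) (auto simp: indicator_def)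
        then show ?thesis using \<open>- \<lfloor>y\<rfloor> \<in> ?J\<close> by simp
      qed
    qed
  qed (measurable, measurable)
  finally show ?thesis .
qed

text \<open>Subtracting the mean changes only the coefficient at frequency (0, 0), and makes it
  vanish.\<close>

theorem periodization_variance_le:
  fixes q :: "real \<times> real \<Rightarrow> real"
  assumes [measurable]: "q \<in> borel_measurable borel" and B: "\<And>z. \<bar>q z\<bar> \<le> B"
    and supp: "\<And>x y. \<bar>x\<bar> > real N \<or> \<bar>y\<bar> > real N \<Longrightarrow> q (x, y) = 0"
    and mean: "(\<integral>z. q z \<partial>lborel) = m"
  shows "(\<integral>\<^sup>+x. \<integral>\<^sup>+y. ennreal (((\<Sum>i\<in>{- int N..int N}. \<Sum>j\<in>{- int N..int N}. q (x - of_int i, y - of_int j)) - m)\<^sup>2)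
      \<partial>unit_lborel \<partial>unit_lborel) \<le>
    (\<integral>\<^sup>+k. \<integral>\<^sup>+j. (if j = 0 \<and> k = 0 then 0 else
       ennreal ((norm (\<integral>z. q z * expi (- (of_int j * fst z + of_int k * snd z)) \<partial>lborel))\<^sup>2))
     \<partial>count_space UNIV \<partial>count_space UNIV)"
proof -
  let ?M = unit_lborel and ?J = "{- int N..int N}"
  have [measurable]: "q \<in> borel_measurable (borel \<Otimes>\<^sub>M borel)"
    using assms(1) by (simp add: borel_prod)
  have B0: "0 \<le> B" using B[of 0] by linarith
  define S where "S z = (\<Sum>i\<in>?J. \<Sum>j\<in>?J. q (fst z - of_int i, snd z - of_int j))" for z
  define g where "g z = complex_of_real (S z - m)" for z
  have [measurable]: "S \<in> borel_measurable (borel \<Otimes>\<^sub>M borel)"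
    unfolding S_def by measurable
  have [measurable]: "g \<in> borel_measurable borel"
    unfolding g_def borel_prod[symmetric] by measurable
  have SB: "\<bar>S z\<bar> \<le> (\<Sum>i\<in>?J. \<Sum>j\<in>?J. B)" for z
    unfolding S_def by (intro order_trans[OF sum_abs] sum_mono B)
  have gB: "norm (g z) \<le> (\<Sum>i\<in>?J. \<Sum>j\<in>?J. B) + \<bar>m\<bar>" for z
    unfolding g_def norm_of_real using SB[of z] by linarith
  have qint: "integrable lborel q"
  proof (rule Bochner_Integration.integrable_bound)
    show "integrable lborel (\<lambda>z. B * indicator ({- real N..real N} \<times> {- real N..real N}) z)"
      by (intro integrable_mult_right integrable_real_indicator)
        (auto simp: lborel_prod[symmetric] lborel.emeasure_pair_measure_Times ennreal_mult_less_top simp del: lborel_prod)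
    show "AE z in lborel. norm (q z) \<le> norm (B * indicator ({- real N..real N} \<times> {- real N..real N}) z)"
      using B B0 supp by (intro AE_I2) (force simp: indicator_def)
  qed simp
  define qh where "qh j k = (\<integral>z. q z * expi (- (of_int j * fst z + of_int k * snd z)) \<partial>lborel)" for j k :: int
  \<comment> \<open>The transform in the second variable alone. Unfolding in \<open>y\<close> turns
    the sum over \<open>j\<close> into \<open>r k\<close> and leaves a periodisation in
    \<open>x\<close>, to which the one-dimensional unfolding applies once more.\<close>
  define r where "r k x = (\<integral>y. q (x, y) * expi (- of_int k * y) \<partial>lborel)" for k :: int and x
  have rsupp: "r k x = 0" if "\<bar>x\<bar> > real N" for k x
    using that by (simp add: r_def supp)
  have ri: "integrable lborel (\<lambda>y. complex_of_real (q (x, y)))" for x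
  proof (rule Bochner_Integration.integrable_bound)
    show "integrable lborel (\<lambda>y. B * indicator {- real N..real N} y)"
      by (intro integrable_mult_right integrable_real_indicator) auto
    show "AE y in lborel. norm (complex_of_real (q (x, y))) \<le> norm (B * indicator {- real N..real N} y)"
      using B B0 supp by (intro AE_I2) (force simp: indicator_def)
  qed simp
  have qe: "integrable (lborel \<Otimes>\<^sub>M lborel) (\<lambda>(x, y). q (x, y) * expi (- of_int k * y) * expi (- of_int j * x))" for j k
    by (rule Bochner_Integration.integrable_bound[where f = q]) (use qint in \<open>auto simp: norm_mult simp flip: lborel_prod\<close>)
  have rint: "integrable lborel (r k)" for k
    unfolding r_def using lborel_pair.integrable_fst'[OF qe[of k 0]] by simp
  have rqh: "(\<integral>x. r k x * expi (- of_int j * x) \<partial>lborel) = qh j k" for j k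
  proof -
    have "(\<integral>x. r k x * expi (- of_int j * x) \<partial>lborel) =
        (\<integral>x. \<integral>y. q (x, y) * expi (- of_int k * y) * expi (- of_int j * x) \<partial>lborel \<partial>lborel)"
      unfolding r_def by (simp add: integral_mult_left_zero)
    also have "\<dots> = (\<integral>z. (case z of (x, y) \<Rightarrow> q (x, y) * expi (- of_int k * y) * expi (- of_int j * x)) \<partial>(lborel \<Otimes>\<^sub>M lborel))"
      using lborel_pair.integral_fst'[OF qe[of k j]] by simp
    also have "\<dots> = qh j k"
      unfolding qh_def lborel_prod
      by (intro Bochner_Integration.integral_cong) (auto simp: expi_add[symmetric] mult.assoc algebra_simps)
    finally show ?thesis .
  qed
  have inner: "(\<integral>y. g (x, y) * expi (- of_int k * y) \<partial>?M) =
      (\<Sum>i\<in>?J. r k (x - of_int i)) - (if k = 0 then m else 0)" for k x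
  proof -
    have "(\<integral>y. g (x, y) * expi (- of_int k * y) \<partial>?M) =
      (\<integral>y. (\<Sum>i\<in>?J. (\<Sum>j\<in>?J. complex_of_real (q (x - of_int i, y - of_int j))) * expi (- of_int k * y))
         - m * expi (- of_int k * y) \<partial>?M)"
      by (simp add: g_def S_def left_diff_distrib sum_distrib_right)
    also have "\<dots> = (\<integral>y. (\<Sum>i\<in>?J. (\<Sum>j\<in>?J. complex_of_real (q (x - of_int i, y - of_int j))) * expi (- of_int k * y)) \<partial>?M)
         - (\<integral>y. m * expi (- of_int k * y) \<partial>?M)"
    proof (rule Bochner_Integration.integral_diff)
      show "integrable ?M (\<lambda>y. \<Sum>i\<in>?J. (\<Sum>j\<in>?J. complex_of_real (q (x - of_int i, y - of_int j))) * expi (- of_int k * y))"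
        by (intro Bochner_Integration.integrable_sum integrable_unit_lborel_bounded[where B = "\<Sum>j\<in>?J. B"])
          (auto simp: norm_mult simp flip: of_real_sum simp del: sum_constant intro!: order_trans[OF sum_abs] sum_mono B)
      show "integrable ?M (\<lambda>y. m * expi (- of_int k * y))"
        by (intro integrable_unit_lborel_bounded[where B = "\<bar>m\<bar>"]) (auto simp: norm_mult)
    qed
    also have "(\<integral>y. m * expi (- of_int k * y) \<partial>?M) = (if k = 0 then m else 0)"
      using integral_expi_int[of "- k"] by simp
    also have "(\<integral>y. (\<Sum>i\<in>?J. (\<Sum>j\<in>?J. complex_of_real (q (x - of_int i, y - of_int j))) * expi (- of_int k * y)) \<partial>?M) =
       (\<Sum>i\<in>?J. \<integral>y. (\<Sum>j\<in>?J. complex_of_real (q (x - of_int i, y - of_int j))) * expi (- of_int k * y) \<partial>?M)"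
      by (intro Bochner_Integration.integral_sum integrable_unit_lborel_bounded[where B = "\<Sum>j\<in>?J. B"])
          (auto simp: norm_mult simp flip: of_real_sum simp del: sum_constant intro!: order_trans[OF sum_abs] sum_mono B)
    also have "\<dots> = (\<Sum>i\<in>?J. r k (x - of_int i))"
      unfolding r_def by (intro sum.cong refl unfold_periodization[of "\<lambda>y. complex_of_real (q (x - of_int i, y))" for i] ri)
        (auto simp: supp)
    finally show ?thesis .
  qed
  have rB: "norm (r k x) \<le> B * (2 * real N)" for k x
  proof -
    have "norm (r k x) \<le> (\<integral>y. norm (q (x, y) * expi (- of_int k * y)) \<partial>lborel)"
      unfolding r_def by (rule integral_norm_bound)
    also have "\<dots> \<le> (\<integral>y. B * indicator {- real N..real N} y \<partial>lborel)"
      using B B0 supp ri[of x, THEN integrable_norm]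
      by (intro integral_mono integrable_mult_right integrable_real_indicator) (force simp: norm_mult indicator_def)+
    finally show ?thesis by simp
  qed
  have [measurable]: "r k \<in> borel_measurable borel" for k
    using rint[of k] by (simp add: integrable_iff_bounded)
  have coeff: "(\<integral>x. (\<integral>y. g (x, y) * expi (- of_int k * y) \<partial>?M) * expi (- of_int j * x) \<partial>?M) =
      qh j k - (if j = 0 \<and> k = 0 then m else 0)" for j k
  proof -
    have "(\<integral>x. (\<integral>y. g (x, y) * expi (- of_int k * y) \<partial>?M) * expi (- of_int j * x) \<partial>?M) =
      (\<integral>x. (\<Sum>i\<in>?J. r k (x - of_int i)) * expi (- of_int j * x) - (if k = 0 then m else 0) * expi (- of_int j * x) \<partial>?M)"
      unfolding inner left_diff_distrib ..
    also have "\<dots> = (\<integral>x. (\<Sum>i\<in>?J. r k (x - of_int i)) * expi (- of_int j * x) \<partial>?M)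
        - (\<integral>x. (if k = 0 then m else 0) * expi (- of_int j * x) \<partial>?M)"
    proof (rule Bochner_Integration.integral_diff)
      show "integrable ?M (\<lambda>x. (\<Sum>i\<in>?J. r k (x - of_int i)) * expi (- of_int j * x))"
        by (intro integrable_unit_lborel_bounded[where B = "\<Sum>j\<in>?J. B * (2 * real N)"])
          (auto simp: norm_mult simp del: sum_constant intro!: order_trans[OF norm_sum] sum_mono rB)
      show "integrable ?M (\<lambda>x. (if k = 0 then m else 0) * expi (- of_int j * x))"
        by (intro integrable_unit_lborel_bounded[where B = "\<bar>m\<bar>"]) (auto simp: norm_mult)
    qed
    also have "(\<integral>x. (if k = 0 then m else 0) * expi (- of_int j * x) \<partial>?M) = (if j = 0 \<and> k = 0 then m else 0)"
      using integral_expi_int[of "- j"] by simp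
    also have "(\<integral>x. (\<Sum>i\<in>?J. r k (x - of_int i)) * expi (- of_int j * x) \<partial>?M) = qh j k"
      unfolding rqh[symmetric] by (intro unfold_periodization rint rsupp)
    finally show ?thesis .
  qed
  have "qh 0 0 = m" using mean by (simp add: qh_def)
  have "(\<integral>\<^sup>+x. \<integral>\<^sup>+y. ennreal ((S (x, y) - m)\<^sup>2) \<partial>?M \<partial>?M) = (\<integral>\<^sup>+x. \<integral>\<^sup>+y. ennreal ((norm (g (x, y)))\<^sup>2) \<partial>?M \<partial>?M)"
    by (simp add: g_def del: of_real_diff)
  also have "\<dots> \<le> (\<integral>\<^sup>+k. \<integral>\<^sup>+j. ennreal ((norm (qh j k - (if j = 0 \<and> k = 0 then m else 0)))\<^sup>2) \<partial>count_space UNIV \<partial>count_space UNIV)"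
    unfolding coeff[symmetric] by (intro parseval2_le[OF _ gB]) simp
  also have "\<dots> \<le> (\<integral>\<^sup>+k. \<integral>\<^sup>+j. (if j = 0 \<and> k = 0 then 0 else ennreal ((norm (qh j k))\<^sup>2)) \<partial>count_space UNIV \<partial>count_space UNIV)"
    by (intro nn_integral_mono) (auto simp: \<open>qh 0 0 = m\<close>)
  finally show ?thesis by (simp only: S_def qh_def fst_conv snd_conv)
qed

section \<open>Affine changes of variables in the plane\<close>

text \<open>Elimination by one-dimensional substitutions and Tonelli. For
  \<open>a \<noteq> 0\<close>, substituting in \<open>x\<close> with \<open>y\<close> fixed makes
  the first coordinate the new variable; the second then has slope \<open>?D / a\<close> in
  \<open>y\<close>, and the two scaling factors multiply to the determinant. For
  \<open>a = 0\<close> the first coordinate depends on \<open>y\<close> alone.\<close>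

lemma nn_integral_lborel_affine2:
  fixes f :: "real \<times> real \<Rightarrow> ennreal"
  assumes [measurable]: "f \<in> borel_measurable borel" and D: "a * d - b * c \<noteq> 0"
  shows "(\<integral>\<^sup>+z. f z \<partial>lborel) =
    ennreal \<bar>a * d - b * c\<bar> * (\<integral>\<^sup>+z. f (\<alpha> + (a * fst z + b * snd z), \<beta> + (c * fst z + d * snd z)) \<partial>lborel)"
proof -
  have [measurable]: "f \<in> borel_measurable (borel \<Otimes>\<^sub>M borel)"
    using assms(1) by (simp add: borel_prod)
  have pair: "(\<integral>\<^sup>+z. g z \<partial>lborel) = (\<integral>\<^sup>+y. \<integral>\<^sup>+x. g (x, y) \<partial>lborel \<partial>lborel)"
      "(\<integral>\<^sup>+z. g z \<partial>lborel) = (\<integral>\<^sup>+x. \<integral>\<^sup>+y. g (x, y) \<partial>lborel \<partial>lborel)"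
    if [measurable]: "g \<in> borel_measurable (borel \<Otimes>\<^sub>M borel)" for g :: "real \<times> real \<Rightarrow> ennreal"
    using that by (simp_all add: lborel_pair.nn_integral_snd lborel.nn_integral_fst flip: lborel_prod)
  let ?D = "a * d - b * c"
  have [measurable]: "(\<lambda>z. f (\<alpha> + (a * fst z + b * snd z), \<beta> + (c * fst z + d * snd z))) \<in> borel_measurable (borel \<Otimes>\<^sub>M borel)"
    by measurable
  show ?thesis
  proof (cases "a = 0")
    case False
    have "ennreal \<bar>?D\<bar> * (\<integral>\<^sup>+z. f (\<alpha> + (a * fst z + b * snd z), \<beta> + (c * fst z + d * snd z)) \<partial>lborel) =
        ennreal \<bar>?D\<bar> * (\<integral>\<^sup>+y. \<integral>\<^sup>+x. f (\<alpha> + (a * x + b * y), \<beta> + (c * x + d * y)) \<partial>lborel \<partial>lborel)"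
      by (subst pair(1)) auto
    also have "(\<integral>\<^sup>+y. \<integral>\<^sup>+x. f (\<alpha> + (a * x + b * y), \<beta> + (c * x + d * y)) \<partial>lborel \<partial>lborel) =
        (\<integral>\<^sup>+y. ennreal (1 / \<bar>a\<bar>) * (\<integral>\<^sup>+x. f (x, \<beta> + c / a * (x - \<alpha>) + ?D / a * y) \<partial>lborel) \<partial>lborel)"
    proof (intro nn_integral_cong)
      fix y
      have "(\<integral>\<^sup>+x. f (x, \<beta> + c / a * (x - \<alpha>) + ?D / a * y) \<partial>lborel) =
         ennreal \<bar>a\<bar> * (\<integral>\<^sup>+x. f ((\<alpha> + b * y) + a * x, \<beta> + c / a * (((\<alpha> + b * y) + a * x) - \<alpha>) + ?D / a * y) \<partial>lborel)"
        using False by (intro nn_integral_real_affine) auto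
      also have "(\<lambda>x. f ((\<alpha> + b * y) + a * x, \<beta> + c / a * (((\<alpha> + b * y) + a * x) - \<alpha>) + ?D / a * y)) =
         (\<lambda>x. f (\<alpha> + (a * x + b * y), \<beta> + (c * x + d * y)))"
        using False by (intro ext arg_cong[where f = f]) (simp add: field_simps)
      finally show "(\<integral>\<^sup>+x. f (\<alpha> + (a * x + b * y), \<beta> + (c * x + d * y)) \<partial>lborel) =
          ennreal (1 / \<bar>a\<bar>) * (\<integral>\<^sup>+x. f (x, \<beta> + c / a * (x - \<alpha>) + ?D / a * y) \<partial>lborel)"
        using False by (simp add: mult.assoc[symmetric] flip: ennreal_mult)
    qed
    also have "\<dots> = ennreal (1 / \<bar>a\<bar>) * (\<integral>\<^sup>+x. \<integral>\<^sup>+y. f (x, \<beta> + c / a * (x - \<alpha>) + ?D / a * y) \<partial>lborel \<partial>lborel)"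
      by (subst nn_integral_cmult, simp, subst lborel_pair.Fubini') (auto simp: case_prod_beta)
    also have "(\<integral>\<^sup>+x. \<integral>\<^sup>+y. f (x, \<beta> + c / a * (x - \<alpha>) + ?D / a * y) \<partial>lborel \<partial>lborel) =
        (\<integral>\<^sup>+x. ennreal (\<bar>a\<bar> / \<bar>?D\<bar>) * (\<integral>\<^sup>+y. f (x, y) \<partial>lborel) \<partial>lborel)"
    proof (intro nn_integral_cong)
      fix x
      have "(\<integral>\<^sup>+y. f (x, y) \<partial>lborel) = ennreal \<bar>?D / a\<bar> *
          (\<integral>\<^sup>+y. f (x, (\<beta> + c / a * (x - \<alpha>)) + ?D / a * y) \<partial>lborel)"
        using False D by (intro nn_integral_real_affine) auto
      then show "(\<integral>\<^sup>+y. f (x, \<beta> + c / a * (x - \<alpha>) + ?D / a * y) \<partial>lborel) =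
          ennreal (\<bar>a\<bar> / \<bar>?D\<bar>) * (\<integral>\<^sup>+y. f (x, y) \<partial>lborel)"
        using False D by (simp add: mult.assoc[symmetric] flip: ennreal_mult)
    qed
    also have "\<dots> = ennreal (\<bar>a\<bar> / \<bar>?D\<bar>) * (\<integral>\<^sup>+z. f z \<partial>lborel)"
      by (subst pair(2)) (auto intro!: nn_integral_cmult)
    finally show ?thesis
      using False D by (simp add: mult.assoc[symmetric] flip: ennreal_mult)
  next
    case True
    then have bc: "b \<noteq> 0" "c \<noteq> 0" using D by auto
    have "(\<integral>\<^sup>+z. f (\<alpha> + (a * fst z + b * snd z), \<beta> + (c * fst z + d * snd z)) \<partial>lborel) =
        (\<integral>\<^sup>+y. \<integral>\<^sup>+x. f (\<alpha> + b * y, \<beta> + (c * x + d * y)) \<partial>lborel \<partial>lborel)"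
      using True by (subst pair(1)) auto
    also have "\<dots> = (\<integral>\<^sup>+y. ennreal (1 / \<bar>c\<bar>) * (\<integral>\<^sup>+x. f (\<alpha> + b * y, x) \<partial>lborel) \<partial>lborel)"
    proof (intro nn_integral_cong)
      fix y
      have "(\<integral>\<^sup>+x. f (\<alpha> + b * y, x) \<partial>lborel) = ennreal \<bar>c\<bar> * (\<integral>\<^sup>+x. f (\<alpha> + b * y, (\<beta> + d * y) + c * x) \<partial>lborel)"
        using bc by (intro nn_integral_real_affine) auto
      then show "(\<integral>\<^sup>+x. f (\<alpha> + b * y, \<beta> + (c * x + d * y)) \<partial>lborel) =
          ennreal (1 / \<bar>c\<bar>) * (\<integral>\<^sup>+x. f (\<alpha> + b * y, x) \<partial>lborel)"
        using bc by (simp add: mult.assoc[symmetric] add_ac flip: ennreal_mult)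
    qed
    also have "\<dots> = ennreal (1 / \<bar>c\<bar>) * (\<integral>\<^sup>+y. (\<integral>\<^sup>+x. f (\<alpha> + b * y, x) \<partial>lborel) \<partial>lborel)"
      by (intro nn_integral_cmult) auto
    also have "(\<integral>\<^sup>+y. (\<integral>\<^sup>+x. f (\<alpha> + b * y, x) \<partial>lborel) \<partial>lborel) = ennreal (1 / \<bar>b\<bar>) * (\<integral>\<^sup>+z. f z \<partial>lborel)"
      using bc nn_integral_real_affine[of "\<lambda>y. \<integral>\<^sup>+x. f (y, x) \<partial>lborel" b \<alpha>]
      by (subst pair(2)) (auto simp: mult.assoc[symmetric] simp flip: ennreal_mult)
    finally show ?thesis
      using True bc by (simp add: mult.assoc[symmetric] abs_mult flip: ennreal_mult)
  qed
qed

text \<open>As an equality of measures the formula carries over to Bochner integrals of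
  vector-valued functions, which the complex Fourier integrals require.\<close>

lemma lborel_affine2:
  fixes a b c d \<alpha> \<beta> :: real
  assumes D: "a * d - b * c \<noteq> 0"
  defines "T \<equiv> \<lambda>z. (\<alpha> + (a * fst z + b * snd z), \<beta> + (c * fst z + d * snd z))"
  shows "lborel = density (distr lborel borel T) (\<lambda>_. ennreal \<bar>a * d - b * c\<bar>)"
proof (rule measure_eqI)
  fix A :: "(real \<times> real) set" assume "A \<in> sets lborel"
  then have [measurable]: "A \<in> sets borel" by simp
  have [measurable]: "T \<in> borel_measurable borel"
    unfolding T_def by (intro borel_measurable_continuous_onI continuous_intros)
  have "emeasure lborel A = (\<integral>\<^sup>+z. indicator A z \<partial>lborel)" by simp
  also have "\<dots> = ennreal \<bar>a * d - b * c\<bar> * (\<integral>\<^sup>+z. indicator A (T z) \<partial>lborel)"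
    unfolding T_def by (rule nn_integral_lborel_affine2) (use D in auto)
  also have "\<dots> = emeasure (density (distr lborel borel T) (\<lambda>_. ennreal \<bar>a * d - b * c\<bar>)) A"
    by (simp add: emeasure_density nn_integral_cmult nn_integral_distr
        del: nn_integral_indicator nn_integral_cmult_indicator)
  finally show "emeasure lborel A = emeasure (density (distr lborel borel T) (\<lambda>_. ennreal \<bar>a * d - b * c\<bar>)) A" .
qed simp

lemma integral_lborel_affine2:
  fixes f :: "real \<times> real \<Rightarrow> 'b::{banach, second_countable_topology}"
  assumes [measurable]: "f \<in> borel_measurable borel" and D: "a * d - b * c \<noteq> 0"
  shows "(\<integral>z. f z \<partial>lborel) =
    \<bar>a * d - b * c\<bar> *\<^sub>R (\<integral>z. f (\<alpha> + (a * fst z + b * snd z), \<beta> + (c * fst z + d * snd z)) \<partial>lborel)"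
proof -
  have [measurable]: "(\<lambda>z::real\<times>real. (\<alpha> + (a * fst z + b * snd z), \<beta> + (c * fst z + d * snd z))) \<in> borel_measurable borel"
    by (intro borel_measurable_continuous_onI continuous_intros)
  show ?thesis
    by (subst lborel_affine2[OF D, of \<alpha> \<beta>]) (simp add: integral_density integral_distr)
qed

subsection \<open>Decay of Fourier transforms\<close>

text \<open>One integration by parts with boundary terms kept: they are bounded, which suffices for
  decay of order one. A common constant for all estimates lets them be added when intervals are
  joined.\<close>

lemma C1_fourier_bound:
  fixes u G G' :: "real \<Rightarrow> real"
  assumes ab: "\<alpha> \<le> \<beta>" and uG: "\<And>x. x \<in> {\<alpha><..<\<beta>} \<Longrightarrow> u x = G x"
    and G: "\<And>x. x \<in> {\<alpha>..\<beta>} \<Longrightarrow> (G has_real_derivative G' x) (at x within {\<alpha>..\<beta>})"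
    and G': "continuous_on {\<alpha>..\<beta>} G'"
  obtains M where "\<And>x. x \<in> {\<alpha>..\<beta>} \<Longrightarrow> \<bar>u x\<bar> \<le> M"
    "\<And>\<omega>. (\<lambda>x. complex_of_real (u x) * expi (\<omega> * x)) integrable_on {\<alpha>..\<beta>}"
    "\<And>\<omega>. norm (integral {\<alpha>..\<beta>} (\<lambda>x. complex_of_real (u x) * expi (\<omega> * x))) \<le> M"
    "\<And>\<omega>. \<bar>\<omega>\<bar> * norm (integral {\<alpha>..\<beta>} (\<lambda>x. complex_of_real (u x) * expi (\<omega> * x))) \<le> M"
proof -
  have Gc: "continuous_on {\<alpha>..\<beta>} G"
    using G by (intro DERIV_continuous_on)
  obtain K where K: "\<And>x. x \<in> {\<alpha>..\<beta>} \<Longrightarrow> \<bar>G x\<bar> \<le> K" "0 < K"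
    using compact_imp_bounded[OF compact_continuous_image[OF Gc compact_Icc]] by (force simp: bounded_pos)
  obtain K' where K': "\<And>x. x \<in> {\<alpha>..\<beta>} \<Longrightarrow> \<bar>G' x\<bar> \<le> K'" "0 < K'"
    using compact_imp_bounded[OF compact_continuous_image[OF G' compact_Icc]] by (force simp: bounded_pos)
  define I where "I \<omega> = integral {\<alpha>..\<beta>} (\<lambda>x. complex_of_real (G x) * expi (\<omega> * x))" for \<omega>
  have Gi: "((\<lambda>x. complex_of_real (G x) * expi (\<omega> * x)) has_integral I \<omega>) {\<alpha>..\<beta>}" for \<omega>
    unfolding I_def
    by (intro integrable_integral integrable_continuous_interval continuous_intros continuous_on_of_real Gc)
  have ui: "((\<lambda>x. complex_of_real (u x) * expi (\<omega> * x)) has_integral I \<omega>) {\<alpha>..\<beta>}" for \<omega>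
    by (rule has_integral_spike_finite[of "{\<alpha>, \<beta>}", OF _ _ Gi]) (auto simp: uG)
  have I1: "norm (I \<omega>) \<le> K * (\<beta> - \<alpha>)" for \<omega>
    using has_integral_bound_real[OF _ finite.emptyI Gi[of \<omega>], of K] K ab by (auto simp: norm_mult)
  have I2: "\<bar>\<omega>\<bar> * norm (I \<omega>) \<le> 2 * K + K' * (\<beta> - \<alpha>)" for \<omega>
  proof -
    let ?J = "integral {\<alpha>..\<beta>} (\<lambda>x. complex_of_real (G' x) * expi (\<omega> * x))"
    have Ji: "((\<lambda>x. complex_of_real (G' x) * expi (\<omega> * x)) has_integral ?J) {\<alpha>..\<beta>}"
      by (intro integrable_integral integrable_continuous_interval continuous_intros continuous_on_of_real G')
    have J: "norm ?J \<le> K' * (\<beta> - \<alpha>)"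
      using has_integral_bound_real[OF _ finite.emptyI Ji, of K'] K' ab by (auto simp: norm_mult)
    \<comment> \<open>The product rule for \<open>G\<close> times the character; subtracting the
      part with \<open>G'\<close> isolates the transform times its frequency.\<close>
    have "((\<lambda>x. complex_of_real (G x) * ((2 * pi * \<omega> * \<i>) * expi (\<omega> * x)) + complex_of_real (G' x) * expi (\<omega> * x))
        has_integral (complex_of_real (G \<beta>) * expi (\<omega> * \<beta>) - complex_of_real (G \<alpha>) * expi (\<omega> * \<alpha>))) {\<alpha>..\<beta>}"
    proof (rule fundamental_theorem_of_calculus[OF ab])
      fix x assume "x \<in> {\<alpha>..\<beta>}"
      then have "((\<lambda>x. complex_of_real (G x)) has_vector_derivative complex_of_real (G' x)) (at x within {\<alpha>..\<beta>})"
        using G by (intro has_vector_derivative_of_real) (simp add: has_real_derivative_iff_has_vector_derivative)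
      from has_vector_derivative_mult[OF this expi_has_vector_derivative[of \<omega>]]
      show "((\<lambda>x. complex_of_real (G x) * expi (\<omega> * x)) has_vector_derivative
        complex_of_real (G x) * ((2 * pi * \<omega> * \<i>) * expi (\<omega> * x)) + complex_of_real (G' x) * expi (\<omega> * x)) (at x within {\<alpha>..\<beta>})"
        by simp
    qed
    from has_integral_diff[OF this Ji]
    have "((\<lambda>x. (2 * pi * \<omega> * \<i>) * (complex_of_real (G x) * expi (\<omega> * x))) has_integral
      (complex_of_real (G \<beta>) * expi (\<omega> * \<beta>) - complex_of_real (G \<alpha>) * expi (\<omega> * \<alpha>) - ?J)) {\<alpha>..\<beta>}"
      by (simp add: mult_ac)
    with has_integral_mult_right[OF Gi[of \<omega>], of "2 * pi * \<omega> * \<i>"]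
    have "(2 * pi * \<omega> * \<i>) * I \<omega> = complex_of_real (G \<beta>) * expi (\<omega> * \<beta>) - complex_of_real (G \<alpha>) * expi (\<omega> * \<alpha>) - ?J"
      by (rule has_integral_unique)
    then have "norm ((2 * pi * \<omega> * \<i>) * I \<omega>) \<le> norm (complex_of_real (G \<beta>) * expi (\<omega> * \<beta>))
        + norm (complex_of_real (G \<alpha>) * expi (\<omega> * \<alpha>)) + norm ?J"
      by (simp only:) (intro order_trans[OF norm_triangle_ineq4] add_mono norm_triangle_ineq4 order_refl)
    also have "\<dots> \<le> K + K + K' * (\<beta> - \<alpha>)"
      using K(1)[of \<alpha>] K(1)[of \<beta>] ab J by (intro add_mono) (auto simp: norm_mult)
    finally have "2 * pi * (\<bar>\<omega>\<bar> * norm (I \<omega>)) \<le> 2 * K + K' * (\<beta> - \<alpha>)"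
      by (simp add: norm_mult mult_ac)
    moreover have "1 * (\<bar>\<omega>\<bar> * norm (I \<omega>)) \<le> 2 * pi * (\<bar>\<omega>\<bar> * norm (I \<omega>))"
      using pi_gt3 by (intro mult_right_mono) auto
    ultimately show ?thesis by linarith
  qed
  \<comment> \<open>The last two summands cover the end points, where \<open>u\<close> may differ
    from \<open>G\<close>.\<close>
  define M where "M = K * (\<beta> - \<alpha>) + (2 * K + K' * (\<beta> - \<alpha>)) + \<bar>u \<alpha>\<bar> + \<bar>u \<beta>\<bar>"
  have pos: "0 \<le> K * (\<beta> - \<alpha>)" "0 \<le> K' * (\<beta> - \<alpha>)" using K K' ab by auto
  show ?thesis
  proof (rule that[of M])
    show "\<bar>u x\<bar> \<le> M" if x: "x \<in> {\<alpha>..\<beta>}" for x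
    proof (cases "x = \<alpha> \<or> x = \<beta>")
      case True
      then show ?thesis using pos K by (auto simp: M_def)
    next
      case False
      then have "u x = G x" using x by (intro uG) auto
      then show ?thesis using pos K(1)[OF x] K(2) by (auto simp: M_def)
    qed
    show "(\<lambda>x. complex_of_real (u x) * expi (\<omega> * x)) integrable_on {\<alpha>..\<beta>}" for \<omega>
      using ui by blast
    show "norm (integral {\<alpha>..\<beta>} (\<lambda>x. complex_of_real (u x) * expi (\<omega> * x))) \<le> M" for \<omega>
      using integral_unique[OF ui[of \<omega>]] I1[of \<omega>] pos K(2) by (simp add: M_def)
    show "\<bar>\<omega>\<bar> * norm (integral {\<alpha>..\<beta>} (\<lambda>x. complex_of_real (u x) * expi (\<omega> * x))) \<le> M" for \<omega>
      using integral_unique[OF ui[of \<omega>]] I2[of \<omega>] pos K(2) by (simp add: M_def)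
  qed
qed

lemma piecewise_C1_off_piece:
  assumes "piecewise_C1_off S g" "C \<in> components (- S)"
  obtains G G' where "\<And>t. t \<in> C \<Longrightarrow> g t = G t"
    "\<And>t. t \<in> closure C \<Longrightarrow> (G has_real_derivative G' t) (at t within closure C)"
    "continuous_on (closure C) G'"
proof -
  have "\<exists>G G'. (\<forall>t \<in> C. g t = G t) \<and>
        (\<forall>t \<in> closure C. (G has_real_derivative G' t) (at t within closure C)) \<and>
        continuous_on (closure C) G'"
    by (rule bspec[OF conjunct2[OF assms(1)[unfolded piecewise_C1_off_def]] assms(2)])
  then obtain G G' where G: "\<forall>t \<in> C. g t = G t"
      "\<forall>t \<in> closure C. (G has_real_derivative G' t) (at t within closure C)"
      "continuous_on (closure C) G'"
    by (elim exE conjE)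
  show ?thesis
    by (rule that[OF bspec[OF G(1)] bspec[OF G(2)] G(3)])
qed

text \<open>Induction on the number of interior breakpoints: integrals over adjacent intervals add,
  and a jump merely contributes further boundary terms.\<close>

lemma piecewise_C1_fourier_bound:
  assumes u: "piecewise_C1_off S u" and ab: "\<alpha> \<le> \<beta>"
  shows "\<exists>M. (\<forall>x\<in>{\<alpha>..\<beta>}. \<bar>u x\<bar> \<le> M) \<and>
    (\<forall>\<omega>. (\<lambda>x. complex_of_real (u x) * expi (\<omega> * x)) integrable_on {\<alpha>..\<beta>} \<and>
      norm (integral {\<alpha>..\<beta>} (\<lambda>x. complex_of_real (u x) * expi (\<omega> * x))) \<le> M \<and>
      \<bar>\<omega>\<bar> * norm (integral {\<alpha>..\<beta>} (\<lambda>x. complex_of_real (u x) * expi (\<omega> * x))) \<le> M)"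
    (is "\<exists>M. ?P \<alpha> \<beta> M")
  using ab
proof (induction "card (S \<inter> {\<alpha><..<\<beta>})" arbitrary: \<alpha> \<beta> rule: less_induct)
  case less
  have S: "finite S" using u by (simp add: piecewise_C1_off_def)
  show ?case
  proof (cases "S \<inter> {\<alpha><..<\<beta>} = {}")
    case True
    show ?thesis
    proof (cases "\<alpha> = \<beta>")
      case True
      then show ?thesis using integrable_on_refl by (intro exI[of _ "\<bar>u \<alpha>\<bar>"]) (auto simp: has_integral_refl)
    next
      case False
      then have "\<alpha> < \<beta>" using less.prems by simp
      \<comment> \<open>A connected interval free of breakpoints lies in a single piece, and the
        closure of that piece contains the closed interval.\<close>
      have sub: "{\<alpha><..<\<beta>} \<subseteq> - S" using True by auto
      moreover have "{\<alpha><..<\<beta>} \<noteq> {}" using \<open>\<alpha> < \<beta>\<close> by (simp add: not_le)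
      ultimately obtain C where C: "C \<in> components (- S)" "{\<alpha><..<\<beta>} \<subseteq> C"
        using exists_component_superset[of "{\<alpha><..<\<beta>}" "- S"] by (metis connected_Ioo subset_empty)
      obtain G G' where G: "\<And>t. t \<in> C \<Longrightarrow> u t = G t"
          "\<And>t. t \<in> closure C \<Longrightarrow> (G has_real_derivative G' t) (at t within closure C)" "continuous_on (closure C) G'"
        by (rule piecewise_C1_off_piece[OF u C(1)]) (rule that)
      have cl: "{\<alpha>..\<beta>} \<subseteq> closure C"
        using closure_mono[OF C(2)] \<open>\<alpha> < \<beta>\<close> by simp
      obtain M where M: "\<And>x. x \<in> {\<alpha>..\<beta>} \<Longrightarrow> \<bar>u x\<bar> \<le> M"
        "\<And>\<omega>. (\<lambda>x. complex_of_real (u x) * expi (\<omega> * x)) integrable_on {\<alpha>..\<beta>}"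
        "\<And>\<omega>. norm (integral {\<alpha>..\<beta>} (\<lambda>x. complex_of_real (u x) * expi (\<omega> * x))) \<le> M"
        "\<And>\<omega>. \<bar>\<omega>\<bar> * norm (integral {\<alpha>..\<beta>} (\<lambda>x. complex_of_real (u x) * expi (\<omega> * x))) \<le> M"
      proof (rule C1_fourier_bound[OF less.prems, of u G G'])
        show "u x = G x" if "x \<in> {\<alpha><..<\<beta>}" for x using that C(2) G(1) by blast
        show "(G has_real_derivative G' x) (at x within {\<alpha>..\<beta>})" if "x \<in> {\<alpha>..\<beta>}" for x
          by (rule DERIV_subset[OF G(2) cl]) (use that cl in auto)
        show "continuous_on {\<alpha>..\<beta>} G'" using G(3) cl by (rule continuous_on_subset)
      qed blast
      then show ?thesis by blast
    qed
  next
    case False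
    then obtain c where c: "c \<in> S" "\<alpha> < c" "c < \<beta>" by auto
    \<comment> \<open>The breakpoint \<open>c\<close> is interior to neither half, so both counts
      drop.\<close>
    have "card (S \<inter> {\<alpha><..<c}) < card (S \<inter> {\<alpha><..<\<beta>})" "card (S \<inter> {c<..<\<beta>}) < card (S \<inter> {\<alpha><..<\<beta>})"
      using S c by (auto intro!: psubset_card_mono)
    note IH = less.hyps[OF this(1) less_imp_le[OF c(2)]] less.hyps[OF this(2) less_imp_le[OF c(3)]]
    obtain M where P: "?P \<alpha> c M" using IH(1) by (elim exE)
    obtain M' where P': "?P c \<beta> M'" using IH(2) by (elim exE)
    note M = conjunct1[OF P, rule_format] conjunct2[OF P, rule_format, THEN conjunct1]
      conjunct2[OF P, rule_format, THEN conjunct2, THEN conjunct1]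
      conjunct2[OF P, rule_format, THEN conjunct2, THEN conjunct2]
    note M' = conjunct1[OF P', rule_format] conjunct2[OF P', rule_format, THEN conjunct1]
      conjunct2[OF P', rule_format, THEN conjunct2, THEN conjunct1]
      conjunct2[OF P', rule_format, THEN conjunct2, THEN conjunct2]
    have pos: "0 \<le> M" "0 \<le> M'"
      using M(3)[of 0] M'(3)[of 0] norm_ge_zero order_trans by blast+
    show ?thesis
    proof (intro exI[of _ "M + M'"] conjI ballI allI)
      show "\<bar>u x\<bar> \<le> M + M'" if "x \<in> {\<alpha>..\<beta>}" for x
        using M(1)[of x] M'(1)[of x] pos that by (cases "x \<le> c") auto
      fix \<omega>
      let ?f = "\<lambda>x. complex_of_real (u x) * expi (\<omega> * x)"
      show int: "?f integrable_on {\<alpha>..\<beta>}"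
        using c M(2) M'(2) by (intro Henstock_Kurzweil_Integration.integrable_combine[of \<alpha> c \<beta>]) auto
      have eq: "integral {\<alpha>..\<beta>} ?f = integral {\<alpha>..c} ?f + integral {c..\<beta>} ?f"
        using c int by (intro Henstock_Kurzweil_Integration.integral_combine[symmetric]) auto
      show "norm (integral {\<alpha>..\<beta>} ?f) \<le> M + M'"
        unfolding eq by (intro order_trans[OF norm_triangle_ineq] add_mono M M')
      have "\<bar>\<omega>\<bar> * norm (integral {\<alpha>..\<beta>} ?f) \<le> \<bar>\<omega>\<bar> * norm (integral {\<alpha>..c} ?f) + \<bar>\<omega>\<bar> * norm (integral {c..\<beta>} ?f)"
        unfolding eq distrib_left[symmetric] by (intro mult_left_mono norm_triangle_ineq) auto
      also have "\<dots> \<le> M + M'" by (intro add_mono M M')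
      finally show "\<bar>\<omega>\<bar> * norm (integral {\<alpha>..\<beta>} ?f) \<le> M + M'" .
    qed
  qed
qed

lemma piecewise_C1_borel:
  assumes u: "piecewise_C1_off S u"
  shows "u \<in> borel_measurable borel"
proof (rule borel_measurable_continuous_countable_exceptions)
  have S: "finite S" using u by (simp add: piecewise_C1_off_def)
  then show "countable S" by (rule countable_finite)
  have "continuous (at x) u" if "x \<in> - S" for x
  proof -
    let ?C = "connected_component_set (- S) x"
    have C: "?C \<in> components (- S)" "x \<in> ?C"
      using that by (auto intro: componentsI)
    have "open ?C"
      using S by (intro open_connected_component) (auto intro: finite_imp_closed)
    obtain G G' where G: "\<And>t. t \<in> ?C \<Longrightarrow> u t = G t"
        "\<And>t. t \<in> closure ?C \<Longrightarrow> (G has_real_derivative G' t) (at t within closure ?C)" "continuous_on (closure ?C) G'"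
      by (rule piecewise_C1_off_piece[OF u C(1)]) (rule that)
    have "continuous_on (closure ?C) G"
      using G(2) by (intro DERIV_continuous_on)
    then have "continuous_on ?C G"
      by (rule continuous_on_subset) (rule closure_subset)
    then have "continuous_on ?C u"
      by (rule continuous_on_eq) (simp add: G(1))
    then show ?thesis using C(2) \<open>open ?C\<close> by (simp add: continuous_on_eq_continuous_at)
  qed
  then show "continuous_on (- S) u"
    by (simp add: continuous_at_imp_continuous_on)
qed

text \<open>Integration by parts without boundary terms. Continuity of \<open>v\<close> across the
  finite set \<open>S\<close> is what lets the fundamental theorem ignore missing derivatives
  there.\<close>

lemma fourier_deriv:
  fixes v :: "real \<Rightarrow> real"
  assumes v: "continuous_on {\<alpha>..\<beta>} v" and ab: "\<alpha> \<le> \<beta>" and S: "finite S"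
    and d: "\<And>x. x \<in> {\<alpha><..<\<beta>} - S \<Longrightarrow> (v has_real_derivative v' x) (at x)"
    and end0: "v \<alpha> = 0" "v \<beta> = 0"
    and int: "(\<lambda>x. complex_of_real (v' x) * expi (\<omega> * x)) integrable_on {\<alpha>..\<beta>}"
  shows "2 * pi * \<bar>\<omega>\<bar> * norm (integral {\<alpha>..\<beta>} (\<lambda>x. complex_of_real (v x) * expi (\<omega> * x))) =
    norm (integral {\<alpha>..\<beta>} (\<lambda>x. complex_of_real (v' x) * expi (\<omega> * x)))"
proof -
  have vi: "(\<lambda>x. complex_of_real (v x) * expi (\<omega> * x)) integrable_on {\<alpha>..\<beta>}"
    by (intro integrable_continuous_interval continuous_intros continuous_on_of_real v)
  have "((\<lambda>x. complex_of_real (v x) * ((2 * pi * \<omega> * \<i>) * expi (\<omega> * x)) + complex_of_real (v' x) * expi (\<omega> * x))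
        has_integral (complex_of_real (v \<beta>) * expi (\<omega> * \<beta>) - complex_of_real (v \<alpha>) * expi (\<omega> * \<alpha>))) {\<alpha>..\<beta>}"
  proof (rule fundamental_theorem_of_calculus_interior_strong[OF S ab])
    fix x assume "x \<in> {\<alpha><..<\<beta>} - S"
    then have "((\<lambda>x. complex_of_real (v x)) has_vector_derivative complex_of_real (v' x)) (at x)"
      using d by (intro has_vector_derivative_of_real) (simp add: has_real_derivative_iff_has_vector_derivative)
    from has_vector_derivative_mult[OF this expi_has_vector_derivative[of \<omega>]]
    show "((\<lambda>x. complex_of_real (v x) * expi (\<omega> * x)) has_vector_derivative
        complex_of_real (v x) * ((2 * pi * \<omega> * \<i>) * expi (\<omega> * x)) + complex_of_real (v' x) * expi (\<omega> * x)) (at x)"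
      by simp
  qed (intro continuous_intros continuous_on_of_real v)
  from has_integral_diff[OF this integrable_integral[OF int]] end0
  have "((\<lambda>x. (2 * pi * \<omega> * \<i>) * (complex_of_real (v x) * expi (\<omega> * x))) has_integral
      (- integral {\<alpha>..\<beta>} (\<lambda>x. complex_of_real (v' x) * expi (\<omega> * x)))) {\<alpha>..\<beta>}"
    by (simp add: mult_ac)
  with has_integral_mult_right[OF integrable_integral[OF vi], of "2 * pi * \<omega> * \<i>"]
  have "(2 * pi * \<omega> * \<i>) * integral {\<alpha>..\<beta>} (\<lambda>x. complex_of_real (v x) * expi (\<omega> * x)) =
     - integral {\<alpha>..\<beta>} (\<lambda>x. complex_of_real (v' x) * expi (\<omega> * x))"
    by (rule has_integral_unique)
  then have "norm ((2 * pi * \<omega> * \<i>) * integral {\<alpha>..\<beta>} (\<lambda>x. complex_of_real (v x) * expi (\<omega> * x))) =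
     norm (integral {\<alpha>..\<beta>} (\<lambda>x. complex_of_real (v' x) * expi (\<omega> * x)))"
    by simp
  then show ?thesis by (simp add: norm_mult)
qed

section \<open>Fourier decay of weight profiles\<close>

lemma higher_deriv_eq_0_outside:
  fixes v :: "real \<Rightarrow> real"
  assumes "\<And>x. x \<notin> {\<alpha>..\<beta>} \<Longrightarrow> v x = 0" and "x \<notin> {\<alpha>..\<beta>}"
  shows "(deriv ^^ j) v x = 0"
  using assms(2)
proof (induction j arbitrary: x)
  case 0
  then show ?case using assms(1) by simp
next
  case (Suc j)
  have "open (- {\<alpha>..\<beta>})" by auto
  then have "\<forall>\<^sub>F y in nhds x. y \<in> - {\<alpha>..\<beta>}"
    using Suc.prems by (intro eventually_nhds_in_open) auto
  then have "\<forall>\<^sub>F y in nhds x. (deriv ^^ j) v y = 0"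
    by eventually_elim (use Suc.IH in auto)
  then have "deriv ((deriv ^^ j) v) x = deriv (\<lambda>y. 0) x"
    by (intro deriv_cong_ev) auto
  then show ?case by simp
qed

text \<open>Continuity carries the value 0 from the complement to its boundary points; this removes
  the boundary terms in \<open>fourier_deriv\<close>.\<close>

lemma vanish_at_endpoints:
  fixes v :: "real \<Rightarrow> real"
  assumes v: "continuous_on UNIV v" and z: "\<And>x. x \<notin> {-1..1} \<Longrightarrow> v x = 0"
  shows "v (-1) = 0" "v 1 = 0"
proof -
  have cl: "closed {x. v x = 0}"
    using continuous_closed_preimage_constant[OF v closed_UNIV, of 0] by simp
  have "closure (- {-1..1}) \<subseteq> {x. v x = 0}"
    using z by (intro closure_minimal cl) auto
  moreover have "- 1 \<in> closure (- {-1..1::real})" "1 \<in> closure (- {-1..1::real})"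
    by (simp_all add: closure_complement)
  ultimately show "v (-1) = 0" "v 1 = 0" by auto
qed

lemma weight_profile_eq_0:
  assumes "weight_profile q \<theta>" "x \<notin> {-1..1}"
  shows "\<theta> x = 0"
proof (rule ccontr)
  assume "\<theta> x \<noteq> 0"
  then have "x \<in> closure {s. \<theta> s \<noteq> 0}"
    by (intro subsetD[OF closure_subset]) simp
  moreover have "closure {s. \<theta> s \<noteq> 0} = {-1..1}"
    using assms(1) unfolding weight_profile_def by (elim conjE)
  ultimately show False using assms(2) by simp
qed

lemma weight_profile_borel_bounded:
  assumes \<theta>: "weight_profile q \<theta>"
  obtains B where "\<theta> \<in> borel_measurable borel" "\<And>x. \<bar>\<theta> x\<bar> \<le> B"
proof -
  have "\<theta> \<in> borel_measurable borel \<and> (\<exists>B. \<forall>x\<in>{-1..1}. \<bar>\<theta> x\<bar> \<le> B)"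
  proof (cases "q = 0")
    case True
    then have "\<exists>S. piecewise_C1_off S \<theta>"
      using \<theta> by (simp only: weight_profile_def if_True)
    then obtain S where S: "piecewise_C1_off S \<theta>" ..
    obtain B where "\<forall>x\<in>{-1..1}. \<bar>\<theta> x\<bar> \<le> B"
      using piecewise_C1_fourier_bound[OF S, of "-1" 1] by force
    then show ?thesis
      using piecewise_C1_borel[OF S] by blast
  next
    case False
    then have *: "C_on_reals (q - 1) \<theta>"
      using \<theta> by (simp only: weight_profile_def if_False)
    have c: "continuous_on UNIV \<theta>"
    proof (cases "q - 1")
      case 0
      then show ?thesis using * by (simp add: C_on_reals_def)
    next
      case (Suc n)
      then have "(deriv ^^ 0) \<theta> differentiable_on UNIV"
        using * unfolding C_on_reals_def by (metis zero_less_Suc)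
      then show ?thesis using differentiable_imp_continuous_on[of \<theta> UNIV] by simp
    qed
    have "bounded (\<theta> ` {-1..1})"
      by (intro compact_imp_bounded compact_continuous_image continuous_on_subset[OF c]) auto
    then obtain B where "\<forall>x\<in>{-1..1}. \<bar>\<theta> x\<bar> \<le> B"
      unfolding bounded_iff real_norm_def ball_simps(9) ..
    then show ?thesis using borel_measurable_continuous_onI[OF c] by blast
  qed
  then obtain B where B': "\<theta> \<in> borel_measurable borel" "\<forall>x\<in>{-1..1}. \<bar>\<theta> x\<bar> \<le> B"
    by (elim conjE exE)
  note B = B'(1) bspec[OF B'(2)]
  have "\<bar>\<theta> x\<bar> \<le> B" for x
  proof (cases "x \<in> {-1..1}")
    case False
    then show ?thesis using weight_profile_eq_0[OF \<theta> False] B(2)[of 0] by auto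
  qed (rule B)
  with B(1) show ?thesis by (rule that)
qed

text \<open>The first estimate serves bounded frequencies. The second combines \<open>q\<close>
  exact integrations by parts for the derivatives of order below \<open>q\<close> with one piecewise
  integration for the derivative of order \<open>q\<close>.\<close>

lemma weight_profile_fourier_bound:
  assumes \<theta>: "weight_profile q \<theta>"
  obtains M where
    "\<And>\<omega>. norm (integral {-1..1} (\<lambda>x. complex_of_real (\<theta> x) * expi (\<omega> * x))) \<le> M"
    "\<And>\<omega>. \<bar>\<omega>\<bar> ^ (q + 1) * norm (integral {-1..1} (\<lambda>x. complex_of_real (\<theta> x) * expi (\<omega> * x))) \<le> M"
proof -
  define d where "d j = (deriv ^^ j) \<theta>" for j
  define I where "I j \<omega> = norm (integral {-1..1} (\<lambda>x. complex_of_real (d j x) * expi (\<omega> * x)))" for j \<omega>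
  have "\<exists>S. piecewise_C1_off S (d q) \<and> (q \<noteq> 0 \<longrightarrow> (\<forall>t\<in>- S. d (q - 1) differentiable (at t)))"
    using \<theta> by (cases "q = 0") (auto simp: weight_profile_def d_def)
  then obtain S where S: "piecewise_C1_off S (d q)" "\<And>t. q \<noteq> 0 \<Longrightarrow> t \<in> - S \<Longrightarrow> d (q - 1) differentiable (at t)"
    by blast
  have finS: "finite S" using S(1) by (simp add: piecewise_C1_off_def)
  have smooth: "C_on_reals (q - 1) \<theta>" if "q \<noteq> 0"
    using \<theta> that by (simp only: weight_profile_def if_False)
  have diff: "d j differentiable (at t)" if "j < q - 1" for j t
    using smooth that by (auto simp: C_on_reals_def d_def differentiable_on_def)
  have cont: "continuous_on UNIV (d j)" if "j < q" for j
  proof (cases "j < q - 1")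
    case True
    then show ?thesis using diff by (intro differentiable_imp_continuous_on) (auto simp: differentiable_on_def)
  next
    case False
    then have "j = q - 1" "q \<noteq> 0" using that by auto
    then show ?thesis using smooth by (simp add: C_on_reals_def d_def)
  qed
  have outside: "d j x = 0" if "x \<notin> {-1..1}" for j x
    unfolding d_def using weight_profile_eq_0[OF \<theta>] that by (rule higher_deriv_eq_0_outside)
  obtain M where M: "\<And>\<omega>. (\<lambda>x. complex_of_real (d q x) * expi (\<omega> * x)) integrable_on {-1..1}"
      "\<And>\<omega>. I q \<omega> \<le> M" "\<And>\<omega>. \<bar>\<omega>\<bar> * I q \<omega> \<le> M"
    using piecewise_C1_fourier_bound[OF S(1), of "-1" 1] by (auto simp: I_def)
  \<comment> \<open>Below order \<open>q - 1\<close> the derivative exists everywhere; at order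
    \<open>q - 1\<close> only off \<open>S\<close>, which \<open>fourier_deriv\<close>
    tolerates.\<close>
  have step: "2 * pi * \<bar>\<omega>\<bar> * I j \<omega> = I (Suc j) \<omega>" if j: "j < q" for j \<omega>
    unfolding I_def
  proof (rule fourier_deriv[OF _ _ finS])
    show "continuous_on {-1..1} (d j)" using cont[OF j] by (rule continuous_on_subset) auto
    show "d j (-1) = 0" "d j 1 = 0"
      using vanish_at_endpoints[OF cont[OF j] outside] by auto
    fix x :: real assume "x \<in> {-1<..<1} - S"
    then have "d j differentiable (at x)"
      using diff[of j x] S(2)[of x] j by (cases "j < q - 1") (auto simp: not_less dest: le_antisym)
    then show "(d j has_real_derivative d (Suc j) x) (at x)"
      by (simp add: d_def DERIV_deriv_iff_real_differentiable)
  next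
    show "(\<lambda>x. complex_of_real (d (Suc j) x) * expi (\<omega> * x)) integrable_on {- 1..1}"
    proof (cases "Suc j < q")
      case True
      then show ?thesis
        by (intro integrable_continuous_interval continuous_intros continuous_on_of_real
            continuous_on_subset[OF cont]) auto
    next
      case False
      then have "Suc j = q" using j by simp
      then show ?thesis using M(1) by simp
    qed
  qed simp
  have pow: "(2 * pi * \<bar>\<omega>\<bar>) ^ j * I 0 \<omega> = I j \<omega>" if "j \<le> q" for j \<omega>
    using that
  proof (induction j)
    case (Suc j)
    then show ?case using step[of j \<omega>] by (simp add: mult.assoc)
  qed simp
  have I0: "0 \<le> I j \<omega>" for j \<omega> by (simp add: I_def)
  have "\<bar>\<omega>\<bar> ^ (q + 1) * I 0 \<omega> \<le> M" for \<omega>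
  proof -
    \<comment> \<open>Each integration by parts gains a factor 2 pi \<ge> 1, which is given
      away.\<close>
    have "\<bar>\<omega>\<bar> ^ q * I 0 \<omega> \<le> (2 * pi * \<bar>\<omega>\<bar>) ^ q * I 0 \<omega>"
      using pi_gt3 I0 by (intro mult_right_mono power_mono) (auto simp: mult_le_cancel_right1 intro: abs_ge_zero)
    also have "\<dots> = I q \<omega>" by (rule pow) simp
    finally have "\<bar>\<omega>\<bar> * (\<bar>\<omega>\<bar> ^ q * I 0 \<omega>) \<le> \<bar>\<omega>\<bar> * I q \<omega>"
      by (intro mult_left_mono) auto
    then show ?thesis using M(3)[of \<omega>] by (simp add: mult.assoc)
  qed
  note decay = this
  obtain B where B: "\<And>x. \<bar>\<theta> x\<bar> \<le> B"
    using weight_profile_borel_bounded[OF \<theta>] by blast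
  have B0: "0 \<le> B" using B[of 0] by linarith
  have "I 0 \<omega> \<le> 2 * B" for \<omega>
  proof (cases "(\<lambda>x. complex_of_real (d 0 x) * expi (\<omega> * x)) integrable_on {-1..1}")
    case True
    have "norm (integral {-1..1} (\<lambda>x. complex_of_real (d 0 x) * expi (\<omega> * x))) \<le> B * measure lborel {-1..1::real}"
      using B B0 by (intro has_integral_bound_real[OF _ finite.emptyI integrable_integral[OF True]])
        (auto simp: norm_mult d_def)
    then show ?thesis by (simp add: I_def)
  next
    \<comment> \<open>A non-integrable function has gauge integral 0 by convention, so the bound
      also holds in this case.\<close>
    case False
    then show ?thesis using B0 by (simp add: I_def not_integrable_integral)
  qed
  then have "I 0 \<omega> \<le> max M (2 * B)" "\<bar>\<omega>\<bar> ^ (q + 1) * I 0 \<omega> \<le> max M (2 * B)" for \<omega>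
    using decay[of \<omega>] by (simp_all add: le_max_iff_disj)
  then show ?thesis
    by (intro that[of "max M (2 * B)"]) (simp_all add: I_def d_def)
qed

text \<open>Merges a bound for low and a bound for high frequencies into one formula: 1 + w^2 is at
  most 2 for |w| \<le> 1 and at most 2 w^2 otherwise, whence the factor
  \<open>2 ^ n\<close>.\<close>

lemma fourier_bound_square:
  fixes y w M :: real
  assumes "0 \<le> y" "y \<le> M" "\<bar>w\<bar> ^ n * y \<le> M"
  shows "y\<^sup>2 \<le> 2 ^ n * M\<^sup>2 / (1 + w\<^sup>2) ^ n"
proof -
  have pos: "0 < (1 + w\<^sup>2) ^ n"
    by (intro zero_less_power add_pos_nonneg) auto
  have "y\<^sup>2 * (1 + w\<^sup>2) ^ n \<le> 2 ^ n * M\<^sup>2"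
  proof (cases "\<bar>w\<bar> \<le> 1")
    case True
    then have "w\<^sup>2 \<le> 1" by (simp add: abs_square_le_1)
    then have "(1 + w\<^sup>2) ^ n \<le> 2 ^ n" by (intro power_mono) auto
    moreover have "y\<^sup>2 \<le> M\<^sup>2" using assms by (intro power_mono) auto
    ultimately have "y\<^sup>2 * (1 + w\<^sup>2) ^ n \<le> M\<^sup>2 * 2 ^ n" using pos by (intro mult_mono) auto
    then show ?thesis by (simp add: mult.commute)
  next
    case False
    then have "1 \<le> w\<^sup>2" using power_mono[of 1 "\<bar>w\<bar>" 2] by simp
    then have "(1 + w\<^sup>2) ^ n \<le> (2 * w\<^sup>2) ^ n" by (intro power_mono) auto
    then have "y\<^sup>2 * (1 + w\<^sup>2) ^ n \<le> y\<^sup>2 * (2 * w\<^sup>2) ^ n" by (intro mult_left_mono) auto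
    also have "\<dots> = 2 ^ n * (\<bar>w\<bar> ^ n * y)\<^sup>2"
    proof -
      have "(\<bar>w\<bar> ^ n)\<^sup>2 = (w\<^sup>2) ^ n"
        by (metis power2_abs power_commutes power_mult mult.commute)
      then show ?thesis by (simp add: power_mult_distrib)
    qed
    also have "\<dots> \<le> 2 ^ n * M\<^sup>2"
      using assms by (intro mult_left_mono power_mono) auto
    finally show ?thesis .
  qed
  then show ?thesis using pos by (simp add: pos_le_divide_eq)
qed

subsection \<open>Averages over rotations and over the lattice\<close>

text \<open>Invariance is given for images of sets, a push-forward concerns preimages; the preimage
  under \<open>rot \<phi>\<close> is the image under \<open>rot (- \<phi>)\<close>.\<close>

lemma haar_SO2_translate:
  assumes \<mu>: "normalized_haar_SO2 \<mu>"
  shows "distr \<mu> \<mu> (\<lambda>\<eta>. rot \<phi> ** \<eta>) = \<mu>"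
proof (rule measure_eqI)
  have sets: "sets \<mu> = sets (restrict_space borel SO2)" and
    inv: "\<And>R A. R \<in> SO2 \<Longrightarrow> A \<in> sets \<mu> \<Longrightarrow> emeasure \<mu> ((\<lambda>\<eta>. R ** \<eta>) ` A) = emeasure \<mu> A"
    using \<mu> by (auto simp: normalized_haar_SO2_def)
  have space: "space \<mu> = SO2"
    using sets_eq_imp_space_eq[OF sets] by (simp add: space_restrict_space)
  have cancel: "rot \<psi> ** (rot (- \<psi>) ** X) = X" "rot (- \<psi>) ** (rot \<psi> ** X) = X" for X :: "real^2^2" and \<psi>
    by (simp_all add: matrix_mul_assoc rot_0 flip: rot_add)
  have mul: "rot \<psi> ** X \<in> SO2" if "X \<in> SO2" for \<psi> X
    using SO2_imp_rot[OF that] rot_add rot_in_SO2 by metis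
  have "continuous_on UNIV (\<lambda>X::real^2^2. rot \<phi> ** X)"
    unfolding matrix_matrix_mult_def by (intro continuous_on_vec_lambda continuous_intros)
  then have "(\<lambda>X. rot \<phi> ** X) \<in> restrict_space borel SO2 \<rightarrow>\<^sub>M restrict_space borel SO2"
    using mul by (intro measurable_restrict_space2 measurable_restrict_space1 borel_measurable_continuous_onI)
      (auto simp: space_restrict_space)
  then have meas: "(\<lambda>X. rot \<phi> ** X) \<in> \<mu> \<rightarrow>\<^sub>M \<mu>"
    using sets by (simp cong: measurable_cong_sets)
  show "emeasure (distr \<mu> \<mu> (\<lambda>\<eta>. rot \<phi> ** \<eta>)) A = emeasure \<mu> A" if "A \<in> sets (distr \<mu> \<mu> (\<lambda>\<eta>. rot \<phi> ** \<eta>))" for A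
  proof -
    have A: "A \<in> sets \<mu>" using that by simp
    have AS: "A \<subseteq> SO2" using sets.sets_into_space[OF A] space by simp
    have "(\<lambda>X. rot \<phi> ** X) -` A \<inter> space \<mu> = (\<lambda>X. rot (- \<phi>) ** X) ` A"
    proof (intro set_eqI iffI)
      fix X assume "X \<in> (\<lambda>X. rot \<phi> ** X) -` A \<inter> space \<mu>"
      then show "X \<in> (\<lambda>X. rot (- \<phi>) ** X) ` A"
        using cancel(2)[of \<phi> X] by (intro image_eqI[of _ _ "rot \<phi> ** X"]) auto
    next
      fix X assume "X \<in> (\<lambda>X. rot (- \<phi>) ** X) ` A"
      then show "X \<in> (\<lambda>X. rot \<phi> ** X) -` A \<inter> space \<mu>"
        using cancel(1)[of \<phi>] AS mul space by auto
    qed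
    then show ?thesis
      using inv[OF rot_in_SO2 A, of "- \<phi>"] by (simp add: emeasure_distr[OF meas A])
  qed
qed simp

lemma space_haar_SO2: "normalized_haar_SO2 \<mu> \<Longrightarrow> space \<mu> = SO2"
  unfolding normalized_haar_SO2_def
  by (auto dest!: sets_eq_imp_space_eq simp: space_restrict_space)

lemma measurable_haar_SO2:
  assumes "normalized_haar_SO2 \<mu>" "u \<in> borel_measurable borel"
  shows "u \<in> borel_measurable \<mu>"
  using measurable_restrict_space1[OF assms(2), of SO2] assms(1)
  by (simp add: normalized_haar_SO2_def cong: measurable_cong_sets)

lemma finite_measure_haar_SO2: "normalized_haar_SO2 \<mu> \<Longrightarrow> finite_measure \<mu>"
  by (intro finite_measureI) (simp add: space_haar_SO2 normalized_haar_SO2_def)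

text \<open>Replaces a Haar integral by an integral over an angle without a formula for
  \<open>\<mu>\<close>: by invariance \<open>\<eta>\<close> may be turned by any
  \<open>\<phi>\<close>; integrating over \<open>\<phi>\<close> and exchanging the integrals leaves
  an angular integral that is bounded for every \<open>\<eta>\<close>. The length 2 pi \<ge> 1 of
  the angular range is given away.\<close>

lemma nn_integral_haar_SO2_le:
  fixes u :: "real^2^2 \<Rightarrow> ennreal"
  assumes \<mu>: "normalized_haar_SO2 \<mu>" and u: "u \<in> borel_measurable borel"
    and K: "\<And>\<eta>. \<eta> \<in> SO2 \<Longrightarrow> (\<integral>\<^sup>+\<phi>\<in>{0..2 * pi}. u (rot \<phi> ** \<eta>) \<partial>lborel) \<le> K"
  shows "(\<integral>\<^sup>+\<eta>. u \<eta> \<partial>\<mu>) \<le> K"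
proof -
  interpret finite_measure \<mu> using \<mu> by (rule finite_measure_haar_SO2)
  interpret P: pair_sigma_finite lborel \<mu> ..
  note [measurable] = u measurable_haar_SO2[OF \<mu> u]
  have idm: "(\<lambda>\<eta>. \<eta>) \<in> \<mu> \<rightarrow>\<^sub>M borel"
    using measurable_haar_SO2[OF \<mu>, of "\<lambda>\<eta>. \<eta>"] by simp
  have rotm: "rot \<in> borel_measurable borel"
    by (rule borel_measurable_continuous_onI[OF continuous_rot])
  have cont: "continuous_on UNIV (\<lambda>z::(real^2^2) \<times> (real^2^2). fst z ** snd z)"
    unfolding matrix_matrix_mult_def by (intro continuous_on_vec_lambda continuous_intros)
  have rotmul: "(\<lambda>z. rot (fst z) ** snd z) \<in> (lborel \<Otimes>\<^sub>M \<mu>) \<rightarrow>\<^sub>M borel"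
  proof (rule borel_measurable_continuous_Pair[where f = "\<lambda>z. rot (fst z)" and g = snd and H = "(**)"])
    show "(\<lambda>z. rot (fst z)) \<in> borel_measurable (lborel \<Otimes>\<^sub>M \<mu>)"
      using rotm by (intro measurable_compose[OF measurable_fst]) simp
    show "snd \<in> borel_measurable (lborel \<Otimes>\<^sub>M \<mu>)"
      using measurable_compose[OF measurable_snd idm, of lborel] by simp
  qed (rule cont)
  have "(\<lambda>\<eta>. rot \<phi> ** \<eta>) \<in> \<mu> \<rightarrow>\<^sub>M borel" for \<phi>
    using measurable_compose[OF measurable_Pair1' rotmul] by simp
  have trans: "(\<integral>\<^sup>+\<eta>. u (rot \<phi> ** \<eta>) \<partial>\<mu>) = (\<integral>\<^sup>+\<eta>. u \<eta> \<partial>\<mu>)" for \<phi>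
  proof -
    have m: "(\<lambda>\<eta>. rot \<phi> ** \<eta>) \<in> \<mu> \<rightarrow>\<^sub>M \<mu>"
    proof -
      have "(\<lambda>\<eta>. rot \<phi> ** \<eta>) \<in> \<mu> \<rightarrow>\<^sub>M restrict_space borel SO2"
        using \<open>\<And>\<phi>. (\<lambda>\<eta>. rot \<phi> ** \<eta>) \<in> \<mu> \<rightarrow>\<^sub>M borel\<close> space_haar_SO2[OF \<mu>] SO2_imp_rot rot_add rot_in_SO2
        by (intro measurable_restrict_space2) (auto, metis)
      then show ?thesis using \<mu> by (simp add: normalized_haar_SO2_def cong: measurable_cong_sets)
    qed
    show ?thesis
      by (subst (2) haar_SO2_translate[OF \<mu>, of \<phi>, symmetric]) (simp add: nn_integral_distr[OF m])
  qed
  have "(\<integral>\<^sup>+\<eta>. u \<eta> \<partial>\<mu>) \<le> ennreal (2 * pi) * (\<integral>\<^sup>+\<eta>. u \<eta> \<partial>\<mu>)"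
  proof -
    have "ennreal 1 \<le> ennreal (2 * pi)" using pi_gt3 by (intro ennreal_leI) simp
    from mult_right_mono[OF this] show ?thesis by simp
  qed
  also have "\<dots> = (\<integral>\<^sup>+\<phi>\<in>{0..2 * pi}. (\<integral>\<^sup>+\<eta>. u (rot \<phi> ** \<eta>) \<partial>\<mu>) \<partial>lborel)"
    by (simp add: trans nn_integral_cmult_indicator mult.commute)
  also have "\<dots> = (\<integral>\<^sup>+\<phi>. \<integral>\<^sup>+\<eta>. u (rot \<phi> ** \<eta>) * indicator {0..2 * pi} \<phi> \<partial>\<mu> \<partial>lborel)"
    using measurable_compose[OF \<open>\<And>\<phi>. (\<lambda>\<eta>. rot \<phi> ** \<eta>) \<in> \<mu> \<rightarrow>\<^sub>M borel\<close> u]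
    by (simp add: nn_integral_multc)
  also have "\<dots> = (\<integral>\<^sup>+\<eta>. \<integral>\<^sup>+\<phi>. u (rot \<phi> ** \<eta>) * indicator {0..2 * pi} \<phi> \<partial>lborel \<partial>\<mu>)"
  proof (rule P.Fubini'[symmetric])
    have "(\<lambda>z. u (rot (fst z) ** snd z) * indicator {0..2 * pi} (fst z)) \<in> borel_measurable (lborel \<Otimes>\<^sub>M \<mu>)"
      using measurable_compose[OF rotmul u] by measurable
    then show "(\<lambda>(\<phi>, \<eta>). u (rot \<phi> ** \<eta>) * indicator {0..2 * pi} \<phi>) \<in> borel_measurable (lborel \<Otimes>\<^sub>M \<mu>)"
      by (simp add: case_prod_beta)
  qed
  also have "\<dots> \<le> (\<integral>\<^sup>+\<eta>. K \<partial>\<mu>)"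
    using K space_haar_SO2[OF \<mu>] by (intro nn_integral_mono) auto
  also have "\<dots> = K"
    using \<mu> space_haar_SO2[OF \<mu>] by (simp add: normalized_haar_SO2_def)
  finally show ?thesis .
qed

section \<open>Integrals over the rotation angle\<close>

lemma abs_sin_ge_half:
  assumes "\<bar>t\<bar> \<le> pi / 2" shows "\<bar>t\<bar> / 2 \<le> \<bar>sin t\<bar>"
proof -
  have pos: "x / 2 \<le> sin x" if x: "0 \<le> x" "x \<le> pi / 2" for x :: real
  proof (cases "x \<le> pi / 3")
    case True
    have "sin 0 - 0 / 2 \<le> sin x - x / 2"
    proof (rule DERIV_nonneg_imp_nondecreasing[OF x(1)])
      fix y assume y: "0 \<le> y" "y \<le> x"
      have "cos (pi / 3) \<le> cos y"
        using y True by (intro cos_monotone_0_pi_le) auto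
      then show "\<exists>D. ((\<lambda>x. sin x - x / 2) has_real_derivative D) (at y) \<and> 0 \<le> D"
        by (intro exI[of _ "cos y - 1 / 2"] conjI) (auto intro!: derivative_eq_intros simp: cos_60)
    qed
    then show ?thesis by simp
  next
    \<comment> \<open>Beyond pi/3 the number 4/5 separates the two sides: sqrt 3 / 2 \<ge> 4/5 \<ge>
      pi/4.\<close>
    case False
    have "sin (pi / 3) \<le> sin x"
      using False x by (intro sin_monotone_2pi_le) auto
    moreover have "x / 2 \<le> 4 / 5" using x pi_less_4 pi_approx by simp
    moreover have "(8 / 5)\<^sup>2 \<le> (3::real)" by (simp add: power2_eq_square)
    then have "8 / 5 \<le> sqrt 3" by (rule real_le_rsqrt)
    ultimately show ?thesis by (simp add: sin_60)
  qed
  show ?thesis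
    using pos[of t] pos[of "- t"] assms by (cases "0 \<le> t") auto
qed

lemma nn_integral_inverse_1_plus_square_le:
  assumes A: "A > 0" and "a \<le> b"
  shows "(\<integral>\<^sup>+x\<in>{a..b}. ennreal (1 / (1 + (A * (x - d))\<^sup>2)) \<partial>lborel) \<le> ennreal (pi / A)"
proof -
  let ?F = "\<lambda>x. arctan (A * (x - d)) / A"
  have "(\<integral>\<^sup>+x\<in>{a..b}. ennreal (1 / (1 + (A * (x - d))\<^sup>2)) \<partial>lborel) = ennreal (?F b - ?F a)"
  proof (rule nn_integral_FTC_Icc[OF _ _ _ \<open>a \<le> b\<close>])
    fix x
    have "((\<lambda>x. arctan (A * (x - d))) has_real_derivative 1 / (1 + (A * (x - d))\<^sup>2) * A) (at x)"
      by (auto intro!: derivative_eq_intros simp: divide_inverse)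
    from DERIV_cdivide[OF this, of A]
    show "(?F has_real_derivative 1 / (1 + (A * (x - d))\<^sup>2)) (at x)"
      using A by simp
  qed auto
  also have "\<dots> \<le> ennreal (pi / A)"
  proof (rule ennreal_leI)
    have "arctan (A * (b - d)) - arctan (A * (a - d)) \<le> pi"
      using arctan_bounded[of "A * (b - d)"] arctan_bounded[of "A * (a - d)"] by linarith
    then show "?F b - ?F a \<le> pi / A"
      using A by (simp add: divide_right_mono flip: diff_divide_distrib)
  qed
  finally show ?thesis .
qed

text \<open>The sine is at least half the distance to its nearest zero, so the integrand lies below
  an arctangent density centred at that zero. Four zeros contribute \<open>pi / (A / 2)\<close>
  each, which gives the constant 8 pi.\<close>

lemma angular_integral_le:
  assumes A: "A > 0"
  shows "(\<integral>\<^sup>+\<phi>\<in>{0..2 * pi}. ennreal (1 / (1 + (A * sin (\<phi> + c))\<^sup>2)) \<partial>lborel) \<le> ennreal (8 * pi / A)"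
proof -
  define j0 where "j0 = \<lfloor>c / pi\<rfloor>"
  \<comment> \<open>As \<phi> + c runs through an interval of length 2 pi starting at
    \<open>c\<close>, these are all possible indices of its nearest zero.\<close>
  let ?J = "{j0..j0 + 3}"
  let ?g = "\<lambda>j \<phi>. 1 / (1 + (A / 2 * (\<phi> - (of_int j * pi - c)))\<^sup>2)"
  have pos: "0 < 1 + (x::real)\<^sup>2" for x by (simp add: add_pos_nonneg)
  have pw: "1 / (1 + (A * sin (\<phi> + c))\<^sup>2) \<le> (\<Sum>j\<in>?J. ?g j \<phi>)" if \<phi>: "\<phi> \<in> {0..2 * pi}" for \<phi>
  proof -
    define j where "j = \<lfloor>(\<phi> + c) / pi + 1 / 2\<rfloor>"
    define t where "t = \<phi> + c - of_int j * pi"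
    have j: "of_int j \<le> (\<phi> + c) / pi + 1 / 2" "(\<phi> + c) / pi + 1 / 2 < of_int j + 1"
      unfolding j_def by linarith+
    have "of_int j * pi \<le> \<phi> + c + pi / 2" "\<phi> + c < of_int j * pi + pi / 2"
      using j pi_gt_zero by (simp_all add: field_simps)
    then have t: "\<bar>t\<bar> \<le> pi / 2" unfolding t_def by linarith
    have "j \<in> ?J"
    proof -
      have "j0 \<le> j" unfolding j_def j0_def using \<phi> pi_gt_zero
        by (intro floor_mono) (simp add: field_simps)
      moreover have "(\<phi> + c) / pi + 1 / 2 \<le> c / pi + 5 / 2"
        using \<phi> pi_gt_zero by (simp add: field_simps)
      then have "j \<le> \<lfloor>c / pi + 5 / 2\<rfloor>" unfolding j_def by (rule floor_mono)
      moreover have "\<lfloor>c / pi + 5 / 2\<rfloor> \<le> j0 + 3"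
        unfolding j0_def by linarith
      ultimately show ?thesis by simp
    qed
    have sin: "(sin (\<phi> + c))\<^sup>2 = (sin t)\<^sup>2"
    proof -
      have "sin (\<phi> + c) = sin (t + pi * of_int j)" by (simp add: t_def)
      also have "\<dots> = sin t * cos (pi * of_int j)"
        by (simp only: sin_add sin_npi_int mult_zero_right add_0_right)
      also have "\<dots>\<^sup>2 = (sin t)\<^sup>2"
        by (simp add: power_mult_distrib)
      finally show ?thesis .
    qed
    have "(\<bar>t\<bar> / 2)\<^sup>2 \<le> \<bar>sin t\<bar>\<^sup>2"
      using abs_sin_ge_half[OF t] by (intro power_mono) auto
    then have "A\<^sup>2 * (t / 2)\<^sup>2 \<le> A\<^sup>2 * (sin t)\<^sup>2"
      by (intro mult_left_mono) (auto simp: power_divide)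
    then have "(A / 2 * t)\<^sup>2 \<le> (A * sin (\<phi> + c))\<^sup>2"
      using sin by (simp add: power_mult_distrib power_divide)
    then have "1 / (1 + (A * sin (\<phi> + c))\<^sup>2) \<le> 1 / (1 + (A / 2 * t)\<^sup>2)"
      using pos by (intro divide_left_mono) auto
    also have "\<dots> = ?g j \<phi>" by (simp add: t_def algebra_simps)
    also have "\<dots> \<le> (\<Sum>j\<in>?J. ?g j \<phi>)"
      using \<open>j \<in> ?J\<close> pos by (intro member_le_sum) (auto simp: less_imp_le)
    finally show ?thesis .
  qed
  have "(\<integral>\<^sup>+\<phi>\<in>{0..2 * pi}. ennreal (1 / (1 + (A * sin (\<phi> + c))\<^sup>2)) \<partial>lborel) \<le>
     (\<integral>\<^sup>+\<phi>. (\<Sum>j\<in>?J. ennreal (?g j \<phi>) * indicator {0..2 * pi} \<phi>) \<partial>lborel)"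
  proof (intro nn_integral_mono)
    fix \<phi> :: real
    have "ennreal (1 / (1 + (A * sin (\<phi> + c))\<^sup>2)) \<le> (\<Sum>j\<in>?J. ennreal (?g j \<phi>))" if "\<phi> \<in> {0..2 * pi}"
      using pw[OF that] by (subst sum_ennreal) (auto intro!: ennreal_leI)
    then show "ennreal (1 / (1 + (A * sin (\<phi> + c))\<^sup>2)) * indicator {0..2 * pi} \<phi>
        \<le> (\<Sum>j\<in>?J. ennreal (?g j \<phi>) * indicator {0..2 * pi} \<phi>)"
      by (cases "\<phi> \<in> {0..2 * pi}") auto
  qed
  also have "\<dots> = (\<Sum>j\<in>?J. \<integral>\<^sup>+\<phi>\<in>{0..2 * pi}. ennreal (?g j \<phi>) \<partial>lborel)"
    by (intro nn_integral_sum) auto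
  also have "\<dots> \<le> (\<Sum>j\<in>?J. ennreal (pi / (A / 2)))"
    using A by (intro sum_mono nn_integral_inverse_1_plus_square_le) auto
  also have "\<dots> = ennreal (8 * pi / A)"
    using A by (simp flip: ennreal_numeral ennreal_mult)
  finally show ?thesis .
qed

text \<open>Either the squared cosine or the squared sine is at least 1/2. In the first case the
  first factor is at most 2/R^2 and one of the \<open>q + 1\<close> copies of the second is
  integrated; in the second case all \<open>q + 1\<close> copies are bounded and the first factor is
  integrated. With 8 pi from \<open>angular_integral_le\<close> the constants are 2 * 8 = 16 and
  \<open>2 ^ (q + 1) * 8 = 2 ^ (q + 4)\<close>.\<close>

lemma angular_average_le:
  fixes R \<epsilon> c :: real
  assumes R: "R > 0" and e: "\<epsilon> > 0"
  shows "(\<integral>\<^sup>+\<phi>\<in>{0..2 * pi}. ennreal (1 / (1 + (R * cos (\<phi> + c))\<^sup>2) * (1 / (1 + (\<epsilon> * (R * sin (\<phi> + c)))\<^sup>2) ^ (q + 1))) \<partial>lborel)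
     \<le> ennreal (16 * pi / (\<epsilon> * R ^ 3) + 2 ^ (q + 4) * pi / (\<epsilon> ^ (2 * q + 2) * R ^ (2 * q + 3)))"
proof -
  have pos: "0 < 1 + (x::real)\<^sup>2" for x by (simp add: add_pos_nonneg)
  let ?u = "\<lambda>\<phi>. 1 / (1 + (R * sin (\<phi> + (c + pi / 2)))\<^sup>2)"
  let ?v = "\<lambda>\<phi>. 1 / (1 + ((\<epsilon> * R) * sin (\<phi> + c))\<^sup>2)"
  let ?a = "2 / R\<^sup>2" and ?b = "(2 / (\<epsilon> * R)\<^sup>2) ^ (q + 1)"
  have pw: "1 / (1 + (R * cos x)\<^sup>2) * (1 / (1 + (\<epsilon> * (R * sin x))\<^sup>2) ^ (q + 1)) \<le>
      ?a * (1 / (1 + ((\<epsilon> * R) * sin x)\<^sup>2)) + ?b * (1 / (1 + (R * cos x)\<^sup>2))" for x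
  proof -
    let ?X = "1 / (1 + (R * cos x)\<^sup>2)" and ?Y = "1 / (1 + ((\<epsilon> * R) * sin x)\<^sup>2)"
    have X: "0 < ?X" "?X \<le> 1" and Y: "0 < ?Y" "?Y \<le> 1" using pos by auto
    have "?X * ?Y ^ (q + 1) \<le> ?a * ?Y + ?b * ?X"
    proof (cases "1 / 2 \<le> (cos x)\<^sup>2")
      case True
      have "R\<^sup>2 * (1 / 2) \<le> R\<^sup>2 * (cos x)\<^sup>2" using True by (intro mult_left_mono) auto
      then have "R\<^sup>2 / 2 \<le> 1 + (R * cos x)\<^sup>2" by (simp add: power_mult_distrib)
      then have "?X \<le> 1 / (R\<^sup>2 / 2)" using R by (intro divide_left_mono) (auto intro!: mult_pos_pos pos)
      then have "?X \<le> ?a" by simp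
      moreover have "?Y ^ (q + 1) \<le> ?Y" using power_decreasing[of 1 "q + 1" ?Y] Y by simp
      ultimately have "?X * ?Y ^ (q + 1) \<le> ?a * ?Y" using X Y by (intro mult_mono) auto
      moreover have "0 \<le> ?b * ?X" using X by simp
      ultimately show ?thesis by linarith
    next
      case False
      then have "1 / 2 \<le> (sin x)\<^sup>2" using sin_cos_squared_add[of x] by linarith
      then have "(\<epsilon> * R)\<^sup>2 * (1 / 2) \<le> (\<epsilon> * R)\<^sup>2 * (sin x)\<^sup>2" by (intro mult_left_mono) auto
      then have "(\<epsilon> * R)\<^sup>2 / 2 \<le> 1 + ((\<epsilon> * R) * sin x)\<^sup>2" by (simp add: power_mult_distrib)
      then have "?Y \<le> 1 / ((\<epsilon> * R)\<^sup>2 / 2)" using R e by (intro divide_left_mono) (auto intro!: mult_pos_pos pos)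
      then have "?Y \<le> 2 / (\<epsilon> * R)\<^sup>2" by simp
      then have "?Y ^ (q + 1) \<le> ?b" using Y by (intro power_mono) auto
      then have "?X * ?Y ^ (q + 1) \<le> ?X * ?b" using X by (intro mult_left_mono) auto
      moreover have "0 \<le> ?a * ?Y" using Y by simp
      ultimately show ?thesis by (simp only: mult.commute[of ?X ?b])
    qed
    then show ?thesis by (simp add: power_one_over mult.assoc)
  qed
  have "(\<integral>\<^sup>+\<phi>\<in>{0..2 * pi}. ennreal (1 / (1 + (R * cos (\<phi> + c))\<^sup>2) * (1 / (1 + (\<epsilon> * (R * sin (\<phi> + c)))\<^sup>2) ^ (q + 1))) \<partial>lborel)
      \<le> (\<integral>\<^sup>+\<phi>. ennreal ?a * (ennreal (?v \<phi>) * indicator {0..2 * pi} \<phi>) + ennreal ?b * (ennreal (?u \<phi>) * indicator {0..2 * pi} \<phi>) \<partial>lborel)"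
  proof (intro nn_integral_mono)
    fix \<phi> :: real
    have cs: "sin (\<phi> + (c + pi / 2)) = cos (\<phi> + c)"
      by (simp add: sin_add cos_add flip: add.assoc)
    have "ennreal (1 / (1 + (R * cos (\<phi> + c))\<^sup>2) * (1 / (1 + (\<epsilon> * (R * sin (\<phi> + c)))\<^sup>2) ^ (q + 1)))
        \<le> ennreal (?a * ?v \<phi> + ?b * ?u \<phi>)"
      unfolding cs by (rule ennreal_leI[OF pw])
    also have "\<dots> = ennreal ?a * ennreal (?v \<phi>) + ennreal ?b * ennreal (?u \<phi>)"
    proof -
      have "0 \<le> ?v \<phi>" "0 \<le> ?u \<phi>" "0 \<le> ?a" "0 \<le> ?b" using pos by (auto simp: less_imp_le)
      then show ?thesis
        by (simp only: ennreal_plus ennreal_mult mult_nonneg_nonneg)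
    qed
    finally show "ennreal (1 / (1 + (R * cos (\<phi> + c))\<^sup>2) * (1 / (1 + (\<epsilon> * (R * sin (\<phi> + c)))\<^sup>2) ^ (q + 1))) * indicator {0..2 * pi} \<phi> \<le>
       ennreal ?a * (ennreal (?v \<phi>) * indicator {0..2 * pi} \<phi>) + ennreal ?b * (ennreal (?u \<phi>) * indicator {0..2 * pi} \<phi>)"
      by (cases "\<phi> \<in> {0..2 * pi}") auto
  qed
  also have "\<dots> = ennreal ?a * (\<integral>\<^sup>+\<phi>\<in>{0..2 * pi}. ennreal (?v \<phi>) \<partial>lborel) + ennreal ?b * (\<integral>\<^sup>+\<phi>\<in>{0..2 * pi}. ennreal (?u \<phi>) \<partial>lborel)"
    by (subst nn_integral_add) (auto simp: nn_integral_cmult)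
  also have "\<dots> \<le> ennreal ?a * ennreal (8 * pi / (\<epsilon> * R)) + ennreal ?b * ennreal (8 * pi / R)"
    using R e by (intro add_mono mult_left_mono angular_integral_le) auto
  also have "\<dots> = ennreal (?a * (8 * pi / (\<epsilon> * R)) + ?b * (8 * pi / R))"
  proof -
    have "0 \<le> ?a" "0 \<le> ?b" "0 \<le> 8 * pi / (\<epsilon> * R)" "0 \<le> 8 * pi / R" using R e by auto
    then show ?thesis by (simp only: ennreal_plus ennreal_mult mult_nonneg_nonneg)
  qed
  also have "?a * (8 * pi / (\<epsilon> * R)) = 16 * pi / (\<epsilon> * R ^ 3)"
    by (simp add: power3_eq_cube power2_eq_square)
  also have "?b * (8 * pi / R) = 2 ^ (q + 4) * pi / (\<epsilon> ^ (2 * q + 2) * R ^ (2 * q + 3))"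
  proof -
    have "?b = 2 ^ (q + 1) / (\<epsilon> ^ (2 * q + 2) * R ^ (2 * q + 2))"
      by (simp add: power_divide power_mult_distrib power_mult[symmetric] del: power_Suc)
    moreover have "R ^ (2 * q + 3) = R ^ (2 * q + 2) * R" by (simp add: power_add eval_nat_numeral)
    moreover have "(2::real) ^ (q + 4) = 2 ^ (q + 1) * 8" by (simp add: power_add)
    ultimately show ?thesis by simp
  qed
  finally show ?thesis .
qed

section \<open>Summation over the lattice\<close>

lemma nn_integral_int_powr_finite:
  "(\<integral>\<^sup>+k. ennreal ((1 + \<bar>real_of_int k\<bar>) powr (- 3 / 2)) \<partial>count_space UNIV) < \<infinity>"
proof -
  let ?f = "\<lambda>k. ennreal ((1 + \<bar>real_of_int k\<bar>) powr (- 3 / 2))"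
  have fin: "(\<integral>\<^sup>+n. ennreal ((1 + real n) powr (- 3 / 2)) \<partial>count_space UNIV) < \<infinity>"
  proof -
    have "summable (\<lambda>n. real (Suc n) powr (- 3 / 2))"
      using summable_real_powr_iff[of "- 3 / 2"] by (subst summable_Suc_iff) simp
    then have "summable (\<lambda>n. (1 + real n) powr (- 3 / 2))"
      by simp
    then have "(\<Sum>n. ennreal ((1 + real n) powr (- 3 / 2))) \<noteq> top"
      by (intro ennreal_suminf_neq_top) auto
    then show ?thesis by (simp add: nn_integral_count_space_nat less_top)
  qed
  have "(\<integral>\<^sup>+k. ?f k \<partial>count_space UNIV) \<le> (\<integral>\<^sup>+k. ?f k * indicator (range int) k + ?f k * indicator (range (\<lambda>n. - int n)) k \<partial>count_space UNIV)"
  proof (intro nn_integral_mono)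
    fix k :: int
    \<comment> \<open>The two ranges overlap in 0, which is counted twice; an upper bound permits
      that.\<close>
    have "k \<in> range int \<or> k \<in> range (\<lambda>n. - int n)"
      by (cases k rule: int_cases2) auto
    then show "?f k \<le> ?f k * indicator (range int) k + ?f k * indicator (range (\<lambda>n. - int n)) k"
      by (auto simp: indicator_def)
  qed
  also have "\<dots> = (\<integral>\<^sup>+k. ?f k \<partial>count_space (range int)) + (\<integral>\<^sup>+k. ?f k \<partial>count_space (range (\<lambda>n. - int n)))"
    by (subst nn_integral_add) (auto simp: nn_integral_count_space_indicator)
  also have "(\<integral>\<^sup>+k. ?f k \<partial>count_space (range int)) = (\<integral>\<^sup>+n. ennreal ((1 + real n) powr (- 3 / 2)) \<partial>count_space UNIV)"
    by (subst nn_integral_bij_count_space[symmetric, of int UNIV "range int"]) (auto intro: inj_on_imp_bij_betw)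
  also have "(\<integral>\<^sup>+k. ?f k \<partial>count_space (range (\<lambda>n. - int n))) = (\<integral>\<^sup>+n. ennreal ((1 + real n) powr (- 3 / 2)) \<partial>count_space UNIV)"
    by (subst nn_integral_bij_count_space[symmetric, of "\<lambda>n. - int n" UNIV "range (\<lambda>n. - int n)"])
      (auto intro!: inj_on_imp_bij_betw injI)
  finally show ?thesis
    by (rule le_less_trans) (use fin in \<open>simp add: less_top\<close>)
qed

text \<open>A product majorant makes the double sum over the lattice factor. Splitting the exponent
  3 evenly leaves 3/2 > 1 in each variable, still summable; the constant is 2^3, from 1 + |j| \<le>
  2 \<rho> and the same for \<open>k\<close>.\<close>

lemma inverse_cube_norm_le:
  assumes "j \<noteq> 0 \<or> k \<noteq> (0::int)"
  shows "1 / (sqrt ((of_int j)\<^sup>2 + (of_int k)\<^sup>2)) ^ 3 \<le>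
    8 * ((1 + \<bar>real_of_int j\<bar>) powr (- 3 / 2) * (1 + \<bar>real_of_int k\<bar>) powr (- 3 / 2))"
proof -
  define \<rho> where "\<rho> = sqrt ((real_of_int j)\<^sup>2 + (real_of_int k)\<^sup>2)"
  have "1 \<le> (real_of_int j)\<^sup>2 + (real_of_int k)\<^sup>2"
  proof -
    have "0 < j\<^sup>2 + k\<^sup>2" using assms by (auto simp: sum_power2_gt_zero_iff)
    then have "1 \<le> j\<^sup>2 + k\<^sup>2" by simp
    then have "real_of_int 1 \<le> real_of_int (j\<^sup>2 + k\<^sup>2)" by (subst of_int_le_iff)
    then show ?thesis by simp
  qed
  then have \<rho>1: "1 \<le> \<rho>" by (simp add: \<rho>_def)
  have "\<bar>real_of_int j\<bar> \<le> \<rho>" "\<bar>real_of_int k\<bar> \<le> \<rho>"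
    unfolding \<rho>_def by (auto intro!: real_le_rsqrt)
  then have "(1 + \<bar>real_of_int j\<bar>) * (1 + \<bar>real_of_int k\<bar>) \<le> (2 * \<rho>) * (2 * \<rho>)"
    using \<rho>1 by (intro mult_mono) auto
  then have "((2 * \<rho>) * (2 * \<rho>)) powr (- 3 / 2) \<le> ((1 + \<bar>real_of_int j\<bar>) * (1 + \<bar>real_of_int k\<bar>)) powr (- 3 / 2)"
    by (intro powr_mono2') (auto intro!: mult_pos_pos add_pos_nonneg)
  also have "((2 * \<rho>) * (2 * \<rho>)) powr (- 3 / 2) = (2 * \<rho>) powr (- 3)"
  proof -
    have "((2 * \<rho>) * (2 * \<rho>)) powr (- 3 / 2) = (2 * \<rho>) powr (- 3 / 2) * (2 * \<rho>) powr (- 3 / 2)"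
      by (rule powr_mult)
    then show ?thesis by (simp only: powr_add[symmetric]) simp
  qed
  also have "\<dots> = 1 / (8 * \<rho> ^ 3)"
  proof -
    have "(2 * \<rho>) powr (- 3) = inverse ((2 * \<rho>) powr (real 3))" by (simp add: powr_minus)
    also have "(2 * \<rho>) powr (real 3) = (2 * \<rho>) ^ 3" using \<rho>1 by (intro powr_realpow) auto
    finally show ?thesis by (simp add: power_mult_distrib inverse_eq_divide)
  qed
  finally have "1 / (8 * \<rho> ^ 3) \<le> (1 + \<bar>real_of_int j\<bar>) powr (- 3 / 2) * (1 + \<bar>real_of_int k\<bar>) powr (- 3 / 2)"
    by (simp only: powr_mult)
  then have "8 * (1 / (8 * \<rho> ^ 3)) \<le> 8 * ((1 + \<bar>real_of_int j\<bar>) powr (- 3 / 2) * (1 + \<bar>real_of_int k\<bar>) powr (- 3 / 2))"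
    by (intro mult_left_mono) auto
  then show ?thesis by (simp add: \<rho>_def)
qed

section \<open>Translations as vectors and as pairs\<close>

lemma nn_integral_lborel_vec2:
  fixes f :: "real^2 \<Rightarrow> ennreal"
  assumes [measurable]: "f \<in> borel_measurable borel"
  shows "(\<integral>\<^sup>+\<xi>. f \<xi> \<partial>lborel) = (\<integral>\<^sup>+x. \<integral>\<^sup>+y. f (vector [x, y]) \<partial>lborel \<partial>lborel)"
proof -
  define V where "V = (\<lambda>z::real \<times> real. vector [fst z, snd z] :: real^2)"
  have V: "V z = fst z *\<^sub>R axis 1 1 + snd z *\<^sub>R axis 2 1" for z
    by (simp add: V_def vec_eq_iff forall_2 axis_def)
  have "continuous_on UNIV V"
    unfolding V by (intro continuous_intros)
  then have [measurable]: "V \<in> borel_measurable borel"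
    by (rule borel_measurable_continuous_onI)
  have B2: "(Basis :: (real^2) set) = {axis 1 1, axis 2 1}"
    by (auto simp: Basis_vec_def UNIV_2)
  have ax: "axis 1 1 \<noteq> (axis 2 1 :: real^2)" by (simp add: axis_eq_axis)
  have "lborel = distr lborel borel V"
  \<comment> \<open>Lebesgue measure is determined by the volumes of boxes, and a coordinate box
    pulls back to a product of intervals.\<close>
  proof (rule lborel_eqI)
    fix l u :: "real^2" assume lu: "\<And>b. b \<in> Basis \<Longrightarrow> l \<bullet> b \<le> u \<bullet> b"
    have le: "l $ 1 \<le> u $ 1" "l $ 2 \<le> u $ 2"
      using lu[of "axis 1 1"] lu[of "axis 2 1"] by (auto simp: B2 inner_axis)
    have "V -` box l u = {l $ 1<..<u $ 1} \<times> {l $ 2<..<u $ 2}"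
      by (auto simp: V_def mem_box_cart forall_2)
    then have "emeasure (distr lborel borel V) (box l u) = emeasure (lborel \<Otimes>\<^sub>M lborel) ({l $ 1<..<u $ 1} \<times> {l $ 2<..<u $ 2})"
      by (simp add: emeasure_distr lborel_prod)
    also have "\<dots> = ennreal (u $ 1 - l $ 1) * ennreal (u $ 2 - l $ 2)"
      using le by (subst lborel.emeasure_pair_measure_Times) auto
    also have "\<dots> = ennreal (\<Prod>b\<in>Basis. (u - l) \<bullet> b)"
      using ax le by (simp add: B2 inner_axis ennreal_mult)
    finally show "emeasure (distr lborel borel V) (box l u) = ennreal (\<Prod>b\<in>Basis. (u - l) \<bullet> b)" .
  qed simp
  then have "(\<integral>\<^sup>+\<xi>. f \<xi> \<partial>lborel) = (\<integral>\<^sup>+z. f (V z) \<partial>lborel)"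
    using nn_integral_distr[of V "lborel" borel f] by simp
  also have "\<dots> = (\<integral>\<^sup>+x. \<integral>\<^sup>+y. f (V (x, y)) \<partial>lborel \<partial>lborel)"
    using lborel.nn_integral_fst[of "\<lambda>z. f (V z)" "lborel :: real measure"] by (simp add: lborel_prod borel_prod)
  finally show ?thesis by (simp add: V_def)
qed

lemma nn_integral_unit_square:
  fixes f :: "real^2 \<Rightarrow> ennreal"
  assumes f[measurable]: "f \<in> borel_measurable borel"
  shows "(\<integral>\<^sup>+\<xi>\<in>cbox 0 1. f \<xi> \<partial>lborel) = (\<integral>\<^sup>+x. \<integral>\<^sup>+y. f (vector [x, y]) \<partial>unit_lborel \<partial>unit_lborel)"
proof -
  have V: "vector [x, y] = x *\<^sub>R axis 1 1 + y *\<^sub>R (axis 2 1 :: real^2)" for x y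
    by (simp add: vec_eq_iff forall_2 axis_def)
  have "continuous_on UNIV (\<lambda>z::real \<times> real. vector [fst z, snd z] :: real^2)"
    unfolding V by (intro continuous_intros)
  then have "(\<lambda>z::real \<times> real. vector [fst z, snd z] :: real^2) \<in> borel_measurable borel"
    by (rule borel_measurable_continuous_onI)
  then have [measurable]: "(\<lambda>z::real \<times> real. vector [fst z, snd z] :: real^2) \<in> borel_measurable (borel \<Otimes>\<^sub>M borel)"
    by (simp add: borel_prod)
  have g[measurable]: "(\<lambda>z. f (vector [fst z, snd z])) \<in> borel_measurable (borel \<Otimes>\<^sub>M borel)"
    by measurable
  have gx[measurable]: "(\<lambda>y. f (vector [x, y])) \<in> borel_measurable borel" for x
    using measurable_compose[OF measurable_Pair1'[of x borel borel] g] by simp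
  have gi[measurable]: "(\<lambda>x. \<integral>\<^sup>+y. f (vector [x, y]) \<partial>unit_lborel) \<in> borel_measurable borel"
    using unit_lborel.borel_measurable_nn_integral[of "\<lambda>x y. f (vector [x, y])" borel] g
    by (simp add: case_prod_beta cong: measurable_cong_sets)
  have "(\<integral>\<^sup>+\<xi>\<in>cbox 0 1. f \<xi> \<partial>lborel) = (\<integral>\<^sup>+x. \<integral>\<^sup>+y. f (vector [x, y]) * indicator (cbox 0 1) (vector [x, y] :: real^2) \<partial>lborel \<partial>lborel)"
    by (subst nn_integral_lborel_vec2) auto
  also have "\<dots> = (\<integral>\<^sup>+x. (\<integral>\<^sup>+y. f (vector [x, y]) * indicator {0..1} y \<partial>lborel) * indicator {0..1} x \<partial>lborel)"
    by (subst nn_integral_multc[symmetric], simp)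
       (intro nn_integral_cong, auto simp: indicator_def mem_box_cart forall_2)
  also have "\<dots> = (\<integral>\<^sup>+x. (\<integral>\<^sup>+y. f (vector [x, y]) \<partial>unit_lborel) * indicator {0..1} x \<partial>lborel)"
    by (simp add: nn_integral_unit_lborel)
  also have "\<dots> = (\<integral>\<^sup>+x. \<integral>\<^sup>+y. f (vector [x, y]) \<partial>unit_lborel \<partial>unit_lborel)"
    by (rule nn_integral_unit_lborel[symmetric, OF gi])
  finally show ?thesis .
qed

subsection \<open>The integrand in a rotated frame\<close>

text \<open>No orientation is imposed, since \<open>n\<close> may be either unit normal of the
  segment.\<close>

definition orthonormal_pair :: "real^2 \<Rightarrow> real^2 \<Rightarrow> bool" where
  "orthonormal_pair \<tau> \<nu> \<longleftrightarrow> norm \<tau> = 1 \<and> norm \<nu> = 1 \<and> \<nu> \<bullet> \<tau> = 0"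

lemma orthonormal_pair_coords:
  assumes "orthonormal_pair \<tau> \<nu>"
  shows "(\<tau>$1)\<^sup>2 + (\<nu>$1)\<^sup>2 = 1" "(\<tau>$2)\<^sup>2 + (\<nu>$2)\<^sup>2 = 1" "\<tau>$1 * \<tau>$2 + \<nu>$1 * \<nu>$2 = 0"
    "\<bar>\<tau>$1 * \<nu>$2 - \<tau>$2 * \<nu>$1\<bar> = 1"
proof -
  define a b c d where "a = \<tau>$1" and "b = \<tau>$2" and "c = \<nu>$1" and "d = \<nu>$2"
  have n: "a * a + b * b = 1" "c * c + d * d = 1" "c * a + d * b = 0"
    using assms by (auto simp: orthonormal_pair_def norm_eq_1 inner_vec_def sum_2 a_def b_def c_def d_def)
  \<comment> \<open>The determinant: Lagrange's identity gives D^2 = 1, and then (c, d) = D (-b, a)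
    expresses the second vector through the first.\<close>
  define D where "D = a * d - b * c"
  have "D * D = (a * a + b * b) * (c * c + d * d) - (c * a + d * b) * (c * a + d * b)"
    by (simp add: D_def algebra_simps)
  then have D: "D * D = 1" using n by simp
  have "c = c * (a * a + b * b)" using n by simp
  also have "\<dots> = a * (c * a + d * b) - b * D" by (simp add: D_def algebra_simps)
  finally have c: "c = - b * D" using n by simp
  have "d = d * (a * a + b * b)" using n by simp
  also have "\<dots> = b * (c * a + d * b) + a * D" by (simp add: D_def algebra_simps)
  finally have d: "d = a * D" using n by simp
  have "c * c = b * b * (D * D)" "d * d = a * a * (D * D)" "c * d = - (a * b * (D * D))"
    by (simp_all add: c d)
  then show "(\<tau>$1)\<^sup>2 + (\<nu>$1)\<^sup>2 = 1" "(\<tau>$2)\<^sup>2 + (\<nu>$2)\<^sup>2 = 1" "\<tau>$1 * \<tau>$2 + \<nu>$1 * \<nu>$2 = 0"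
    using D n by (simp_all add: power2_eq_square flip: a_def b_def c_def d_def)
  have "\<bar>D\<bar> = 1" using D abs_square_eq_1[of D] by (simp add: power2_eq_square)
  then show "\<bar>\<tau>$1 * \<nu>$2 - \<tau>$2 * \<nu>$1\<bar> = 1"
    by (simp add: D_def a_def b_def c_def d_def)
qed

lemma orthonormal_pair_inner:
  assumes "orthonormal_pair \<tau> \<nu>"
  shows "x \<bullet> y = (x \<bullet> \<tau>) * (y \<bullet> \<tau>) + (x \<bullet> \<nu>) * (y \<bullet> \<nu>)"
proof -
  have "(x \<bullet> \<tau>) * (y \<bullet> \<tau>) + (x \<bullet> \<nu>) * (y \<bullet> \<nu>) =
    x$1 * y$1 * ((\<tau>$1)\<^sup>2 + (\<nu>$1)\<^sup>2) + x$2 * y$2 * ((\<tau>$2)\<^sup>2 + (\<nu>$2)\<^sup>2)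
     + (x$1 * y$2 + x$2 * y$1) * (\<tau>$1 * \<tau>$2 + \<nu>$1 * \<nu>$2)"
    by (simp add: inner_vec_def sum_2 power2_eq_square algebra_simps)
  then show ?thesis
    using orthonormal_pair_coords[OF assms] by (simp add: inner_vec_def sum_2)
qed

lemma orthonormal_pair_expand:
  assumes "orthonormal_pair \<tau> \<nu>"
  shows "x = (x \<bullet> \<tau>) *\<^sub>R \<tau> + (x \<bullet> \<nu>) *\<^sub>R \<nu>"
proof (rule vector_eq_rdot[THEN iffD1], rule allI)
  fix z
  show "x \<bullet> z = ((x \<bullet> \<tau>) *\<^sub>R \<tau> + (x \<bullet> \<nu>) *\<^sub>R \<nu>) \<bullet> z"
    using orthonormal_pair_inner[OF assms, of x z] by (simp add: inner_add_left inner_commute[of \<tau> z] inner_commute[of \<nu> z])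
qed

lemma SO2_orthogonal: "\<eta> \<in> SO2 \<Longrightarrow> orthogonal_matrix \<eta>"
  by (simp add: SO2_def rotation_matrix_def)

lemma SO2_inner: "\<eta> \<in> SO2 \<Longrightarrow> (\<eta> *v x) \<bullet> (\<eta> *v y) = x \<bullet> y"
proof -
  assume "\<eta> \<in> SO2"
  then have "transpose \<eta> ** \<eta> = mat 1"
    using SO2_orthogonal by (simp add: orthogonal_matrix_def)
  moreover have "(\<eta> *v x) \<bullet> (\<eta> *v y) = (transpose \<eta> *v (\<eta> *v x)) \<bullet> y"
    by (simp add: dot_lmul_matrix transpose_matrix_vector)
  ultimately show ?thesis by (simp add: matrix_vector_mul_assoc)
qed

lemma orthonormal_pair_rotate:
  "\<eta> \<in> SO2 \<Longrightarrow> orthonormal_pair \<tau> \<nu> \<Longrightarrow> orthonormal_pair (\<eta> *v \<tau>) (\<eta> *v \<nu>)"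
  by (simp add: orthonormal_pair_def norm_eq_1 SO2_inner)

text \<open>Moves the rotation from the lattice point to the frame: the rotated tangent and normal
  vary, the lattice stays fixed.\<close>

lemma SO2_matrix_inv_inner:
  assumes "\<eta> \<in> SO2"
  shows "(matrix_inv \<eta> *v x) \<bullet> y = x \<bullet> (\<eta> *v y)"
proof -
  have "transpose \<eta> ** \<eta> = mat 1" "\<eta> ** transpose \<eta> = mat 1"
    using SO2_orthogonal[OF assms] by (simp_all add: orthogonal_matrix_def)
  then have "\<exists>B. \<eta> ** B = mat 1 \<and> B ** \<eta> = mat 1" by blast
  \<comment> \<open>\<open>matrix_inv\<close> is defined by choice, so its properties follow only
    after an inverse has been exhibited.\<close>
  then have inv: "\<eta> ** matrix_inv \<eta> = mat 1 \<and> matrix_inv \<eta> ** \<eta> = mat 1"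
    unfolding matrix_inv_def by (rule someI_ex)
  have "matrix_inv \<eta> = matrix_inv \<eta> ** (\<eta> ** transpose \<eta>)"
    using \<open>\<eta> ** transpose \<eta> = mat 1\<close> by simp
  also have "\<dots> = (matrix_inv \<eta> ** \<eta>) ** transpose \<eta>"
    by (rule matrix_mul_assoc)
  also have "\<dots> = transpose \<eta>"
    using inv by simp
  finally have "matrix_inv \<eta> = transpose \<eta>" .
  then show ?thesis
    by (simp add: dot_lmul_matrix transpose_matrix_vector)
qed

lemma SO2_rot_mult: "\<eta> \<in> SO2 \<Longrightarrow> rot \<phi> ** \<eta> \<in> SO2"
  using SO2_imp_rot rot_add rot_in_SO2 by metis

lemma integrable_bounded_support:
  fixes u :: "'a::euclidean_space \<Rightarrow> 'b::{banach, second_countable_topology}"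
  assumes "u \<in> borel_measurable borel" "\<And>z. norm (u z) \<le> B" "bounded S" "\<And>z. z \<notin> S \<Longrightarrow> u z = 0"
  shows "integrable lborel u"
proof -
  obtain a where a: "S \<subseteq> cbox (- a) a"
    using bounded_subset_cbox_symmetric[OF assms(3)] by blast
  have B0: "0 \<le> B" using assms(2) norm_ge_zero order_trans by blast
  show ?thesis
  proof (rule Bochner_Integration.integrable_bound)
    show "integrable lborel (\<lambda>z. B * indicator (cbox (- a) a) z)"
      using emeasure_lborel_cbox_finite[of "- a" a]
      by (intro integrable_mult_right integrable_real_indicator) simp_all
    show "AE z in lborel. norm (u z) \<le> norm (B * indicator (cbox (- a) a) z)"
    proof (rule AE_I2)
      fix z
      show "norm (u z) \<le> norm (B * indicator (cbox (- a) a) z)"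
        using assms(2)[of z] assms(4)[of z] a B0 by (cases "z \<in> cbox (- a) a") auto
    qed
  qed (use assms(1) in simp)
qed

text \<open>One summand of the lattice sum as a function of \<open>z = \<xi> - w\<close>; \<open>\<tau>\<close> and \<open>\<nu>\<close> are the rotated
  tangent and normal, \<open>\<alpha>\<close> and \<open>\<beta>\<close> the coordinates of the origin relative to the segment's first endpoint.\<close>

definition tile ::
  "(real \<Rightarrow> real) \<Rightarrow> (real \<Rightarrow> real) \<Rightarrow> real \<Rightarrow> real \<Rightarrow> real \<Rightarrow> real^2 \<Rightarrow> real^2 \<Rightarrow> real \<times> real \<Rightarrow> real" where
  "tile F \<Theta> h \<alpha> \<beta> \<tau> \<nu> z =
     h\<^sup>2 * (F (\<alpha> - h * (\<tau>$1 * fst z + \<tau>$2 * snd z)) * \<Theta> (\<beta> - h * (\<nu>$1 * fst z + \<nu>$2 * snd z)))"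

text \<open>In the frame coordinates both the tile and the character are products. The Jacobian
  cancels the prefactor \<open>h\<^sup>2\<close>, the frequency splits into its tangential and
  normal components over \<open>h\<close>, and the position of the segment enters only through a
  phase of modulus one.\<close>

lemma tile_fourier:
  fixes F \<Theta> :: "real \<Rightarrow> real" and j k h \<alpha> \<beta> :: real
  assumes [measurable]: "F \<in> borel_measurable borel" "\<Theta> \<in> borel_measurable borel"
    and B: "\<And>s. \<bar>F s\<bar> \<le> B" "\<And>s. \<bar>\<Theta> s\<bar> \<le> C" and supp: "\<And>s. \<bar>s\<bar> > r \<Longrightarrow> F s = 0" "\<And>s. \<bar>s\<bar> > r \<Longrightarrow> \<Theta> s = 0"
    and on: "orthonormal_pair \<tau> \<nu>" and h: "h > 0"
  defines "k1 \<equiv> (j * \<tau>$1 + k * \<tau>$2) / h" and "k2 \<equiv> (j * \<nu>$1 + k * \<nu>$2) / h"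
  shows "(\<integral>z. tile F \<Theta> h \<alpha> \<beta> \<tau> \<nu> z * expi (- (j * fst z + k * snd z)) \<partial>lborel) =
    expi (- (k1 * \<alpha> + k2 * \<beta>)) * (\<integral>s. F s * expi (k1 * s) \<partial>lborel) * (\<integral>t. \<Theta> t * expi (k2 * t) \<partial>lborel)"
proof -
  let ?a = "- (h * \<tau>$1)" and ?b = "- (h * \<tau>$2)" and ?c = "- (h * \<nu>$1)" and ?d = "- (h * \<nu>$2)"
  let ?e = "expi (- (k1 * \<alpha> + k2 * \<beta>))"
  define f where "f z = ?e * ((F (fst z) * expi (k1 * fst z)) * (\<Theta> (snd z) * expi (k2 * snd z)))" for z :: "real \<times> real"
  have [measurable]: "f \<in> borel_measurable borel"
    unfolding f_def borel_prod[symmetric] by measurable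
  have "?a * ?d - ?b * ?c = h\<^sup>2 * (\<tau>$1 * \<nu>$2 - \<tau>$2 * \<nu>$1)"
    by (simp add: power2_eq_square algebra_simps)
  \<comment> \<open>The frame may reverse orientation, so the determinant is known up to
    sign.\<close>
  then have D: "\<bar>?a * ?d - ?b * ?c\<bar> = h\<^sup>2"
    using orthonormal_pair_coords(4)[OF on] by (simp only: abs_mult) simp
  have "0 < h\<^sup>2" using h by simp
  with D have D0: "?a * ?d - ?b * ?c \<noteq> 0" by linarith
  have "(\<integral>z. tile F \<Theta> h \<alpha> \<beta> \<tau> \<nu> z * expi (- (j * fst z + k * snd z)) \<partial>lborel) =
      (\<integral>z. h\<^sup>2 *\<^sub>R f (\<alpha> + (?a * fst z + ?b * snd z), \<beta> + (?c * fst z + ?d * snd z)) \<partial>lborel)"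
  proof (rule Bochner_Integration.integral_cong[OF refl])
    fix z :: "real \<times> real"
    let ?s = "\<alpha> + (?a * fst z + ?b * snd z)" and ?t = "\<beta> + (?c * fst z + ?d * snd z)"
    define \<sigma> where "\<sigma> = \<tau>$1 * fst z + \<tau>$2 * snd z"
    define \<sigma>' where "\<sigma>' = \<nu>$1 * fst z + \<nu>$2 * snd z"
    have s: "?s = \<alpha> - h * \<sigma>" "?t = \<beta> - h * \<sigma>'" by (simp_all add: \<sigma>_def \<sigma>'_def algebra_simps)
    \<comment> \<open>The inner product of frequency and position, expanded in the orthonormal
      frame.\<close>
    have "j * fst z + k * snd z = (j * \<tau>$1 + k * \<tau>$2) * \<sigma> + (j * \<nu>$1 + k * \<nu>$2) * \<sigma>'"
      using orthonormal_pair_inner[OF on, of "vector [j, k]" "vector [fst z, snd z]"]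
      by (simp add: inner_vec_def sum_2 \<sigma>_def \<sigma>'_def algebra_simps)
    then have "- (j * fst z + k * snd z) = - (k1 * \<alpha> + k2 * \<beta>) + k1 * ?s + k2 * ?t"
      unfolding s using h by (simp add: k1_def k2_def field_simps)
    then have e: "expi (- (j * fst z + k * snd z)) = ?e * expi (k1 * ?s) * expi (k2 * ?t)"
      by (simp only: expi_add)
    show "tile F \<Theta> h \<alpha> \<beta> \<tau> \<nu> z * expi (- (j * fst z + k * snd z)) = h\<^sup>2 *\<^sub>R f (?s, ?t)"
      unfolding e f_def tile_def fst_conv snd_conv s \<sigma>_def[symmetric] \<sigma>'_def[symmetric]
      by (simp add: scaleR_conv_of_real)
  qed
  also have "\<dots> = h\<^sup>2 *\<^sub>R (\<integral>z. f (\<alpha> + (?a * fst z + ?b * snd z), \<beta> + (?c * fst z + ?d * snd z)) \<partial>lborel)"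
    by simp
  also have "\<dots> = (\<integral>z. f z \<partial>lborel)"
    by (subst integral_lborel_affine2[of f, OF _ D0, of \<alpha> \<beta>]) (simp_all only: D, measurable)
  also have "\<dots> = (\<integral>s. \<integral>t. f (s, t) \<partial>lborel \<partial>lborel)"
  proof -
    have B0: "0 \<le> B" using B(1)[of 0] by linarith
    have "integrable lborel f"
    proof (rule integrable_bounded_support)
      show "norm (f z) \<le> B * C" for z
        using B(1)[of "fst z"] B(2)[of "snd z"] B0 by (simp add: f_def norm_mult mult_mono)
      show "bounded ({- r..r} \<times> {- r..r})" by (intro bounded_Times bounded_closed_interval)
      fix z :: "real \<times> real" assume "z \<notin> {- r..r} \<times> {- r..r}"
      then have "\<bar>fst z\<bar> > r \<or> \<bar>snd z\<bar> > r" by (cases z) auto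
      then show "f z = 0" using supp by (auto simp: f_def)
    qed simp
    then show ?thesis
      using lborel_pair.integral_fst'[of f] by (simp add: lborel_prod)
  qed
  also have "\<dots> = ?e * (\<integral>s. F s * expi (k1 * s) \<partial>lborel) * (\<integral>t. \<Theta> t * expi (k2 * t) \<partial>lborel)"
    unfolding f_def fst_conv snd_conv
    by (simp only: integral_mult_right_zero integral_mult_left_zero) (simp only: mult.assoc)
  finally show ?thesis .
qed

text \<open>A nonzero value bounds both frame coordinates of the point and hence its norm. The
  radius does not depend on the frame, so one window serves all rotations.\<close>

lemma tile_support:
  assumes on: "orthonormal_pair \<tau> \<nu>" and h: "h > 0"
    and supp: "\<And>s. \<bar>s\<bar> > r \<Longrightarrow> F s = 0" "\<And>s. \<bar>s\<bar> > r \<Longrightarrow> \<Theta> s = 0"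
    and N: "(\<bar>\<alpha>\<bar> + \<bar>\<beta>\<bar> + 2 * r) / h \<le> real N" and xy: "\<bar>x\<bar> > real N \<or> \<bar>y\<bar> > real N"
  shows "tile F \<Theta> h \<alpha> \<beta> \<tau> \<nu> (x, y) = 0"
proof (rule ccontr)
  assume "tile F \<Theta> h \<alpha> \<beta> \<tau> \<nu> (x, y) \<noteq> 0"
  define z where "z = (vector [x, y] :: real^2)"
  have z: "\<tau>$1 * x + \<tau>$2 * y = z \<bullet> \<tau>" "\<nu>$1 * x + \<nu>$2 * y = z \<bullet> \<nu>"
    by (simp_all add: z_def inner_vec_def sum_2)
  have "F (\<alpha> - h * (z \<bullet> \<tau>)) \<noteq> 0" "\<Theta> (\<beta> - h * (z \<bullet> \<nu>)) \<noteq> 0"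
    using \<open>tile F \<Theta> h \<alpha> \<beta> \<tau> \<nu> (x, y) \<noteq> 0\<close> by (auto simp: tile_def z)
  then have "\<bar>\<alpha> - h * (z \<bullet> \<tau>)\<bar> \<le> r" "\<bar>\<beta> - h * (z \<bullet> \<nu>)\<bar> \<le> r"
    using supp by (meson not_le)+
  then have "\<bar>h * (z \<bullet> \<tau>)\<bar> + \<bar>h * (z \<bullet> \<nu>)\<bar> \<le> \<bar>\<alpha>\<bar> + \<bar>\<beta>\<bar> + 2 * r" by linarith
  then have "h * (\<bar>z \<bullet> \<tau>\<bar> + \<bar>z \<bullet> \<nu>\<bar>) \<le> \<bar>\<alpha>\<bar> + \<bar>\<beta>\<bar> + 2 * r"
    using h by (simp add: abs_mult distrib_left)
  then have "\<bar>z \<bullet> \<tau>\<bar> + \<bar>z \<bullet> \<nu>\<bar> \<le> (\<bar>\<alpha>\<bar> + \<bar>\<beta>\<bar> + 2 * r) / h"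
    using h by (simp add: pos_le_divide_eq mult.commute)
  then have "\<bar>z \<bullet> \<tau>\<bar> + \<bar>z \<bullet> \<nu>\<bar> \<le> real N" using N by linarith
  moreover have "norm z \<le> \<bar>z \<bullet> \<tau>\<bar> + \<bar>z \<bullet> \<nu>\<bar>"
  proof -
    have "norm z = norm ((z \<bullet> \<tau>) *\<^sub>R \<tau> + (z \<bullet> \<nu>) *\<^sub>R \<nu>)"
      by (rule arg_cong[OF orthonormal_pair_expand[OF on]])
    also have "\<dots> \<le> norm ((z \<bullet> \<tau>) *\<^sub>R \<tau>) + norm ((z \<bullet> \<nu>) *\<^sub>R \<nu>)" by (rule norm_triangle_ineq)
    finally show ?thesis using on by (simp add: orthonormal_pair_def)
  qed
  moreover have "\<bar>x\<bar> \<le> norm z" "\<bar>y\<bar> \<le> norm z"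
    using component_le_norm_cart[of z 1] component_le_norm_cart[of z 2] by (simp_all add: z_def)
  ultimately show False using xy by linarith
qed

text \<open>Replaces the definite description by orthonormal coordinates. The condition |t| \<le>
  \<epsilon> of the tube is absorbed by the weight, which vanishes beyond it.\<close>

lemma tube_integrand_eq:
  assumes ab: "dist a b = 1" and n: "norm n = 1" "n \<bullet> (b - a) = 0" and \<theta>: "weight_profile q \<theta>" and e: "\<epsilon> > 0"
  shows "tube_integrand (closed_segment a b) n f \<theta> \<epsilon> z =
    (if (z - a) \<bullet> (b - a) \<in> {0..1} then f (linepath a b ((z - a) \<bullet> (b - a))) else 0) *
      scaled_weight \<theta> \<epsilon> ((z - a) \<bullet> n)"
proof -
  let ?T = "b - a"
  have T: "norm ?T = 1" using ab by (simp add: dist_norm norm_minus_commute)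
  have on: "orthonormal_pair ?T n" using T n by (simp add: orthonormal_pair_def)
  define s t where "s = (z - a) \<bullet> ?T" and "t = (z - a) \<bullet> n"
  have "z - a = s *\<^sub>R ?T + t *\<^sub>R n"
    unfolding s_def t_def by (rule orthonormal_pair_expand[OF on])
  then have z: "z = linepath a b s + t *\<^sub>R n"
    by (simp add: linepath_def algebra_simps)
  have w0: "scaled_weight \<theta> \<epsilon> t = 0" if "\<not> \<bar>t\<bar> \<le> \<epsilon>"
  proof -
    have "t / \<epsilon> \<notin> {-1..1}" using that e by (auto simp: field_simps abs_le_iff)
    then show ?thesis using weight_profile_eq_0[OF \<theta>] by (simp add: scaled_weight_def)
  qed
  have tube: "s \<in> {0..1} \<and> \<bar>t\<bar> \<le> \<epsilon>" if zt: "z \<in> tube (closed_segment a b) n \<epsilon>"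
  proof -
    obtain x t' where x: "x \<in> closed_segment a b" "t' \<in> {- \<epsilon>..\<epsilon>}" "z = x + t' *\<^sub>R n"
      using zt by (auto simp: tube_def)
    obtain s' where s': "s' \<in> {0..1}" "x = linepath a b s'"
      using x(1) linepath_image_01 by (metis imageE)
    have za: "z - a = s' *\<^sub>R ?T + t' *\<^sub>R n"
      by (simp add: x(3) s'(2) linepath_def algebra_simps)
    have "s = s'" "t = t'"
      using T n unfolding s_def t_def za
      by (simp_all add: inner_add_left norm_eq_1 inner_commute[of ?T n])
    then show ?thesis using s'(1) x(2) by auto
  qed
  show ?thesis
  proof (cases "s \<in> {0..1} \<and> \<bar>t\<bar> \<le> \<epsilon>")
    case True
    have "linepath a b s \<in> closed_segment a b"
      using True by (metis linepath_image_01 imageI)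
    then have "tube_integrand (closed_segment a b) n f \<theta> \<epsilon> z = f (linepath a b s) * scaled_weight \<theta> \<epsilon> t"
      using True n unfolding z by (intro tube_integrand_tube) auto
    then show ?thesis using True by (simp add: s_def t_def)
  next
    case False
    then have "z \<notin> tube (closed_segment a b) n \<epsilon>" using tube by blast
    then have "tube_integrand (closed_segment a b) n f \<theta> \<epsilon> z = 0"
      by (simp add: tube_integrand_def)
    then show ?thesis using False w0 by (auto simp: s_def t_def)
  qed
qed

text \<open>Cuts the lattice sum down to a window independent of \<open>\<eta>\<close> and
  \<open>\<xi>\<close>, in the shape of a periodisation.\<close>

lemma implicit_boundary_integral_eq_sum:
  fixes F :: "real \<Rightarrow> real"
  assumes ab: "dist a b = 1" and n: "norm n = 1" "n \<bullet> (b - a) = 0" and \<theta>: "weight_profile q \<theta>"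
    and e: "\<epsilon> > 0" and h: "h > 0" and \<eta>: "\<eta> \<in> SO2" and \<xi>: "\<xi> \<in> cbox 0 1"
    and F: "\<And>s. F s = (if s \<in> {0..1} then f (linepath a b s) else 0)"
  defines "\<alpha> \<equiv> - (a \<bullet> (b - a))" and "\<beta> \<equiv> - (a \<bullet> n)"
  assumes N: "(\<bar>\<alpha>\<bar> + \<bar>\<beta>\<bar> + 2 * (1 + \<epsilon>)) / h + 1 \<le> real N"
  shows "implicit_boundary_integral (closed_segment a b) n \<theta> \<epsilon> h f \<eta> \<xi> =
    (\<Sum>i\<in>{- int N..int N}. \<Sum>j\<in>{- int N..int N}.
      tile F (scaled_weight \<theta> \<epsilon>) h \<alpha> \<beta> (\<eta> *v (b - a)) (\<eta> *v n) (\<xi>$1 - of_int i, \<xi>$2 - of_int j))"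
proof -
  let ?T = "b - a" and ?J = "{- int N..int N}"
  let ?tile = "tile F (scaled_weight \<theta> \<epsilon>) h \<alpha> \<beta> (\<eta> *v ?T) (\<eta> *v n)"
  let ?V = "\<lambda>(i, j). vector [real_of_int i, real_of_int j] :: real^2"
  define g where "g w = tube_integrand (closed_segment a b) n f \<theta> \<epsilon> (h *\<^sub>R (matrix_inv \<eta> *v (w - \<xi>)))" for w
  have g: "h\<^sup>2 * g w = ?tile (\<xi>$1 - w$1, \<xi>$2 - w$2)" for w
  proof -
    let ?z = "h *\<^sub>R (matrix_inv \<eta> *v (w - \<xi>))"
    have *: "(?z - a) \<bullet> x = - (a \<bullet> x) - h * ((\<eta> *v x)$1 * (\<xi>$1 - w$1) + (\<eta> *v x)$2 * (\<xi>$2 - w$2))" for x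
      by (simp add: inner_diff_left SO2_matrix_inv_inner[OF \<eta>] inner_vec_def[of w] inner_vec_def[of \<xi>] sum_2 algebra_simps)
    show ?thesis
      unfolding g_def tube_integrand_eq[OF ab n \<theta> e] F[symmetric] tile_def fst_conv snd_conv *
      by (simp add: \<alpha>_def \<beta>_def)
  qed
  have T: "norm ?T = 1" using ab by (simp add: dist_norm norm_minus_commute)
  have on: "orthonormal_pair (\<eta> *v ?T) (\<eta> *v n)"
    using T n by (intro orthonormal_pair_rotate[OF \<eta>]) (simp add: orthonormal_pair_def)
  have F0: "F s = 0" if "\<bar>s\<bar> > 1 + \<epsilon>" for s using that e by (auto simp: F)
  have W0: "scaled_weight \<theta> \<epsilon> s = 0" if "\<bar>s\<bar> > 1 + \<epsilon>" for s
  proof -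
    have "s / \<epsilon> \<notin> {-1..1}" using that e by (auto simp: field_simps)
    then show ?thesis using weight_profile_eq_0[OF \<theta>] by (simp add: scaled_weight_def)
  qed
  have "0 \<le> (\<bar>\<alpha>\<bar> + \<bar>\<beta>\<bar> + 2 * (1 + \<epsilon>)) / h" using e h by simp
  with N have N1: "1 \<le> real N" by linarith
  then have N1': "1 \<le> N" by simp
  have zero: "g w = 0" if "w \<in> {w. \<forall>i. w $ i \<in> \<int>} - ?V ` (?J \<times> ?J)" for w
  proof -
    have "w$1 \<in> \<int>" "w$2 \<in> \<int>" using that by blast+
    then obtain i j where ij: "w$1 = of_int i" "w$2 = of_int j"
      by (metis Ints_cases)
    then have "w = ?V (i, j)" by (simp add: vec_eq_iff forall_2)
    then have "(i, j) \<notin> ?J \<times> ?J" using that by blast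
    then have "int N + 1 \<le> \<bar>i\<bar> \<or> int N + 1 \<le> \<bar>j\<bar>" by simp linarith
    then have "real_of_int (int N + 1) \<le> real_of_int \<bar>i\<bar> \<or> real_of_int (int N + 1) \<le> real_of_int \<bar>j\<bar>"
      by (simp only: of_int_le_iff)
    then have "real N + 1 \<le> \<bar>real_of_int i\<bar> \<or> real N + 1 \<le> \<bar>real_of_int j\<bar>" by simp
    moreover have "0 \<le> \<xi>$1" "\<xi>$1 \<le> 1" "0 \<le> \<xi>$2" "\<xi>$2 \<le> 1"
      using \<xi> by (auto simp: mem_box_cart)
    ultimately have "\<bar>\<xi>$1 - w$1\<bar> > real N - 1 \<or> \<bar>\<xi>$2 - w$2\<bar> > real N - 1"
      unfolding ij by linarith
    then have "\<bar>\<xi>$1 - w$1\<bar> > real (N - 1) \<or> \<bar>\<xi>$2 - w$2\<bar> > real (N - 1)"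
      using N1' by (simp add: of_nat_diff)
    \<comment> \<open>A translation in the unit square moves a lattice point by up to one in each
      coordinate; the summand 1 in the bound on \<open>N\<close> pays for this, and the support is
      tested against \<open>N - 1\<close>.\<close>
    then have "?tile (\<xi>$1 - w$1, \<xi>$2 - w$2) = 0"
      using N N1' by (intro tile_support[OF on h F0 W0, where N = "N - 1"]) (auto simp: of_nat_diff)
    then show ?thesis using g[of w] h by simp
  qed
  have "infsum g {w. \<forall>i. w $ i \<in> \<int>} = infsum g (?V ` (?J \<times> ?J))"
  proof (rule infsum_cong_neutral)
    show "g w = 0" if "w \<in> ?V ` (?J \<times> ?J) - {w. \<forall>i. w $ i \<in> \<int>}" for w
      using that by (auto simp: forall_2)
  qed (use zero in blast)+
  then have "h\<^sup>2 * infsum g {w. \<forall>i. w $ i \<in> \<int>} = h\<^sup>2 * infsum g (?V ` (?J \<times> ?J))" by simp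
  also have "\<dots> = (\<Sum>w\<in>?V ` (?J \<times> ?J). h\<^sup>2 * g w)"
    by (simp add: sum_distrib_left)
  also have "\<dots> = (\<Sum>p\<in>?J \<times> ?J. h\<^sup>2 * g (?V p))"
    by (subst sum.reindex) (auto simp: inj_on_def vec_eq_iff forall_2)
  also have "\<dots> = (\<Sum>i\<in>?J. \<Sum>j\<in>?J. ?tile (\<xi>$1 - of_int i, \<xi>$2 - of_int j))"
    by (simp add: sum.cartesian_product g case_prod_beta)
  finally show ?thesis
    unfolding implicit_boundary_integral_def g_def[abs_def] .
qed

lemma lborel_integral_eq_integral:
  fixes g :: "real \<Rightarrow> 'b::euclidean_space"
  assumes g: "g \<in> borel_measurable borel" and B: "\<And>x. norm (g x) \<le> B" and z: "\<And>x. x \<notin> {\<alpha>..\<beta>} \<Longrightarrow> g x = 0"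
  shows "(\<integral>x. g x \<partial>lborel) = integral {\<alpha>..\<beta>} g"
proof -
  have "integrable lborel g"
    by (rule integrable_bounded_support[OF g B, of "{\<alpha>..\<beta>}"]) (use z in auto)
  moreover have ind: "(\<lambda>x. indicator {\<alpha>..\<beta>} x *\<^sub>R g x) = g"
  proof
    fix x show "indicator {\<alpha>..\<beta>} x *\<^sub>R g x = g x"
      using z[of x] by (cases "x \<in> {\<alpha>..\<beta>}") simp_all
  qed
  ultimately have "set_integrable lborel {\<alpha>..\<beta>} g"
    by (simp only: set_integrable_def)
  from set_borel_integral_eq_integral(2)[OF this] show ?thesis
    unfolding set_lebesgue_integral_def ind .
qed

lemma lborel_fourier_eq_integral:
  fixes u :: "real \<Rightarrow> real"
  assumes [measurable]: "u \<in> borel_measurable borel" and B: "\<And>x. \<bar>u x\<bar> \<le> B" and z: "\<And>x. x \<notin> {\<alpha>..\<beta>} \<Longrightarrow> u x = 0"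
  shows "(\<integral>x. u x * expi (\<omega> * x) \<partial>lborel) = integral {\<alpha>..\<beta>} (\<lambda>x. complex_of_real (u x) * expi (\<omega> * x))"
  by (rule lborel_integral_eq_integral[where B = B]) (use B z in \<open>auto simp: norm_mult\<close>)

text \<open>The extension by zero may jump at 0 and 1, so integration by parts is done once, with
  boundary terms; this fixes the power of \<open>1 + \<omega>\<^sup>2\<close>.\<close>

lemma smooth_on_segment_profile:
  fixes F :: "real \<Rightarrow> real"
  assumes f: "smooth_on_segment a b f" and F_def: "\<And>s. F s = (if s \<in> {0..1} then f (linepath a b s) else 0)"
  obtains M where "F \<in> borel_measurable borel" "\<And>s. \<bar>F s\<bar> \<le> M"
    "\<And>\<omega>. (norm (\<integral>s. F s * expi (\<omega> * s) \<partial>lborel))\<^sup>2 \<le> 2 * M\<^sup>2 / (1 + \<omega>\<^sup>2)"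
proof -
  obtain D :: "nat \<Rightarrow> real \<Rightarrow> real" where D0: "\<forall>s \<in> {0..1}. D 0 s = f (linepath a b s)"
    and D: "\<forall>k. \<forall>s \<in> {0..1}. (D k has_real_derivative D (Suc k) s) (at s within {0..1})"
    using f unfolding smooth_on_segment_def by (elim exE conjE)
  have cont: "continuous_on {0..1} (D k)" for k
    using D by (intro DERIV_continuous_on) blast
  have Feq: "F s = D 0 s" if "s \<in> {0..1}" for s
    using that D0 by (simp add: F_def)
  have F0: "F s = 0" if "s \<notin> {0..1}" for s
    using that by (simp only: F_def if_False)
  have "F = (\<lambda>s. indicator {0..1} s *\<^sub>R D 0 s)"
  proof
    fix s show "F s = indicator {0..1} s *\<^sub>R D 0 s"
      using Feq[of s] F0[of s] by (cases "s \<in> {0..1}") simp_all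
  qed
  then have Fm: "F \<in> borel_measurable borel"
    using borel_measurable_continuous_on_indicator[OF _ cont[of 0]] by simp
  obtain M where M: "\<And>x. x \<in> {0..1} \<Longrightarrow> \<bar>F x\<bar> \<le> M"
    "\<And>\<omega>. (\<lambda>x. complex_of_real (F x) * expi (\<omega> * x)) integrable_on {0..1}"
    "\<And>\<omega>. norm (integral {0..1} (\<lambda>x. complex_of_real (F x) * expi (\<omega> * x))) \<le> M"
    "\<And>\<omega>. \<bar>\<omega>\<bar> * norm (integral {0..1} (\<lambda>x. complex_of_real (F x) * expi (\<omega> * x))) \<le> M"
  proof (rule C1_fourier_bound[of 0 1 F "D 0" "D 1"])
    show "(D 0 has_real_derivative D 1 x) (at x within {0..1})" if "x \<in> {0..1}" for x
      using D that by simp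
    show "F x = D 0 x" if "x \<in> {0<..<1}" for x using that by (intro Feq) auto
    show "continuous_on {0..1} (D 1)" by (rule cont)
  qed (simp, blast)
  have FM: "\<bar>F s\<bar> \<le> M" for s
    using M(1)[of s] M(1)[of 0] F0[of s] abs_ge_zero[of "F 0"] by (cases "s \<in> {0..1}") auto
  have "(norm (\<integral>s. F s * expi (\<omega> * s) \<partial>lborel))\<^sup>2 \<le> 2 * M\<^sup>2 / (1 + \<omega>\<^sup>2)" for \<omega>
    using lborel_fourier_eq_integral[OF Fm FM F0, of 0 1 \<omega>]
      fourier_bound_square[of "norm (integral {0..1} (\<lambda>x. complex_of_real (F x) * expi (\<omega> * x)))" M \<omega> 1]
      M(3)[of \<omega>] M(4)[of \<omega>] by simp
  with Fm FM show ?thesis by (rule that)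
qed

lemma weight_profile_fourier_decay:
  assumes \<theta>: "weight_profile q \<theta>"
  obtains M where "0 \<le> M" "\<And>\<omega>. (norm (\<integral>t. \<theta> t * expi (\<omega> * t) \<partial>lborel))\<^sup>2 \<le> M * (1 / (1 + \<omega>\<^sup>2) ^ (q + 1))"
proof -
  obtain B where B: "\<theta> \<in> borel_measurable borel" "\<And>x. \<bar>\<theta> x\<bar> \<le> B"
    using weight_profile_borel_bounded[OF \<theta>] by blast
  obtain M where M: "\<And>\<omega>. norm (integral {-1..1} (\<lambda>x. complex_of_real (\<theta> x) * expi (\<omega> * x))) \<le> M"
    "\<And>\<omega>. \<bar>\<omega>\<bar> ^ (q + 1) * norm (integral {-1..1} (\<lambda>x. complex_of_real (\<theta> x) * expi (\<omega> * x))) \<le> M"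
    using weight_profile_fourier_bound[OF \<theta>] by blast
  show ?thesis
  proof (rule that[of "2 ^ (q + 1) * M\<^sup>2"])
    fix \<omega>
    show "(norm (\<integral>t. \<theta> t * expi (\<omega> * t) \<partial>lborel))\<^sup>2 \<le> 2 ^ (q + 1) * M\<^sup>2 * (1 / (1 + \<omega>\<^sup>2) ^ (q + 1))"
      using lborel_fourier_eq_integral[OF B weight_profile_eq_0[OF \<theta>], of "-1" 1 \<omega>]
        fourier_bound_square[OF norm_ge_zero M(1)[of \<omega>] M(2)[of \<omega>]] by simp
  qed simp
qed

lemma weight_profile_integral:
  assumes \<theta>: "weight_profile q \<theta>"
  shows "(\<integral>t. \<theta> t \<partial>lborel) = 1"
proof -
  obtain B where B: "\<theta> \<in> borel_measurable borel" "\<And>x. \<bar>\<theta> x\<bar> \<le> B"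
    using weight_profile_borel_bounded[OF \<theta>] by blast
  have "(\<theta> has_integral 1) {-1..1}"
    using \<theta> unfolding weight_profile_def by (elim conjE)
  moreover have "(\<integral>t. \<theta> t \<partial>lborel) = integral {-1..1} \<theta>"
    by (rule lborel_integral_eq_integral[OF B(1), of B]) (use B(2) weight_profile_eq_0[OF \<theta>] in simp_all)
  ultimately show ?thesis by (simp add: integral_unique)
qed

text \<open>The dilation preserves mass, so the width acts only by rescaling the frequency.\<close>

lemma scaled_weight_fourier:
  assumes e: "\<epsilon> > 0"
  shows "(\<integral>t. scaled_weight \<theta> \<epsilon> t * expi (\<omega> * t) \<partial>lborel) = (\<integral>t. \<theta> t * expi (\<epsilon> * \<omega> * t) \<partial>lborel)"
proof -
  have "(\<integral>t. scaled_weight \<theta> \<epsilon> t * expi (\<omega> * t) \<partial>lborel) =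
      \<bar>\<epsilon>\<bar> *\<^sub>R (\<integral>t. scaled_weight \<theta> \<epsilon> (0 + \<epsilon> * t) * expi (\<omega> * (0 + \<epsilon> * t)) \<partial>lborel)"
    using e by (intro lborel_integral_real_affine) simp
  also have "\<dots> = (\<integral>t. \<bar>\<epsilon>\<bar> *\<^sub>R (scaled_weight \<theta> \<epsilon> (0 + \<epsilon> * t) * expi (\<omega> * (0 + \<epsilon> * t))) \<partial>lborel)"
    by simp
  also have "\<dots> = (\<integral>t. \<theta> t * expi (\<epsilon> * \<omega> * t) \<partial>lborel)"
    using e by (intro Bochner_Integration.integral_cong) (auto simp: scaled_weight_def scaleR_conv_of_real mult_ac)
  finally show ?thesis .
qed

text \<open>Rotating the frame by \<phi> shifts the angle between frequency and tangent by \<phi>,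
  which reduces the Haar average to \<open>angular_average_le\<close> with a phase \<open>c\<close>
  depending on \<open>\<eta>\<close>; the bound there is uniform in \<open>c\<close>.\<close>

lemma haar_average_le:
  assumes \<mu>: "normalized_haar_SO2 \<mu>" and on: "orthonormal_pair \<tau> \<nu>" and h: "h > 0" and e: "\<epsilon> > 0" and \<kappa>: "\<kappa> \<noteq> 0"
  defines "R \<equiv> norm \<kappa> / h"
  shows "(\<integral>\<^sup>+\<eta>. ennreal (1 / (1 + ((\<kappa> \<bullet> (\<eta> *v \<tau>)) / h)\<^sup>2) * (1 / (1 + (\<epsilon> * ((\<kappa> \<bullet> (\<eta> *v \<nu>)) / h))\<^sup>2) ^ (q + 1))) \<partial>\<mu>)
    \<le> ennreal (16 * pi / (\<epsilon> * R ^ 3) + 2 ^ (q + 4) * pi / (\<epsilon> ^ (2 * q + 2) * R ^ (2 * q + 3)))"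
proof (rule nn_integral_haar_SO2_le[OF \<mu>])
  have c: "continuous_on UNIV (\<lambda>\<eta>. \<kappa> \<bullet> (\<eta> *v v))" for v :: "real^2"
    unfolding matrix_vector_mult_def by (intro continuous_intros continuous_on_vec_lambda)
  have [measurable]: "(\<lambda>\<eta>. \<kappa> \<bullet> (\<eta> *v v)) \<in> borel_measurable borel" for v :: "real^2"
    by (rule borel_measurable_continuous_onI[OF c])
  show "(\<lambda>\<eta>. ennreal (1 / (1 + ((\<kappa> \<bullet> (\<eta> *v \<tau>)) / h)\<^sup>2) * (1 / (1 + (\<epsilon> * ((\<kappa> \<bullet> (\<eta> *v \<nu>)) / h))\<^sup>2) ^ (q + 1)))) \<in> borel_measurable borel"
    by measurable
  fix \<eta> assume \<eta>: "\<eta> \<in> SO2"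
  define v where "v = \<eta> *v \<tau>"
  \<comment> \<open>Inner and cross product of the frequency with the rotated tangent: its polar
    coordinates relative to that tangent are read off from them.\<close>
  define P Q where "P = \<kappa>$1 * v$1 + \<kappa>$2 * v$2" and "Q = \<kappa>$1 * v$2 - \<kappa>$2 * v$1"
  have R: "R > 0" using \<kappa> h by (simp add: R_def)
  have "norm v = 1"
    using orthonormal_pair_rotate[OF \<eta> on] by (simp add: orthonormal_pair_def v_def)
  then have v1: "v$1 * v$1 + v$2 * v$2 = 1" by (simp add: norm_eq_1 inner_vec_def sum_2)
  have "P\<^sup>2 + Q\<^sup>2 = (\<kappa>$1 * \<kappa>$1 + \<kappa>$2 * \<kappa>$2) * (v$1 * v$1 + v$2 * v$2)"
    by (simp add: P_def Q_def power2_eq_square algebra_simps)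
  also have "\<dots> = (norm \<kappa>)\<^sup>2"
    using v1 by (simp add: power2_norm_eq_inner inner_vec_def sum_2)
  finally have "(P / norm \<kappa>)\<^sup>2 + (Q / norm \<kappa>)\<^sup>2 = 1"
    using \<kappa> by (simp add: power_divide flip: add_divide_distrib)
  then obtain c where c: "P / norm \<kappa> = cos c" "Q / norm \<kappa> = sin c"
    using sincos_total_2pi by metis
  then have PQ: "P = norm \<kappa> * cos c" "Q = norm \<kappa> * sin c"
    using \<kappa> by (simp_all add: field_simps)
  have 1: "(\<kappa> \<bullet> ((rot \<phi> ** \<eta>) *v \<tau>)) / h = R * cos (\<phi> + c)" for \<phi>
  proof -
    have eq: "\<kappa> \<bullet> ((rot \<phi> ** \<eta>) *v \<tau>) = P * cos \<phi> - Q * sin \<phi>"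
      unfolding matrix_vector_mul_assoc[symmetric] v_def[symmetric]
      by (simp add: inner_vec_def sum_2 matrix_vector_mult_def rot_def P_def Q_def algebra_simps)
    show ?thesis
      unfolding eq PQ R_def cos_add using h by (simp add: field_simps)
  qed
  \<comment> \<open>With the orientation of the normal left open, its component is determined up to
    sign by Pythagoras; the integrand contains only its square.\<close>
  have 2: "((\<kappa> \<bullet> ((rot \<phi> ** \<eta>) *v \<nu>)) / h)\<^sup>2 = (R * sin (\<phi> + c))\<^sup>2" for \<phi>
  proof -
    have "R\<^sup>2 = (\<kappa> \<bullet> \<kappa>) / h\<^sup>2" by (simp add: R_def power_divide power2_norm_eq_inner)
    also have "\<dots> = ((\<kappa> \<bullet> ((rot \<phi> ** \<eta>) *v \<tau>)) / h)\<^sup>2 + ((\<kappa> \<bullet> ((rot \<phi> ** \<eta>) *v \<nu>)) / h)\<^sup>2"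
      using orthonormal_pair_inner[OF orthonormal_pair_rotate[OF SO2_rot_mult[OF \<eta>] on], of \<kappa> \<kappa> \<phi>]
      by (simp add: power2_eq_square add_divide_distrib)
    finally have "((\<kappa> \<bullet> ((rot \<phi> ** \<eta>) *v \<nu>)) / h)\<^sup>2 = R\<^sup>2 * (1 - (cos (\<phi> + c))\<^sup>2)"
      unfolding 1 by (simp add: power_mult_distrib algebra_simps)
    then show ?thesis by (simp add: sin_squared_eq power_mult_distrib)
  qed
  have "(1 / (1 + ((\<kappa> \<bullet> ((rot \<phi> ** \<eta>) *v \<tau>)) / h)\<^sup>2) * (1 / (1 + (\<epsilon> * ((\<kappa> \<bullet> ((rot \<phi> ** \<eta>) *v \<nu>)) / h))\<^sup>2) ^ (q + 1))) =
      (1 / (1 + (R * cos (\<phi> + c))\<^sup>2) * (1 / (1 + (\<epsilon> * (R * sin (\<phi> + c)))\<^sup>2) ^ (q + 1)))" for \<phi>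
    unfolding power_mult_distrib[of \<epsilon>] 1 2 ..
  then show "(\<integral>\<^sup>+\<phi>\<in>{0..2 * pi}. ennreal (1 / (1 + ((\<kappa> \<bullet> ((rot \<phi> ** \<eta>) *v \<tau>)) / h)\<^sup>2) *
      (1 / (1 + (\<epsilon> * ((\<kappa> \<bullet> ((rot \<phi> ** \<eta>) *v \<nu>)) / h))\<^sup>2) ^ (q + 1))) \<partial>lborel)
    \<le> ennreal (16 * pi / (\<epsilon> * R ^ 3) + 2 ^ (q + 4) * pi / (\<epsilon> ^ (2 * q + 2) * R ^ (2 * q + 3)))"
    using angular_average_le[OF R e, of c q] by simp
qed

text \<open>Nonzero lattice points have norm \<rho> \<ge> 1, so the power 2q+3 may be lowered to 3
  and both contributions share one summable weight. The constant is \<open>2 ^ (q + 4)\<close> times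
  the 8 of \<open>inverse_cube_norm_le\<close>.\<close>

lemma lattice_term_le:
  fixes j k :: int
  assumes h: "h > 0" and e: "\<epsilon> > 0" and jk: "j \<noteq> 0 \<or> k \<noteq> 0"
  defines "R \<equiv> norm (vector [real_of_int j, real_of_int k] :: real^2) / h"
  shows "16 * pi / (\<epsilon> * R ^ 3) + 2 ^ (q + 4) * pi / (\<epsilon> ^ (2 * q + 2) * R ^ (2 * q + 3)) \<le>
    2 ^ (q + 7) * pi * (h ^ 3 / \<epsilon> + h ^ (2 * q + 3) / \<epsilon> ^ (2 * q + 2)) *
      ((1 + \<bar>real_of_int j\<bar>) powr (- 3 / 2) * (1 + \<bar>real_of_int k\<bar>) powr (- 3 / 2))"
proof -
  define \<rho> where "\<rho> = sqrt ((real_of_int j)\<^sup>2 + (real_of_int k)\<^sup>2)"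
  let ?w = "(1 + \<bar>real_of_int j\<bar>) powr (- 3 / 2) * (1 + \<bar>real_of_int k\<bar>) powr (- 3 / 2)"
  have R: "R = \<rho> / h"
    by (simp add: R_def \<rho>_def norm_vec_def L2_set_def sum_2)
  have "0 < j\<^sup>2 + k\<^sup>2" using jk by (auto simp: sum_power2_gt_zero_iff)
  then have "1 \<le> j\<^sup>2 + k\<^sup>2" by simp
  then have "real_of_int 1 \<le> real_of_int (j\<^sup>2 + k\<^sup>2)" by (subst of_int_le_iff)
  then have \<rho>1: "1 \<le> \<rho>" by (simp add: \<rho>_def)
  have w: "1 / \<rho> ^ 3 \<le> 8 * ?w"
    unfolding \<rho>_def by (rule inverse_cube_norm_le[OF jk])
  have "16 * pi / (\<epsilon> * R ^ 3) = 16 * pi * (h ^ 3 / \<epsilon>) * (1 / \<rho> ^ 3)"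
    using h by (simp add: R power_divide)
  also have "\<dots> \<le> 2 ^ (q + 4) * pi * (h ^ 3 / \<epsilon>) * (1 / \<rho> ^ 3)"
  proof -
    have "(16::real) \<le> 2 ^ (q + 4)" using power_increasing[of 4 "q + 4" "2::real"] by simp
    then show ?thesis using h e \<rho>1 by (intro mult_right_mono) auto
  qed
  finally have 1: "16 * pi / (\<epsilon> * R ^ 3) \<le> 2 ^ (q + 4) * pi * (h ^ 3 / \<epsilon>) * (1 / \<rho> ^ 3)" .
  have "2 ^ (q + 4) * pi / (\<epsilon> ^ (2 * q + 2) * R ^ (2 * q + 3)) =
      2 ^ (q + 4) * pi * (h ^ (2 * q + 3) / \<epsilon> ^ (2 * q + 2)) * (1 / \<rho> ^ (2 * q + 3))"
    using h by (simp add: R power_divide)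
  also have "\<dots> \<le> 2 ^ (q + 4) * pi * (h ^ (2 * q + 3) / \<epsilon> ^ (2 * q + 2)) * (1 / \<rho> ^ 3)"
    using h e \<rho>1 by (intro mult_left_mono divide_left_mono power_increasing) auto
  finally have "16 * pi / (\<epsilon> * R ^ 3) + 2 ^ (q + 4) * pi / (\<epsilon> ^ (2 * q + 2) * R ^ (2 * q + 3)) \<le>
      2 ^ (q + 4) * pi * (h ^ 3 / \<epsilon> + h ^ (2 * q + 3) / \<epsilon> ^ (2 * q + 2)) * (1 / \<rho> ^ 3)"
    unfolding distrib_left distrib_right by (rule add_mono[OF 1])
  also have "\<dots> \<le> 2 ^ (q + 4) * pi * (h ^ 3 / \<epsilon> + h ^ (2 * q + 3) / \<epsilon> ^ (2 * q + 2)) * (8 * ?w)"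
    using h e by (intro mult_left_mono w) auto
  also have "\<dots> = 2 ^ (q + 7) * pi * (h ^ 3 / \<epsilon> + h ^ (2 * q + 3) / \<epsilon> ^ (2 * q + 2)) * ?w"
    by (simp add: power_add)
  finally show ?thesis .
qed

text \<open>No integrability is needed: the Bochner integral of a non-integrable function is \<open>0\<close>.\<close>

lemma ennreal_integral_le_nn_integral:
  fixes u :: "'a \<Rightarrow> real"
  assumes "\<And>x. 0 \<le> u x"
  shows "ennreal (\<integral>x. u x \<partial>M) \<le> (\<integral>\<^sup>+x. ennreal (u x) \<partial>M)"
  using assms by (cases "integrable M u") (simp_all add: nn_integral_eq_integral not_integrable_integral_eq)

text \<open>Returns from extended nonnegative integrals to the Bochner integrals of the theorem.
  Nonnegativity is included because a big-O bound concerns the absolute value.\<close>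

lemma iterated_integral_le:
  fixes X :: "'a \<Rightarrow> 'b \<Rightarrow> real"
  assumes X: "\<And>x y. 0 \<le> X x y" and K: "0 \<le> K"
    and le: "(\<integral>\<^sup>+x\<in>A. \<integral>\<^sup>+y. ennreal (X x y) \<partial>\<mu> \<partial>M) \<le> ennreal K"
  shows "0 \<le> (LINT x:A|M. LINT y|\<mu>. X x y)" "(LINT x:A|M. LINT y|\<mu>. X x y) \<le> K"
proof -
  let ?u = "\<lambda>x. indicator A x * (LINT y|\<mu>. X x y)"
  have u: "0 \<le> ?u x" for x
    using X by simp
  show "0 \<le> (LINT x:A|M. LINT y|\<mu>. X x y)"
    unfolding set_lebesgue_integral_def using u by simp
  have "ennreal (\<integral>x. ?u x \<partial>M) \<le> (\<integral>\<^sup>+x. ennreal (?u x) \<partial>M)"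
    by (rule ennreal_integral_le_nn_integral[OF u])
  also have "\<dots> \<le> (\<integral>\<^sup>+x\<in>A. \<integral>\<^sup>+y. ennreal (X x y) \<partial>\<mu> \<partial>M)"
  proof (rule nn_integral_mono)
    fix x
    show "ennreal (?u x) \<le> (\<integral>\<^sup>+y. ennreal (X x y) \<partial>\<mu>) * indicator A x"
      using ennreal_integral_le_nn_integral[of "X x" \<mu>] X by (cases "x \<in> A") auto
  qed
  also note le
  finally show "(LINT x:A|M. LINT y|\<mu>. X x y) \<le> K"
    using K by (simp add: set_lebesgue_integral_def)
qed

subsection \<open>The variance bound\<close>

text \<open>Enumerating the integers turns the sum into a countable series. The outer exchange with
  the Haar integral needs this for the inner sum.\<close>

lemma borel_measurable_nn_integral_count_int:
  fixes u :: "int \<Rightarrow> 'a \<Rightarrow> ennreal"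
  assumes "\<And>j. u j \<in> borel_measurable M"
  shows "(\<lambda>x. \<integral>\<^sup>+j. u j x \<partial>count_space UNIV) \<in> borel_measurable M"
proof -
  have "(\<integral>\<^sup>+j. u j x \<partial>count_space UNIV) = (\<Sum>n. u (int_decode n) x)" for x
    by (subst nn_integral_bij_count_space[OF bij_int_decode, symmetric]) (rule nn_integral_count_space_nat)
  then show ?thesis using assms by simp
qed

text \<open>\<open>K\<close> is chosen before \<open>h\<close> and \<epsilon>, which vary
  independently here; the relation between them enters only through the right-hand side.\<close>

theorem implicit_boundary_variance_le:
  fixes a b n :: "real^2" and f :: "real^2 \<Rightarrow> real"
  assumes ab: "dist a b = 1" and n: "norm n = 1" "n \<bullet> (b - a) = 0" and f: "smooth_on_segment a b f"
    and \<theta>: "weight_profile q \<theta>" and \<mu>: "normalized_haar_SO2 \<mu>"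
  obtains K where "0 \<le> K" "\<And>h \<epsilon>. h > 0 \<Longrightarrow> \<epsilon> > 0 \<Longrightarrow>
    (\<integral>\<^sup>+\<xi>\<in>cbox 0 1. \<integral>\<^sup>+\<eta>. ennreal (\<bar>implicit_boundary_integral (closed_segment a b) n \<theta> \<epsilon> h f \<eta> \<xi>
        - segment_integral a b f\<bar>\<^sup>2) \<partial>\<mu> \<partial>lborel)
      \<le> ennreal (K * (h ^ 3 / \<epsilon> + h ^ (2 * q + 3) / \<epsilon> ^ (2 * q + 2)))"
proof -
  let ?T = "b - a"
  have T: "norm ?T = 1" using ab by (simp add: dist_norm norm_minus_commute)
  have on: "orthonormal_pair ?T n" using T n by (simp add: orthonormal_pair_def)
  define F where "F s = (if s \<in> {0..1} then f (linepath a b s) else 0)" for s :: real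
  obtain M where Fm: "F \<in> borel_measurable borel" and FM: "\<And>s. \<bar>F s\<bar> \<le> M"
    and Fdecay: "\<And>\<omega>. (norm (\<integral>s. F s * expi (\<omega> * s) \<partial>lborel))\<^sup>2 \<le> 2 * M\<^sup>2 / (1 + \<omega>\<^sup>2)"
    using smooth_on_segment_profile[OF f F_def] by blast
  obtain M' where M'0: "0 \<le> M'"
    and \<theta>decay: "\<And>\<omega>. (norm (\<integral>t. \<theta> t * expi (\<omega> * t) \<partial>lborel))\<^sup>2 \<le> M' * (1 / (1 + \<omega>\<^sup>2) ^ (q + 1))"
    using weight_profile_fourier_decay[OF \<theta>] by blast
  obtain B where \<theta>m: "\<theta> \<in> borel_measurable borel" and \<theta>B: "\<And>x. \<bar>\<theta> x\<bar> \<le> B"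
    using weight_profile_borel_bounded[OF \<theta>] by blast
  note [measurable] = Fm \<theta>m
  define \<alpha> where "\<alpha> = - (a \<bullet> ?T)"
  define \<beta> where "\<beta> = - (a \<bullet> n)"
  define m where "m = segment_integral a b f"
  have Fint: "(\<integral>s. F s \<partial>lborel) = m"
  proof -
    have "(\<integral>s. F s \<partial>lborel) = integral {0..1} F"
      by (rule lborel_integral_eq_integral[OF Fm, of M]) (use FM in \<open>auto simp: F_def\<close>)
    also have "\<dots> = m"
      unfolding m_def segment_integral_def using ab by (intro integral_cong) (simp add: F_def)
    finally show ?thesis .
  qed
  define C where "C = 2 * M\<^sup>2 * M'"
  have C0: "0 \<le> C" using M'0 by (simp add: C_def)
  define w where "w k = (1 + \<bar>real_of_int k\<bar>) powr (- 3 / 2)" for k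
  have w0: "0 \<le> w k" for k by (simp add: w_def)
  define W where "W = enn2real (\<integral>\<^sup>+k. ennreal (w k) \<partial>count_space UNIV)"
  have W: "(\<integral>\<^sup>+k. ennreal (w k) \<partial>count_space UNIV) = ennreal W"
    using nn_integral_int_powr_finite unfolding W_def w_def by (intro ennreal_enn2real[symmetric]) simp
  have W0: "0 \<le> W" by (simp add: W_def)
  \<comment> \<open>Decay constants of the two factors, the constant of
    \<open>lattice_term_le\<close>, and one weight sum for each lattice coordinate.\<close>
  define K where "K = C * (2 ^ (q + 7) * pi) * (W * W)"
  show ?thesis
  proof (rule that[of K])
    show "0 \<le> K" using C0 W0 by (simp add: K_def)
  next
    fix h \<epsilon> :: real assume h: "h > 0" and e: "\<epsilon> > 0"
    define \<Theta> where "\<Theta> = scaled_weight \<theta> \<epsilon>"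
    have [measurable]: "\<Theta> \<in> borel_measurable borel"
      unfolding \<Theta>_def scaled_weight_def by measurable
    have \<Theta>B: "\<bar>\<Theta> s\<bar> \<le> B / \<epsilon>" for s
      using \<theta>B[of "s / \<epsilon>"] e by (simp add: \<Theta>_def scaled_weight_def divide_right_mono)
    have F0: "F s = 0" if "\<bar>s\<bar> > 1 + \<epsilon>" for s using that e by (auto simp: F_def)
    have \<Theta>0: "\<Theta> s = 0" if "\<bar>s\<bar> > 1 + \<epsilon>" for s
    proof -
      have "s / \<epsilon> \<notin> {-1..1}" using that e by (auto simp: field_simps)
      then show ?thesis using weight_profile_eq_0[OF \<theta>] by (simp add: \<Theta>_def scaled_weight_def)
    qed
    \<comment> \<open>The window grows as \<open>h\<close> shrinks, but \<open>N\<close> does not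
      occur in the bound.\<close>
    define N where "N = nat \<lceil>(\<bar>\<alpha>\<bar> + \<bar>\<beta>\<bar> + 2 * (1 + \<epsilon>)) / h + 1\<rceil>"
    have N: "(\<bar>\<alpha>\<bar> + \<bar>\<beta>\<bar> + 2 * (1 + \<epsilon>)) / h + 1 \<le> real N"
      unfolding N_def by (rule real_nat_ceiling_ge)
    let ?J = "{- int N..int N}"
    define p where "p \<eta> = tile F \<Theta> h \<alpha> \<beta> (\<eta> *v ?T) (\<eta> *v n)" for \<eta>
    define X where "X \<eta> \<xi> = (\<Sum>i\<in>?J. \<Sum>j\<in>?J. p \<eta> (\<xi>$1 - of_int i, \<xi>$2 - of_int j)) - m" for \<eta> and \<xi> :: "real^2"
    define k1 where "k1 j k \<eta> = (real_of_int j * (\<eta> *v ?T)$1 + real_of_int k * (\<eta> *v ?T)$2) / h" for j k and \<eta> :: "real^2^2"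
    define k2 where "k2 j k \<eta> = (real_of_int j * (\<eta> *v n)$1 + real_of_int k * (\<eta> *v n)$2) / h" for j k and \<eta> :: "real^2^2"
    \<comment> \<open>A majorant of the squared coefficients, explicit in \<open>\<eta>\<close> and
      therefore visibly measurable; it is 0 at the origin, where the mean has been removed.\<close>
    define u where "u j k \<eta> = (if j = 0 \<and> k = 0 then 0 else
      ennreal (C * (1 / (1 + (k1 j k \<eta>)\<^sup>2) * (1 / (1 + (\<epsilon> * k2 j k \<eta>)\<^sup>2) ^ (q + 1)))))" for j k \<eta>
    have coeff: "(\<integral>z. p \<eta> z * expi (- (of_int j * fst z + of_int k * snd z)) \<partial>lborel) =
        expi (- (k1 j k \<eta> * \<alpha> + k2 j k \<eta> * \<beta>)) * (\<integral>s. F s * expi (k1 j k \<eta> * s) \<partial>lborel)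
          * (\<integral>t. \<theta> t * expi (\<epsilon> * k2 j k \<eta> * t) \<partial>lborel)"
      if \<eta>: "\<eta> \<in> SO2" for \<eta> j k
      unfolding p_def k1_def k2_def scaled_weight_fourier[OF e, symmetric] \<Theta>_def[symmetric]
      by (rule tile_fourier[OF _ _ FM \<Theta>B F0 \<Theta>0 orthonormal_pair_rotate[OF \<eta> on] h]) measurable
    have coeff_le: "ennreal ((norm (\<integral>z. p \<eta> z * expi (- (of_int j * fst z + of_int k * snd z)) \<partial>lborel))\<^sup>2)
        \<le> ennreal (C * (1 / (1 + (k1 j k \<eta>)\<^sup>2) * (1 / (1 + (\<epsilon> * k2 j k \<eta>)\<^sup>2) ^ (q + 1))))"
      if \<eta>: "\<eta> \<in> SO2" for \<eta> j k
    proof (rule ennreal_leI)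
      have "(norm (\<integral>z. p \<eta> z * expi (- (of_int j * fst z + of_int k * snd z)) \<partial>lborel))\<^sup>2 =
          (norm (\<integral>s. F s * expi (k1 j k \<eta> * s) \<partial>lborel))\<^sup>2 * (norm (\<integral>t. \<theta> t * expi (\<epsilon> * k2 j k \<eta> * t) \<partial>lborel))\<^sup>2"
        unfolding coeff[OF \<eta>] norm_mult norm_expi by (simp add: power_mult_distrib)
      also have "\<dots> \<le> (2 * M\<^sup>2 / (1 + (k1 j k \<eta>)\<^sup>2)) * (M' * (1 / (1 + (\<epsilon> * k2 j k \<eta>)\<^sup>2) ^ (q + 1)))"
        by (intro mult_mono Fdecay \<theta>decay) auto
      also have "\<dots> = C * (1 / (1 + (k1 j k \<eta>)\<^sup>2) * (1 / (1 + (\<epsilon> * k2 j k \<eta>)\<^sup>2) ^ (q + 1)))"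
        by (simp add: C_def)
      finally show "(norm (\<integral>z. p \<eta> z * expi (- (of_int j * fst z + of_int k * snd z)) \<partial>lborel))\<^sup>2 \<le>
        C * (1 / (1 + (k1 j k \<eta>)\<^sup>2) * (1 / (1 + (\<epsilon> * k2 j k \<eta>)\<^sup>2) ^ (q + 1)))" .
    qed
    have pm: "p \<eta> \<in> borel_measurable borel" for \<eta>
      unfolding p_def tile_def[abs_def] borel_prod[symmetric] by measurable
    \<comment> \<open>Frequency zero: the phase is 1, the weight has mass 1, and \<open>F\<close>
      integrates to the segment integral.\<close>
    have mean: "(\<integral>z. p \<eta> z \<partial>lborel) = m" if \<eta>: "\<eta> \<in> SO2" for \<eta>
    proof -
      have k0: "k1 0 0 \<eta> = 0" "k2 0 0 \<eta> = 0" by (simp_all add: k1_def k2_def)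
      have "complex_of_real (\<integral>z. p \<eta> z \<partial>lborel) = complex_of_real m"
        using coeff[OF \<eta>, of 0 0] by (simp add: k0 Fint weight_profile_integral[OF \<theta>])
      then show ?thesis by (simp only: of_real_eq_iff)
    qed
    have pB: "\<bar>p \<eta> z\<bar> \<le> h\<^sup>2 * (M * (B / \<epsilon>))" for \<eta> z
      unfolding p_def tile_def abs_mult using FM \<Theta>B
      by (intro mult_mono) (auto intro: order_trans[OF abs_ge_zero FM[of 0]])
    have psupp: "p \<eta> (x, y) = 0" if \<eta>: "\<eta> \<in> SO2" and xy: "\<bar>x\<bar> > real N \<or> \<bar>y\<bar> > real N" for \<eta> x y
      unfolding p_def using N
      by (intro tile_support[OF orthonormal_pair_rotate[OF \<eta> on] h F0 \<Theta>0 _ xy]) auto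
    have eq: "implicit_boundary_integral (closed_segment a b) n \<theta> \<epsilon> h f \<eta> \<xi> - segment_integral a b f = X \<eta> \<xi>"
      if "\<eta> \<in> SO2" "\<xi> \<in> cbox 0 1" for \<eta> \<xi>
      using implicit_boundary_integral_eq_sum[OF ab n \<theta> e h that F_def N[unfolded \<alpha>_def \<beta>_def]]
      by (simp add: X_def p_def m_def \<alpha>_def \<beta>_def \<Theta>_def)
    have fixed: "(\<integral>\<^sup>+\<xi>\<in>cbox 0 1. ennreal ((X \<eta> \<xi>)\<^sup>2) \<partial>lborel) \<le>
        (\<integral>\<^sup>+k. \<integral>\<^sup>+j. u j k \<eta> \<partial>count_space UNIV \<partial>count_space UNIV)" if \<eta>: "\<eta> \<in> SO2" for \<eta>
    proof -
      have "(\<lambda>\<xi>. X \<eta> \<xi>) \<in> borel_measurable borel"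
        unfolding X_def p_def tile_def fst_conv snd_conv by measurable
      then have "(\<integral>\<^sup>+\<xi>\<in>cbox 0 1. ennreal ((X \<eta> \<xi>)\<^sup>2) \<partial>lborel) =
          (\<integral>\<^sup>+x. \<integral>\<^sup>+y. ennreal ((X \<eta> (vector [x, y]))\<^sup>2) \<partial>unit_lborel \<partial>unit_lborel)"
        by (intro nn_integral_unit_square) measurable
      also have "\<dots> \<le> (\<integral>\<^sup>+k. \<integral>\<^sup>+j. (if j = 0 \<and> k = 0 then 0 else
         ennreal ((norm (\<integral>z. p \<eta> z * expi (- (of_int j * fst z + of_int k * snd z)) \<partial>lborel))\<^sup>2))
         \<partial>count_space UNIV \<partial>count_space UNIV)"
        unfolding X_def vector_2 by (rule periodization_variance_le[OF pm pB psupp[OF \<eta>] mean[OF \<eta>]])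
      also have "\<dots> \<le> (\<integral>\<^sup>+k. \<integral>\<^sup>+j. u j k \<eta> \<partial>count_space UNIV \<partial>count_space UNIV)"
        unfolding u_def using coeff_le[OF \<eta>] by (intro nn_integral_mono) auto
      finally show ?thesis .
    qed
    have cv: "continuous_on UNIV (\<lambda>\<eta>::real^2^2. (\<eta> *v v)$i)" for v :: "real^2" and i
      unfolding matrix_vector_mult_def by (simp add: continuous_intros)
    then have mb: "(\<lambda>\<eta>::real^2^2. (\<eta> *v v)$i) \<in> borel_measurable borel" for v :: "real^2" and i
      by (rule borel_measurable_continuous_onI)
    have [measurable]: "(\<lambda>\<eta>. (\<eta> *v v)$i) \<in> borel_measurable \<mu>" for v :: "real^2" and i
      by (rule measurable_haar_SO2[OF \<mu> mb])
    have um: "u j k \<in> borel_measurable \<mu>" for j k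
      unfolding u_def[abs_def] k1_def k2_def by measurable
    have average: "(\<integral>\<^sup>+\<eta>. u j k \<eta> \<partial>\<mu>) \<le>
      ennreal (C * (2 ^ (q + 7) * pi * (h ^ 3 / \<epsilon> + h ^ (2 * q + 3) / \<epsilon> ^ (2 * q + 2)))) * (ennreal (w j) * ennreal (w k))" for j k
    proof (cases "j = 0 \<and> k = 0")
      case True
      then show ?thesis by (simp add: u_def)
    next
      case False
      define \<kappa> where "\<kappa> = (vector [real_of_int j, real_of_int k] :: real^2)"
      have \<kappa>: "\<kappa> \<noteq> 0" using False by (auto simp: \<kappa>_def vec_eq_iff forall_2)
      have k12: "k1 j k \<eta> = (\<kappa> \<bullet> (\<eta> *v ?T)) / h" "k2 j k \<eta> = (\<kappa> \<bullet> (\<eta> *v n)) / h" for \<eta>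
        by (simp_all add: k1_def k2_def \<kappa>_def inner_vec_def sum_2)
      let ?R = "norm \<kappa> / h"
      let ?E = "h ^ 3 / \<epsilon> + h ^ (2 * q + 3) / \<epsilon> ^ (2 * q + 2)"
      let ?g = "\<lambda>\<eta>. 1 / (1 + (k1 j k \<eta>)\<^sup>2) * (1 / (1 + (\<epsilon> * k2 j k \<eta>)\<^sup>2) ^ (q + 1))"
      have g0: "0 \<le> ?g \<eta>" for \<eta> by simp
      have [measurable]: "?g \<in> borel_measurable \<mu>"
        unfolding k1_def k2_def by measurable
      have "(\<integral>\<^sup>+\<eta>. u j k \<eta> \<partial>\<mu>) = (\<integral>\<^sup>+\<eta>. ennreal C * ennreal (?g \<eta>) \<partial>\<mu>)"
        unfolding u_def using False C0 g0 by (intro nn_integral_cong) (simp only: if_False ennreal_mult)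
      also have "\<dots> = ennreal C * (\<integral>\<^sup>+\<eta>. ennreal (?g \<eta>) \<partial>\<mu>)"
        by (rule nn_integral_cmult) measurable
      also have "\<dots> \<le> ennreal C * ennreal (16 * pi / (\<epsilon> * ?R ^ 3) + 2 ^ (q + 4) * pi / (\<epsilon> ^ (2 * q + 2) * ?R ^ (2 * q + 3)))"
        unfolding k12 by (intro mult_left_mono haar_average_le[OF \<mu> on h e \<kappa>]) simp
      also have "\<dots> \<le> ennreal C * ennreal (2 ^ (q + 7) * pi * ?E * (w j * w k))"
        unfolding \<kappa>_def w_def using False by (intro mult_left_mono ennreal_leI lattice_term_le[OF h e]) auto
      also have "\<dots> = ennreal (C * (2 ^ (q + 7) * pi * ?E)) * (ennreal (w j) * ennreal (w k))"
        using C0 w0 h e by (simp add: ennreal_mult'[symmetric] ennreal_mult''[symmetric] mult_ac)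
      finally show ?thesis .
    qed
    interpret finite_measure \<mu> using \<mu> by (rule finite_measure_haar_SO2)
    interpret P: pair_sigma_finite lborel \<mu> ..
    let ?E = "h ^ 3 / \<epsilon> + h ^ (2 * q + 3) / \<epsilon> ^ (2 * q + 2)"
    let ?c = "C * (2 ^ (q + 7) * pi * ?E)"
    have c0: "0 \<le> ?c" using C0 h e by simp
    have "(\<integral>\<^sup>+\<xi>\<in>cbox 0 1. \<integral>\<^sup>+\<eta>. ennreal (\<bar>implicit_boundary_integral (closed_segment a b) n \<theta> \<epsilon> h f \<eta> \<xi>
        - segment_integral a b f\<bar>\<^sup>2) \<partial>\<mu> \<partial>lborel) =
      (\<integral>\<^sup>+\<xi>. \<integral>\<^sup>+\<eta>. ennreal ((X \<eta> \<xi>)\<^sup>2) * indicator (cbox 0 1) \<xi> \<partial>\<mu> \<partial>lborel)"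
    \<comment> \<open>The finite sum represents the integral only for rotations and for translations
      in the unit square, so the indicator stays attached.\<close>
    proof (rule nn_integral_cong)
      fix \<xi> :: "real^2"
      show "(\<integral>\<^sup>+\<eta>. ennreal (\<bar>implicit_boundary_integral (closed_segment a b) n \<theta> \<epsilon> h f \<eta> \<xi>
        - segment_integral a b f\<bar>\<^sup>2) \<partial>\<mu>) * indicator (cbox 0 1) \<xi> =
        (\<integral>\<^sup>+\<eta>. ennreal ((X \<eta> \<xi>)\<^sup>2) * indicator (cbox 0 1) \<xi> \<partial>\<mu>)"
      proof (cases "\<xi> \<in> cbox 0 1")
        case True
        then have "(\<integral>\<^sup>+\<eta>. ennreal (\<bar>implicit_boundary_integral (closed_segment a b) n \<theta> \<epsilon> h f \<eta> \<xi>
            - segment_integral a b f\<bar>\<^sup>2) \<partial>\<mu>) = (\<integral>\<^sup>+\<eta>. ennreal ((X \<eta> \<xi>)\<^sup>2) \<partial>\<mu>)"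
          by (intro nn_integral_cong) (simp add: eq space_haar_SO2[OF \<mu>])
        then show ?thesis using True by simp
      qed simp
    qed
    also have "\<dots> = (\<integral>\<^sup>+\<eta>. \<integral>\<^sup>+\<xi>. ennreal ((X \<eta> \<xi>)\<^sup>2) * indicator (cbox 0 1) \<xi> \<partial>lborel \<partial>\<mu>)"
    proof (rule P.Fubini'[symmetric])
      \<comment> \<open>Joint measurability is checked on the finite sum of tiles, a Borel
        expression in the coordinates of \<open>\<xi>\<close> and of the rotated frame.\<close>
      have [measurable]: "(\<lambda>z. (snd z *v v)$i) \<in> borel_measurable (lborel \<Otimes>\<^sub>M \<mu>)" for v :: "real^2" and i
        by (rule measurable_compose[OF measurable_snd]) measurable
      have [measurable]: "(\<lambda>z::(real^2) \<times> (real^2^2). fst z $ i) \<in> borel_measurable (lborel \<Otimes>\<^sub>M \<mu>)" for i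
        by (rule measurable_compose[OF measurable_fst]) measurable
      have "(\<lambda>z. X (snd z) (fst z)) \<in> borel_measurable (lborel \<Otimes>\<^sub>M \<mu>)"
        unfolding X_def p_def tile_def fst_conv snd_conv by measurable
      then show "(\<lambda>(\<xi>, \<eta>). ennreal ((X \<eta> \<xi>)\<^sup>2) * indicator (cbox 0 1) \<xi>) \<in> borel_measurable (lborel \<Otimes>\<^sub>M \<mu>)"
        unfolding case_prod_beta by measurable
    qed
    also have "\<dots> \<le> (\<integral>\<^sup>+\<eta>. \<integral>\<^sup>+k. \<integral>\<^sup>+j. u j k \<eta> \<partial>count_space UNIV \<partial>count_space UNIV \<partial>\<mu>)"
      using fixed by (intro nn_integral_mono) (simp add: space_haar_SO2[OF \<mu>])
    also have "\<dots> = (\<integral>\<^sup>+k. \<integral>\<^sup>+\<eta>. \<integral>\<^sup>+j. u j k \<eta> \<partial>count_space UNIV \<partial>\<mu> \<partial>count_space UNIV)"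
      by (intro nn_integral_count_space_nn_integral borel_measurable_nn_integral_count_int um) simp
    also have "\<dots> = (\<integral>\<^sup>+k. \<integral>\<^sup>+j. \<integral>\<^sup>+\<eta>. u j k \<eta> \<partial>\<mu> \<partial>count_space UNIV \<partial>count_space UNIV)"
      by (intro nn_integral_cong nn_integral_count_space_nn_integral um) simp
    also have "\<dots> \<le> (\<integral>\<^sup>+k. \<integral>\<^sup>+j. ennreal ?c * (ennreal (w j) * ennreal (w k)) \<partial>count_space UNIV \<partial>count_space UNIV)"
      by (intro nn_integral_mono average)
    also have "\<dots> = ennreal ?c * (ennreal W * ennreal W)"
      by (simp add: nn_integral_cmult nn_integral_multc W)
    also have "\<dots> = ennreal (K * ?E)"
      using c0 W0 unfolding K_def by (simp add: ennreal_mult[symmetric] mult_ac)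
    finally show "(\<integral>\<^sup>+\<xi>\<in>cbox 0 1. \<integral>\<^sup>+\<eta>. ennreal (\<bar>implicit_boundary_integral (closed_segment a b) n \<theta> \<epsilon> h f \<eta> \<xi>
        - segment_integral a b f\<bar>\<^sup>2) \<partial>\<mu> \<partial>lborel) \<le> ennreal (K * ?E)" .
  qed
qed

section \<open>Powers of the step size\<close>

text \<open>Both summands decrease in the width, so the lower bound on \<epsilon> turns them into
  powers of \<open>h\<close>. For \<open>h < 1\<close> the smaller exponent dominates, and the two
  exponents coincide at \<alpha> = 2q/(2q+1).\<close>

lemma width_powr_bounds:
  fixes h \<epsilon> c \<alpha> :: real and q :: nat
  assumes h: "0 < h" "h < 1" and c: "0 < c" "c * h powr \<alpha> \<le> \<epsilon>"
  defines "p \<equiv> if \<alpha> < 2 * real q / (2 * real q + 1) then 3 - \<alpha> else 1 + (2 * real q + 2) * (1 - \<alpha>)"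
  shows "h ^ 3 / \<epsilon> + h ^ (2 * q + 3) / \<epsilon> ^ (2 * q + 2) \<le> (1 / c + 1 / c ^ (2 * q + 2)) * h powr p"
proof -
  have pos: "0 < c * h powr \<alpha>" using h c by simp
  then have e: "0 < \<epsilon>" using c by linarith
  have dec: "h powr y \<le> h powr p" if "p \<le> y" for y
    using that h by (intro powr_mono') auto
  have p: "p \<le> 3 - \<alpha>" "p \<le> 1 + (2 * real q + 2) * (1 - \<alpha>)"
  proof -
    \<comment> \<open>After clearing the denominator, the case condition says precisely which of the
      two exponents is smaller.\<close>
    have "\<alpha> < 2 * real q / (2 * real q + 1) \<longleftrightarrow> \<alpha> * (2 * real q + 1) < 2 * real q"
      by (rule pos_less_divide_eq) simp
    then show "p \<le> 3 - \<alpha>" "p \<le> 1 + (2 * real q + 2) * (1 - \<alpha>)"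
      unfolding p_def by (auto simp: algebra_simps)
  qed
  have "h ^ 3 / \<epsilon> \<le> h ^ 3 / (c * h powr \<alpha>)"
    using h pos c e by (intro divide_left_mono) (auto intro!: mult_pos_pos)
  also have "\<dots> = 1 / c * h powr (3 - \<alpha>)"
    using h by (simp add: powr_diff powr_numeral)
  also have "\<dots> \<le> 1 / c * h powr p"
    using c by (intro mult_left_mono dec p) auto
  finally have 1: "h ^ 3 / \<epsilon> \<le> 1 / c * h powr p" .
  have "h ^ (2 * q + 3) / \<epsilon> ^ (2 * q + 2) \<le> h ^ (2 * q + 3) / (c * h powr \<alpha>) ^ (2 * q + 2)"
    using h pos c e by (intro divide_left_mono power_mono) (auto intro!: mult_pos_pos zero_less_power)
  also have "\<dots> = 1 / c ^ (2 * q + 2) * h powr (1 + (2 * real q + 2) * (1 - \<alpha>))"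
  proof -
    have "h ^ (2 * q + 3) = h powr (real (2 * q + 3))"
      using h by (simp only: powr_realpow)
    moreover have "(h powr \<alpha>) ^ (2 * q + 2) = h powr (\<alpha> * real (2 * q + 2))"
      using h by (simp only: powr_powr[symmetric] powr_realpow powr_gt_zero)
    ultimately have "h ^ (2 * q + 3) / (h powr \<alpha>) ^ (2 * q + 2) = h powr (real (2 * q + 3) - \<alpha> * real (2 * q + 2))"
      by (simp only: powr_diff)
    also have "real (2 * q + 3) - \<alpha> * real (2 * q + 2) = 1 + (2 * real q + 2) * (1 - \<alpha>)"
      by (simp add: algebra_simps)
    finally have "h ^ (2 * q + 3) / (h powr \<alpha>) ^ (2 * q + 2) = h powr (1 + (2 * real q + 2) * (1 - \<alpha>))" .
    moreover have "h ^ (2 * q + 3) / (c * h powr \<alpha>) ^ (2 * q + 2) =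
        1 / c ^ (2 * q + 2) * (h ^ (2 * q + 3) / (h powr \<alpha>) ^ (2 * q + 2))"
      by (simp add: power_mult_distrib)
    ultimately show ?thesis by (simp only:)
  qed
  also have "\<dots> \<le> 1 / c ^ (2 * q + 2) * h powr p"
    using c by (intro mult_left_mono dec p) auto
  finally show ?thesis using 1 by (simp only: distrib_right add_mono)
qed

theorem theorem4p8:
  fixes a b n :: "real^2" and f :: "real^2 \<Rightarrow> real" and \<theta> :: "real \<Rightarrow> real" and q :: nat
    and \<epsilon> :: "real \<Rightarrow> real" and \<alpha> :: real and \<mu> :: "(real^2^2) measure" and \<Gamma> :: "(real^2) set"
  assumes "\<Gamma> = closed_segment a b" and "dist a b = 1"
    and "norm n = 1" and "n \<bullet> (b - a) = 0"
    and "smooth_on_segment a b f"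
    and "weight_profile q \<theta>"
    and "\<alpha> \<in> {0..1}"
    and "\<exists>c1>0. \<exists>c2>0. \<forall>\<^sub>F h in at_right 0. c1 * h powr \<alpha> \<le> \<epsilon> h \<and> \<epsilon> h \<le> c2 * h powr \<alpha>"
    and "normalized_haar_SO2 \<mu>"
  shows "(\<lambda>h. LINT \<xi>:cbox 0 1|lborel. LINT \<eta>|\<mu>.
            \<bar>implicit_boundary_integral \<Gamma> n \<theta> (\<epsilon> h) h f \<eta> \<xi> - segment_integral a b f\<bar>\<^sup>2)
         \<in> O[at_right 0](\<lambda>h. h powr
              (if \<alpha> < 2 * real q / (2 * real q + 1) then 3 - \<alpha>
               else 1 + (2 * real q + 2) * (1 - \<alpha>)))"
proof -
  obtain K where K: "0 \<le> K" "\<And>h \<epsilon>. h > 0 \<Longrightarrow> \<epsilon> > 0 \<Longrightarrow>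
    (\<integral>\<^sup>+\<xi>\<in>cbox 0 1. \<integral>\<^sup>+\<eta>. ennreal (\<bar>implicit_boundary_integral (closed_segment a b) n \<theta> \<epsilon> h f \<eta> \<xi>
        - segment_integral a b f\<bar>\<^sup>2) \<partial>\<mu> \<partial>lborel)
      \<le> ennreal (K * (h ^ 3 / \<epsilon> + h ^ (2 * q + 3) / \<epsilon> ^ (2 * q + 2)))"
    using implicit_boundary_variance_le[OF assms(2-6,9)] by blast
  obtain c where c: "c > 0" and width: "\<forall>\<^sub>F h in at_right 0. c * h powr \<alpha> \<le> \<epsilon> h"
    using assms(8) by (auto simp: eventually_conj_iff)
  have "\<forall>\<^sub>F h in at_right 0. h \<in> {0<..<1::real}"
    by (rule eventually_at_right_real) simp
  with width show ?thesis
  proof (intro bigoI[where c = "K * (1 / c + 1 / c ^ (2 * q + 2))"], eventually_elim)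
    case (elim h)
    let ?E = "h ^ 3 / \<epsilon> h + h ^ (2 * q + 3) / \<epsilon> h ^ (2 * q + 2)"
    let ?L = "LINT \<xi>:cbox 0 1|lborel. LINT \<eta>|\<mu>.
            \<bar>implicit_boundary_integral \<Gamma> n \<theta> (\<epsilon> h) h f \<eta> \<xi> - segment_integral a b f\<bar>\<^sup>2"
    have h: "0 < h" "h < 1" using elim by auto
    have "0 < c * h powr \<alpha>" using c h by simp
    then have e: "0 < \<epsilon> h" using elim by linarith
    have "0 \<le> K * ?E" using K(1) h e by simp
    \<comment> \<open>With \<open>h\<close> and its width inserted, one instance yields both the
      sign and the upper bound of the Bochner integral.\<close>
    note bound = iterated_integral_le[OF _ this K(2)[OF h(1) e]]
    have L: "0 \<le> ?L" "?L \<le> K * ?E"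
      unfolding assms(1) by (rule bound; simp)+
    note L(2)
    also have "K * ?E \<le> K * ((1 / c + 1 / c ^ (2 * q + 2)) * h powr
              (if \<alpha> < 2 * real q / (2 * real q + 1) then 3 - \<alpha>
               else 1 + (2 * real q + 2) * (1 - \<alpha>)))"
      using elim by (intro mult_left_mono width_powr_bounds h c K(1)) auto
    finally show ?case using L(1) by (simp add: mult.assoc)
  qed
qed

end
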